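(* Let $\mathfrak{g}=\mathfrak{sl}_2(\mathbb{C})$, and for $z$ in the center $\mathfrak{Z}(\mathfrak{U}\mathfrak{g})$ of $\mathfrak{U}\mathfrak{g}$ let $H_z$ be the infinitesimal Hecke algebra of $\mathfrak{sl}_2$ with parameter $z$; write $H=H_0=\mathfrak{U}(\mathfrak{g}\ltimes V)$. (1) If $z\neq 0$, then $H_z$ has no outer derivations, i.e. every $\mathbb{C}$-linear derivation $H_z\to H_z$ is inner. (2) The first Hochschild cohomology $H^1(H,H)$ (the $\mathbb{C}$-linear derivations of $H$ modulo inner derivations) is a free module of rank $1$ over the center of $H$.
   Context: Let $\mathfrak{g}=\mathfrak{sl}_2(\mathbb{C})$ with standard basis $e,f,h$ ($[h,e]=2e$, $[h,f]=-2f$, $[e,f]=h$), and let $V$ be its two-dimensional irreducible representation over $\mathbb{C}$ with basis $x,y$, where $e\cdot x=0$, $e\cdot y=x$, $f\cdot x=y$, $f\cdot y=0$, $h\cdot x=x$, $h\cdot y=-y$. Let $TV$ be the tensor algebra of $V$. For $z\in\mathfrak{Z}(\mathfrak{U}\mathfrak{g})$, $H_z$ is the quotient of the semidirect product $\mathfrak{U}\mathfrak{g}\ltimes TV$ (in which $[a,v]=a\cdot v$ for $a\in\mathfrak{g}$, $v\in V$) by the two-sided ideal generated by $xy-yx-z$. Thus $H_z$ is the associative unital $\mathbb{C}$-algebra generated by $e,f,h,x,y$ with the $\mathfrak{sl}_2$ relations, the relations $[e,x]=0$, $[e,y]=x$, $[f,x]=y$, $[f,y]=0$, $[h,x]=x$,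 $[h,y]=-y$, and $[x,y]=z$. For $z=0$ this is $H=H_0=\mathfrak{U}(\mathfrak{g}\ltimes V)$, the enveloping algebra of the semidirect product Lie algebra in which $V$ is an abelian ideal. An inner derivation is one of the form $b\mapsto [a,b]$ for a fixed element $a$ of the algebra. The center of $H$ acts on derivations of $H$ by multiplication, $(cD)(b)=c\,D(b)$; this preserves inner derivations and so induces the module structure on $H^1(H,H)$. *)

theory Defs
  imports Complex_Main "HOL-Library.Poly_Mapping" "HOL-Library.FuncSet" "HOL-Algebra.Module" "HOL-Algebra.QuotRing"
begin

section \<open>Associative algebras over the complex numbers\<close>

text \<open>
  A complex associative algebra is a record of type \<open>(complex, 'a) module\<close>: the ring part is the
  (possibly noncommutative) algebra and \<open>smult\<close> is the action of the scalars. The same record type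
  serves for modules over a ring, in which case \<open>mult\<close> and \<open>one\<close> are irrelevant.
\<close>

definition quot_module :: "('k, 'a) module \<Rightarrow> 'a set \<Rightarrow> ('k, 'a set) module" where
  "quot_module M N =
     \<lparr>carrier = carrier (M Quot N), monoid.mult = monoid.mult (M Quot N), one = one (M Quot N),
      zero = zero (M Quot N), add = add (M Quot N),
      smult = (\<lambda>c A. \<Union>a\<in>A. N +>\<^bsub>M\<^esub> (c \<odot>\<^bsub>M\<^esub> a))\<rparr>"


subsection \<open>Free algebras and presentations\<close>

text \<open>
  The datatype wrapper makes the free monoid an instance of \<^class>\<open>monoid_add\<close> (written additively,
  with concatenation as addition), so that the convolution product of \<^theory>\<open>HOL-Library.Poly_Mapping\<close>
  on \<open>'g word \<Rightarrow>\<^sub>0 complex\<close> is the product of noncommutative polynomials.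
\<close>

datatype 'g word = Word (letters: "'g list")

instantiation word :: (type) monoid_add
begin

definition zero_word :: "'a word" where
  "zero_word = Word []"

definition plus_word :: "'a word \<Rightarrow> 'a word \<Rightarrow> 'a word" where
  "plus_word u v = Word (letters u @ letters v)"

instance
  by standard (simp_all add: zero_word_def plus_word_def)

end

type_synonym 'g ncpoly = "'g word \<Rightarrow>\<^sub>0 complex"

definition gen :: "'g \<Rightarrow> 'g ncpoly" where
  "gen g = Poly_Mapping.single (Word [g]) 1"

definition free_alg :: "'g set \<Rightarrow> (complex, 'g ncpoly) module" where
  "free_alg S =
     \<lparr>carrier = {p. \<forall>w\<in>Poly_Mapping.keys p. set (letters w) \<subseteq> S},
      monoid.mult = (*), one = 1, zero = 0, add = (+),
      smult = (\<lambda>c p. Poly_Mapping.map ((*) c) p)\<rparr>"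

text \<open>The unital algebra generated by \<open>S\<close> subject to the relations \<open>r = 0\<close> for \<open>r \<in> R\<close>.\<close>

definition presented_alg :: "'g set \<Rightarrow> 'g ncpoly set \<Rightarrow> (complex, 'g ncpoly set) module" where
  "presented_alg S R = quot_module (free_alg S) (Idl\<^bsub>free_alg S\<^esub> R)"


subsection \<open>Center, derivations and the first Hochschild cohomology\<close>

definition center :: "('a, 'm) ring_scheme \<Rightarrow> 'a set" where
  "center A = {c \<in> carrier A. \<forall>a\<in>carrier A. c \<otimes>\<^bsub>A\<^esub> a = a \<otimes>\<^bsub>A\<^esub> c}"

definition center_ring :: "('a, 'm) ring_scheme \<Rightarrow> ('a, 'm) ring_scheme" where
  "center_ring A = A\<lparr>carrier := center A\<rparr>"

text \<open>
  Maps between carriers are taken to be extensional (\<open>undefined\<close> outside the carrier), so that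
  two derivations are equal as soon as they agree on the algebra.
\<close>

definition derivations :: "(complex, 'a) module \<Rightarrow> ('a \<Rightarrow> 'a) set" where
  "derivations A = {D \<in> carrier A \<rightarrow>\<^sub>E carrier A.
     (\<forall>a\<in>carrier A. \<forall>b\<in>carrier A. D (a \<oplus>\<^bsub>A\<^esub> b) = D a \<oplus>\<^bsub>A\<^esub> D b) \<and>
     (\<forall>c. \<forall>a\<in>carrier A. D (c \<odot>\<^bsub>A\<^esub> a) = c \<odot>\<^bsub>A\<^esub> D a) \<and>
     (\<forall>a\<in>carrier A. \<forall>b\<in>carrier A.
        D (a \<otimes>\<^bsub>A\<^esub> b) = D a \<otimes>\<^bsub>A\<^esub> b \<oplus>\<^bsub>A\<^esub> a \<otimes>\<^bsub>A\<^esub> D b)}"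

definition inner_derivation :: "('a, 'm) ring_scheme \<Rightarrow> 'a \<Rightarrow> 'a \<Rightarrow> 'a" where
  "inner_derivation A a = (\<lambda>b\<in>carrier A. a \<otimes>\<^bsub>A\<^esub> b \<ominus>\<^bsub>A\<^esub> b \<otimes>\<^bsub>A\<^esub> a)"

definition inner_derivations :: "('a, 'm) ring_scheme \<Rightarrow> ('a \<Rightarrow> 'a) set" where
  "inner_derivations A = inner_derivation A ` carrier A"

text \<open>The derivations of \<open>A\<close>, as a module over \<open>center_ring A\<close>.\<close>

definition derivation_module :: "(complex, 'a) module \<Rightarrow> ('a, 'a \<Rightarrow> 'a) module" where
  "derivation_module A =
     \<lparr>carrier = derivations A, monoid.mult = undefined, one = undefined,
      zero = (\<lambda>b\<in>carrier A. \<zero>\<^bsub>A\<^esub>),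
      add = (\<lambda>D E. \<lambda>b\<in>carrier A. D b \<oplus>\<^bsub>A\<^esub> E b),
      smult = (\<lambda>c D. \<lambda>b\<in>carrier A. c \<otimes>\<^bsub>A\<^esub> D b)\<rparr>"

definition HH1 :: "(complex, 'a) module \<Rightarrow> ('a, ('a \<Rightarrow> 'a) set) module" where
  "HH1 A = quot_module (derivation_module A) (inner_derivations A)"

text \<open>\<open>M\<close> is a module over \<open>R\<close> possessing a basis of \<open>n\<close> elements.\<close>

definition free_module_of_rank ::
    "('r, 'm) ring_scheme \<Rightarrow> ('r, 'a, 'n) module_scheme \<Rightarrow> nat \<Rightarrow> bool" where
  "free_module_of_rank R M n \<longleftrightarrow> module R M \<and>
     (\<exists>u \<in> {..<n} \<rightarrow> carrier M. \<forall>m\<in>carrier M.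
        \<exists>!c. c \<in> {..<n} \<rightarrow>\<^sub>E carrier R \<and> m = (\<Oplus>\<^bsub>M\<^esub>i\<in>{..<n}. c i \<odot>\<^bsub>M\<^esub> u i))"


section \<open>Infinitesimal Hecke algebras of sl2\<close>

datatype sl2V = Ge | Gf | Gh | Gx | Gy

definition comm :: "'a::ring \<Rightarrow> 'a \<Rightarrow> 'a" where
  "comm a b = a * b - b * a"

definition sl2_relations :: "sl2V ncpoly set" where
  "sl2_relations =
     {comm (gen Gh) (gen Ge) - 2 * gen Ge,
      comm (gen Gh) (gen Gf) + 2 * gen Gf,
      comm (gen Ge) (gen Gf) - gen Gh}"

definition action_relations :: "sl2V ncpoly set" where
  "action_relations =
     {comm (gen Ge) (gen Gx),
      comm (gen Ge) (gen Gy) - gen Gx,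
      comm (gen Gf) (gen Gx) - gen Gy,
      comm (gen Gf) (gen Gy),
      comm (gen Gh) (gen Gx) - gen Gx,
      comm (gen Gh) (gen Gy) + gen Gy}"

text \<open>The universal enveloping algebra of \<open>sl2\<close>.\<close>

definition U_sl2 :: "(complex, sl2V ncpoly set) module" where
  "U_sl2 = presented_alg {Ge, Gf, Gh} sl2_relations"

text \<open>
  An element \<open>z\<close> of \<^const>\<open>U_sl2\<close> is a coset, i.e. the set of all noncommutative polynomials in
  \<open>e, f, h\<close> representing it. The relation \<open>[x, y] = z\<close> is imposed for every representative; since
  representatives differ by consequences of the sl2 relations, a single one would suffice.
\<close>

definition inf_hecke :: "sl2V ncpoly set \<Rightarrow> (complex, sl2V ncpoly set) module" where
  "inf_hecke z = presented_alg UNIV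
     (sl2_relations \<union> action_relations \<union> {comm (gen Gx) (gen Gy) - w | w. w \<in> z})"

end

theory Submission
  imports Defs "HOL-Computational_Algebra.Polynomial"
begin

text \<open>
  Write \<open>s\<^sup>2\<close> for the Casimir element, normalised to act by \<open>(k + 1)\<^sup>2\<close> on highest weight vectors of
  weight \<open>k\<close>. The algebra is the sum of the sl2-modules generated by the highest weight vectors
  \<open>e\<^sup>a x\<^sup>d w\<^sup>\<epsilon> c\<close> with \<open>\<epsilon> \<le> 1\<close>, where \<open>w = [s\<^sup>2, x]\<close> and \<open>c\<close> is a polynomial in \<open>s\<^sup>2\<close> and a central
  element \<open>t\<close>. A derivation can be made to vanish on sl2, and then sends \<open>x\<close> to a highest weight vector of
  weight 1, that is to \<open>P x\<close> with \<open>P\<close> a polynomial in \<open>s\<close> and \<open>t\<close>. The part of \<open>P\<close> that is antisymmetric under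
  \<open>s \<mapsto> -1 - s\<close> comes from inner derivations by polynomials in \<open>s\<^sup>2\<close> and \<open>t\<close>. For symmetric \<open>P\<close>, applying the
  derivation to \<open>[x, y] = z\<close> in Gelfand-Tsetlin modules says that \<open>(G + \<tau>) P\<close> is constant in \<open>s\<close>, where
  \<open>G(s) - G(s - 1) = s z(s\<^sup>2)\<close> and \<open>\<tau> = t / 4\<close> is arbitrary. If \<open>z \<noteq> 0\<close>, then \<open>G\<close> is not constant and \<open>P = 0\<close>; if
  \<open>z = 0\<close>, then \<open>P\<close> is a polynomial in \<open>t\<close> and the derivation is a central multiple of the Euler derivation.
\<close>

section \<open>Algebras over the complex numbers\<close>

text \<open>The argument does not rest on a PBW basis. The sum of the highest weight modules is only
  shown to span, by closing it under left multiplication by the generators; whatever must be nonzero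
  is detected on Gelfand-Tsetlin modules, where \<open>t\<close> acts by the scalar 4 \<tau>, so
  that polynomials in \<open>t\<close> are recovered from their values. The element \<open>s\<close>
  is not in the algebra. It acts on multiples of \<open>x\<close> only, because tensoring with V
  moves the square root of the Casimir element by one: right multiplication by \<open>cas\<close> is
  s^2, left multiplication is (s + 1)^2. The reflection of s to -1 - s exchanges the two, so
  [r(s^2), x] is antisymmetric; conversely, summing an antisymmetric polynomial over s and taking
  the even part of the sum produces r. A derivation that kills sl2 commutes with ad \<open>e\<close>
  and ad \<open>h\<close>, which is why it keeps \<open>x\<close> of highest weight 1. The function
  G comes from the modules: one of the two coefficients of \<open>x\<close> is normalised to 1, the
  other is then G(s - 1) / (s (s - 1)), and [x, y] = z becomes the difference equation for G, with
  \<tau> as its constant of summation.\<close>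

class complex_algebra = ring_1 +
  fixes scaleC :: "complex \<Rightarrow> 'a \<Rightarrow> 'a"  (infixr "*\<^sub>C" 75)
  assumes scaleC_add_right: "c *\<^sub>C (a + b) = c *\<^sub>C a + c *\<^sub>C b"
    and scaleC_add_left: "(c + d) *\<^sub>C a = c *\<^sub>C a + d *\<^sub>C a"
    and scaleC_scaleC [simp]: "c *\<^sub>C d *\<^sub>C a = (c * d) *\<^sub>C a"
    and scaleC_one [simp]: "1 *\<^sub>C a = a"
    and mult_scaleC_left [simp]: "(c *\<^sub>C a) * b = c *\<^sub>C (a * b)"
    and mult_scaleC_right [simp]: "a * (c *\<^sub>C b) = c *\<^sub>C (a * b)"
begin

lemma scaleC_zero_left [simp]: "0 *\<^sub>C a = 0"
  using scaleC_add_left[of 0 0 a] by simp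

lemma scaleC_zero_right [simp]: "c *\<^sub>C 0 = 0"
  using scaleC_add_right[of c 0 0] by simp

lemma scaleC_minus_right [simp]: "c *\<^sub>C (- a) = - (c *\<^sub>C a)"
  using scaleC_add_right[of c a "- a"] by (simp add: eq_neg_iff_add_eq_0 add.commute)

lemma scaleC_minus_left [simp]: "(- c) *\<^sub>C a = - (c *\<^sub>C a)"
  using scaleC_add_left[of c "- c" a] by (simp add: eq_neg_iff_add_eq_0 add.commute)

lemma scaleC_diff_right: "c *\<^sub>C (a - b) = c *\<^sub>C a - c *\<^sub>C b"
  using scaleC_add_right[of c a "- b"] by simp

lemma scaleC_diff_left: "(c - d) *\<^sub>C a = c *\<^sub>C a - d *\<^sub>C a"
  using scaleC_add_left[of c "- d" a] by simp

lemma scaleC_sum_right: "c *\<^sub>C sum g A = (\<Sum>i\<in>A. c *\<^sub>C g i)"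
  by (induction A rule: infinite_finite_induct) (simp_all add: scaleC_add_right)

lemma scaleC_eq_0_iff [simp]: "c *\<^sub>C a = 0 \<longleftrightarrow> c = 0 \<or> a = 0"
proof
  assume *: "c *\<^sub>C a = 0"
  have "inverse c *\<^sub>C c *\<^sub>C a = 0"
    unfolding * by simp
  then show "c = 0 \<or> a = 0"
    by (cases "c = 0") simp_all
qed auto

end

lemma scaleC_numeral: "numeral n *\<^sub>C a = numeral n * (a::'a::complex_algebra)"
proof (induction n)
  case (Bit0 n)
  show ?case
    by (simp only: numeral_Bit0 scaleC_add_left Bit0 distrib_right)
next
  case (Bit1 n)
  show ?case
    by (simp only: numeral_Bit1 scaleC_add_left Bit1 distrib_right scaleC_one mult_1_left)
qed simp

lemma numeral_scaleC: "numeral n * (a::'a::complex_algebra) = numeral n *\<^sub>C a"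
  by (simp add: scaleC_numeral)

lemma comm_add_right: "comm a (b + c) = comm a b + comm (a::'a::ring) c"
  and comm_diff_right: "comm a (b - c) = comm a b - comm a c"
  and comm_minus_right: "comm a (- b) = - comm a b"
  and comm_add_left: "comm (a + b) c = comm a c + comm b c"
  and comm_diff_left: "comm (a - b) c = comm a c - comm b c"
  and comm_zero_right [simp]: "comm a 0 = 0"
  and comm_zero_left [simp]: "comm 0 a = 0"
  and comm_self [simp]: "comm a a = 0"
  by (simp_all add: comm_def algebra_simps)

lemma comm_mult_right: "comm a (b * c) = comm a b * c + b * comm (a::'a::ring) c"
  and comm_mult_left: "comm (b * c) a = comm b a * c + b * comm c a"
  by (simp_all add: comm_def algebra_simps)

lemma comm_jacobi: "comm a (comm b c) = comm (comm a b) c + comm b (comm (a::'a::ring) c)"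
  by (simp add: comm_def algebra_simps)

lemma comm_swap: "comm b a = - comm (a::'a::ring) b"
  by (simp add: comm_def)

lemma comm_scaleC_right [simp]: "comm a (c *\<^sub>C b) = c *\<^sub>C comm (a::'a::complex_algebra) b"
  and comm_scaleC_left [simp]: "comm (c *\<^sub>C a) b = c *\<^sub>C comm a b"
  by (simp_all add: comm_def scaleC_diff_right)

lemma comm_one [simp]: "comm a (1::'a::ring_1) = 0" "comm (1::'a::ring_1) a = 0"
  by (simp_all add: comm_def)

lemma comm_sum_right: "comm a (sum g A) = (\<Sum>i\<in>A. comm (a::'a::ring) (g i))"
  by (induction A rule: infinite_finite_induct) (simp_all add: comm_add_right)

lemma comm_eq_0_iff: "comm a b = 0 \<longleftrightarrow> a * b = b * (a::'a::ring)"
  by (simp add: comm_def)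

section \<open>Evaluation of polynomials at elements of an algebra\<close>

definition peval :: "'a::complex_algebra \<Rightarrow> complex poly \<Rightarrow> 'a" where
  "peval a p = fold_coeffs (\<lambda>k b. k *\<^sub>C 1 + a * b) p 0"

lemma peval_0 [simp]: "peval a 0 = 0"
  by (simp add: peval_def)

lemma peval_pCons [simp]: "peval a (pCons k p) = k *\<^sub>C 1 + a * peval a p"
  by (cases "k = 0 \<and> p = 0") (auto simp: peval_def)

lemma peval_1 [simp]: "peval a 1 = 1"
  by (simp add: one_pCons)

lemma peval_add: "peval a (p + q) = peval a p + peval a q"
  by (induction p q rule: poly_induct2) (simp_all add: algebra_simps scaleC_add_left)

lemma peval_smult [simp]: "peval a (smult c p) = c *\<^sub>C peval a p"
  by (induction p) (simp_all add: scaleC_add_right)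

lemma peval_commute: "comm b a = 0 \<Longrightarrow> comm b (peval a p) = 0"
  by (induction p) (simp_all add: comm_add_right comm_mult_right)

lemma peval_mult: "peval a (p * q) = peval a p * peval a q"
  by (induction p) (simp_all add: peval_add distrib_right mult.assoc)

text \<open>The inner polynomials are evaluated at \<open>a\<close> and the outer variable at
  \<open>t\<close>. It is used with \<open>a = cas\<close> and the central element \<open>t\<close>,
  so its values are the sl2-invariants of the algebra.\<close>

definition peval2 :: "'a::complex_algebra \<Rightarrow> 'a \<Rightarrow> complex poly poly \<Rightarrow> 'a" where
  "peval2 a t P = fold_coeffs (\<lambda>p b. peval a p + t * b) P 0"

lemma peval2_0 [simp]: "peval2 a t 0 = 0"
  by (simp add: peval2_def)

lemma peval2_pCons [simp]: "peval2 a t (pCons p P) = peval a p + t * peval2 a t P"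
  by (cases "p = 0 \<and> P = 0") (auto simp: peval2_def)

lemma peval2_add: "peval2 a t (P + Q) = peval2 a t P + peval2 a t Q"
  by (induction P Q rule: poly_induct2) (simp_all add: peval_add algebra_simps)

lemma peval2_smult: "comm a t = 0 \<Longrightarrow> peval2 a t (smult r P) = peval a r * peval2 a t P"
proof (induction P)
  case (pCons p P)
  have "peval a r * t = t * peval a r"
    using peval_commute[of t a r] pCons(3) by (simp add: comm_def)
  then show ?case
    using pCons by (simp add: peval_mult distrib_left mult.assoc[symmetric])
qed simp

lemma peval2_commute: "comm b a = 0 \<Longrightarrow> comm b t = 0 \<Longrightarrow> comm b (peval2 a t P) = 0"
  by (induction P) (simp_all add: comm_add_right comm_mult_right peval_commute)

section \<open>Identities in infinitesimal Hecke algebras\<close>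

text \<open>Reordering products leaves equal terms with differently grouped numeral coefficients.
  Splitting numerals into repeated sums reduces the remaining goal to an identity in an abelian
  group.\<close>

lemma scaleC_expand:
  "numeral (num.Bit0 n) *\<^sub>C a = numeral n *\<^sub>C a + numeral n *\<^sub>C (a::'a::complex_algebra)"
  "numeral (num.Bit1 n) *\<^sub>C a = numeral n *\<^sub>C a + numeral n *\<^sub>C a + a"
  "numeral num.One *\<^sub>C a = a"
  by (simp_all only: numeral_Bit0 numeral_Bit1 scaleC_add_left numeral_One scaleC_one)

locale sl2_triple =
  fixes e f h :: "'a::complex_algebra"
  assumes comm_he: "comm h e = 2 *\<^sub>C e"
    and comm_hf: "comm h f = - (2 *\<^sub>C f)"
    and comm_ef: "comm e f = h"
begin

lemma sl2_order: "h * e = e * h + 2 *\<^sub>C e" "f * h = h * f + 2 *\<^sub>C f" "f * e = e * f - h"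
  using comm_he comm_hf comm_ef by (simp_all add: comm_def algebra_simps)

lemma sl2_order': "h * (e * u) = e * (h * u) + 2 *\<^sub>C (e * u)" "f * (h * u) = h * (f * u) + 2 *\<^sub>C (f * u)"
    "f * (e * u) = e * (f * u) - h * u"
  using sl2_order by (simp_all add: mult.assoc[symmetric] distrib_right left_diff_distrib)

text \<open>Four times the Casimir element plus one, which acts by \<open>(k + 1)\<^sup>2\<close> on highest weight vectors of weight \<open>k\<close>.\<close>

definition cas :: 'a where
  "cas = h * h + 2 *\<^sub>C h + 1 + 4 *\<^sub>C (f * e)"

lemma comm_cas [simp]: "comm e cas = 0" "comm h cas = 0" "comm f cas = 0"
  unfolding cas_def
  by (simp_all add: comm_def sl2_order sl2_order' algebra_simps scaleC_add_right scaleC_diff_right)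
     (simp_all add: scaleC_expand)

end

text \<open>The equation for \<open>zt\<close> expresses that \<open>x wy - y w + zt(cas)\<close> is central, see \<open>t\<close> below.\<close>

locale hecke = sl2_triple +
  fixes x y :: "'a::complex_algebra" and zp zt :: "complex poly"
  assumes comm_ex: "comm e x = 0" and comm_ey: "comm e y = x"
    and comm_fx: "comm f x = y" and comm_fy: "comm f y = 0"
    and comm_hx: "comm h x = x" and comm_hy: "comm h y = - y"
    and comm_xy: "comm x y = peval cas zp"
    and zt: "pcompose zt [:1, 2, 1:] - pcompose zt [:0, 0, 1:]
      = - ([:3, 2:] * pcompose zp [:1, 2, 1:] + [:-1, 2:] * pcompose zp [:0, 0, 1:])"
begin

definition z :: 'a where "z = peval cas zp"

lemma comm_z [simp]: "comm e z = 0" "comm h z = 0" "comm f z = 0" "comm cas z = 0"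
  by (simp_all add: z_def peval_commute)

lemma order: "x * e = e * x" "y * e = e * y - x" "x * f = f * x - y" "y * f = f * y"
    "x * h = h * x - x" "y * h = h * y + y" "y * x = x * y - z"
    "z * e = e * z" "z * f = f * z" "z * h = h * z"
  using comm_ex comm_ey comm_fx comm_fy comm_hx comm_hy comm_xy comm_z
  by (simp_all add: comm_def z_def[symmetric] algebra_simps)

lemma order': "x * (e * u) = e * (x * u)" "y * (e * u) = e * (y * u) - x * u"
    "x * (f * u) = f * (x * u) - y * u" "y * (f * u) = f * (y * u)"
    "x * (h * u) = h * (x * u) - x * u" "y * (h * u) = h * (y * u) + y * u"
    "y * (x * u) = x * (y * u) - z * u"
    "z * (e * u) = e * (z * u)" "z * (f * u) = f * (z * u)" "z * (h * u) = h * (z * u)"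
  using order by (simp_all add: mult.assoc[symmetric] distrib_right left_diff_distrib)

lemmas normal_order = sl2_order sl2_order' order order' algebra_simps scaleC_add_right scaleC_diff_right

definition w :: 'a where "w = comm cas x"
definition wy :: 'a where "wy = comm cas y"

lemma w_eq: "w = 2 *\<^sub>C (h * x) + 4 *\<^sub>C (e * y) - 3 *\<^sub>C x"
  unfolding w_def cas_def comm_def
  by (simp add: normal_order) (simp add: scaleC_expand)

lemma wy_eq: "wy = 4 *\<^sub>C (f * x) - 2 *\<^sub>C (h * y) - 3 *\<^sub>C y"
  unfolding wy_def cas_def comm_def
  by (simp add: normal_order) (simp add: scaleC_expand)

lemma comm_w: "comm e w = 0" "comm h w = w" "comm f w = wy" "comm e wy = w"
    "comm h wy = - wy" "comm f wy = 0"
  by (simp_all add: w_def wy_def comm_jacobi comm_ex comm_hx comm_fx comm_ey comm_fy comm_hy comm_minus_right)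

text \<open>Left and right multiplication by \<open>cas\<close> on \<open>x\<close> behave like L =
  (s + 1)^2 and R = s^2, so L - R = 2 s + 1 and (L - R)^2 = 4 L - 1 - 2 (L - R), where
  \<open>s\<close> no longer occurs. This quadratic equation is what provides the square root
  \<open>s\<close>.\<close>

lemma comm_cas_w: "comm cas w = 4 *\<^sub>C (cas * x) - x - 2 *\<^sub>C w"
proof -
  have "comm cas w = 2 *\<^sub>C (h * w) + 4 *\<^sub>C (e * wy) - 3 *\<^sub>C w"
    unfolding w_eq[THEN arg_cong, of "comm cas"]
    using comm_swap[of cas e] comm_swap[of cas h]
    by (simp add: comm_diff_right comm_add_right comm_mult_right w_def wy_def)
  also have "\<dots> = 4 *\<^sub>C (cas * x) - x - 2 *\<^sub>C w"
    unfolding w_eq wy_eq cas_def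
    by (simp add: normal_order) (simp add: scaleC_expand)
  finally show ?thesis .
qed

lemma cas_x: "cas * x = x * cas + w"
  by (simp add: w_def comm_def)

lemma cas_w: "cas * w = w * cas + 4 *\<^sub>C (x * cas) + 2 *\<^sub>C w - x"
proof -
  have "cas * w = w * cas + comm cas w" by (simp add: comm_def)
  then show ?thesis
    by (simp add: comm_cas_w cas_x scaleC_add_right) (simp add: scaleC_expand)
qed

text \<open>Together with \<open>w_w\<close> this rewrites products of \<open>x\<close> and
  \<open>w\<close> so that \<open>w\<close> occurs at most once and to the right of all
  \<open>x\<close>. The price is a term with \<open>e\<close>, in which the parameter
  \<open>z\<close> or the invariant \<open>om\<close> appears.\<close>

lemma w_x: "w * x = x * w + 2 *\<^sub>C (x * x) - 4 *\<^sub>C (e * z)"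
  unfolding w_eq by (simp add: normal_order)

definition om :: 'a where "om = x * wy - y * w"

lemma comm_om [simp]: "comm e om = 0" "comm h om = 0" "comm f om = 0"
  by (simp_all add: om_def comm_diff_right comm_mult_right comm_w comm_ex comm_ey comm_fx comm_fy comm_hx comm_hy)

lemma w_w: "w * w = 4 *\<^sub>C (x * x * cas) - x * x + 4 *\<^sub>C (x * w) - 4 *\<^sub>C (e * om)"
proof -
  have 1: "4 *\<^sub>C (e * wy) = comm cas w - 2 *\<^sub>C (h * w) + 3 *\<^sub>C w"
  proof -
    have "comm cas w = 2 *\<^sub>C (h * w) + 4 *\<^sub>C (e * wy) - 3 *\<^sub>C w"
      unfolding w_eq[THEN arg_cong, of "comm cas"]
      using comm_swap[of cas e] comm_swap[of cas h]
      by (simp add: comm_diff_right comm_add_right comm_mult_right w_def wy_def)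
    then show ?thesis by simp
  qed
  have "4 *\<^sub>C (e * om) = x * (4 *\<^sub>C (e * wy)) - (4 *\<^sub>C (e * y)) * w"
    unfolding om_def by (simp add: algebra_simps scaleC_diff_right order')
  also have "\<dots> = x * comm cas w - (2 *\<^sub>C (h * x) + 4 *\<^sub>C (e * y) - 5 *\<^sub>C x) * w"
    unfolding 1 by (simp add: algebra_simps scaleC_diff_right order') (simp add: scaleC_expand)
  also have "\<dots> = x * comm cas w - (w - 2 *\<^sub>C x) * w"
    unfolding w_eq by (simp add: algebra_simps) (simp add: scaleC_expand)
  finally show ?thesis
    unfolding comm_cas_w cas_x
    by (simp add: algebra_simps scaleC_add_right)
qed

lemma comm_om_x: "comm om x = z * w + w * z + 2 *\<^sub>C (z * x) - 2 *\<^sub>C (x * z)"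
  unfolding om_def comm_def w_eq wy_eq
  by (simp add: normal_order) (simp add: scaleC_expand)

text \<open>This is the contribution of the factor \<open>e\<close> when \<open>lw\<close> is
  applied to \<open>e * n\<close>; it is a combination of \<open>x\<close> and \<open>w\<close>, so
  multiplying it by \<open>n\<close> gives a highest weight vector again.\<close>

lemma y_e: "x * comm f e - 2 *\<^sub>C (y * e) = (1/2) *\<^sub>C (3 *\<^sub>C x - w)"
proof -
  have "2 *\<^sub>C (x * comm f e - 2 *\<^sub>C (y * e)) = 3 *\<^sub>C x - w"
    unfolding w_eq using comm_swap[of f e] comm_ef
    by (simp add: normal_order) (simp add: scaleC_expand)
  from arg_cong[OF this, of "\<lambda>u. (1/2) *\<^sub>C u"] show ?thesis by simp
qed

end

section \<open>A square root of the Casimir element acting on multiples of x\<close>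

context hecke
begin

text \<open>The map \<open>X\<close> turns \<open>p(s)\<close> into \<open>x p(s)\<close>, where \<open>s\<close> is a square root of \<open>cas\<close> acting from the right: right
  multiplication by \<open>cas\<close> is multiplication by \<open>s\<^sup>2\<close>, and left multiplication is multiplication by \<open>(s + 1)\<^sup>2\<close>.
  The two components of \<open>XX p\<close> are \<open>X p\<close> and \<open>X (s p)\<close>.\<close>

definition x1 :: 'a where "x1 = (1/2) *\<^sub>C (w - x)"

definition XX :: "complex poly \<Rightarrow> 'a \<times> 'a" where
  "XX p = fold_coeffs (\<lambda>k (u, v). (k *\<^sub>C x + v, k *\<^sub>C x1 + u * cas)) p (0, 0)"

definition X :: "complex poly \<Rightarrow> 'a" where "X p = fst (XX p)"

lemma XX_pCons: "XX (pCons k p) = (k *\<^sub>C x + snd (XX p), k *\<^sub>C x1 + fst (XX p) * cas)"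
  by (cases "k = 0 \<and> p = 0") (auto simp: XX_def case_prod_beta)

lemma XX_0: "XX 0 = (0, 0)"
  by (simp add: XX_def)

lemma X_0 [simp]: "X 0 = 0"
  by (simp add: X_def XX_0)

lemma X_pCons: "X (pCons k p) = k *\<^sub>C x + X (pCons 0 p)"
  by (simp add: X_def XX_pCons)

lemma X_pCons_0_pCons: "X (pCons 0 (pCons k p)) = k *\<^sub>C x1 + X p * cas"
  by (simp add: X_def XX_pCons)

lemma X_add_aux: "X (p + q) = X p + X q \<and> X (pCons 0 (p + q)) = X (pCons 0 p) + X (pCons 0 q)"
proof (induction p q rule: poly_induct2)
  case (pCons a p b q)
  then show ?case
    using X_pCons[of a p] X_pCons[of b q] X_pCons[of "a + b" "p + q"]
    by (simp add: X_pCons_0_pCons scaleC_add_left distrib_right)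
qed simp

lemma X_add: "X (p + q) = X p + X q"
  using X_add_aux by blast

lemma X_smult_aux: "X (smult c p) = c *\<^sub>C X p \<and> X (pCons 0 (smult c p)) = c *\<^sub>C X (pCons 0 p)"
proof (induction p)
  case (pCons a p)
  then show ?case
    using X_pCons[of a p] X_pCons[of "c * a" "smult c p"]
    by (simp add: X_pCons_0_pCons scaleC_add_right)
qed simp

lemma X_smult: "X (smult c p) = c *\<^sub>C X p"
  using X_smult_aux by blast

lemma X_minus: "X (- p) = - X p"
  using X_smult[of "-1" p] by simp

lemma X_diff: "X (p - q) = X p - X q"
  using X_add[of p "- q"] by (simp add: X_minus)

lemma X_1: "X 1 = x" "X [:1:] = x"
  by (simp_all add: one_pCons X_pCons)

lemma X_s: "X [:0, 1:] = x1"
  using X_pCons_0_pCons[of 1 0] by simp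

lemma X_cas: "X p * cas = X ([:0, 0, 1:] * p)"
  using X_pCons_0_pCons[of 0 p] by simp

lemma x1_cas: "cas * x1 = x1 * cas + 2 *\<^sub>C (x * cas) + x1"
proof -
  have "2 *\<^sub>C (cas * x1) = 2 *\<^sub>C (x1 * cas + 2 *\<^sub>C (x * cas) + x1)"
    unfolding x1_def
    by (simp add: cas_x cas_w right_diff_distrib left_diff_distrib scaleC_add_right scaleC_diff_right)
       (simp add: scaleC_expand)
  from arg_cong[OF this, of "\<lambda>u. (1/2) *\<^sub>C u"] show ?thesis by simp
qed

text \<open>The recursion for \<open>X\<close> goes down by two degrees, so the claim is carried
  together with its shift by \<open>s\<close>. The polynomial \<open>[:1, 2, 1:]\<close> is (s +
  1)^2.\<close>

lemma cas_X_aux: "cas * X p = X ([:1, 2, 1:] * p) \<and> cas * X (pCons 0 p) = X (pCons 0 ([:1, 2, 1:] * p))"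
proof (induction p)
  case (pCons k p)
  have eq: "[:1, 2, 1:] * pCons k p = smult k [:1, 2, 1:] + pCons 0 ([:1, 2, 1:] * p)"
    by (simp add: mult.commute)
  have w: "w = x + 2 *\<^sub>C x1" by (simp add: x1_def)
  have 1: "X [:1, 2, 1:] = x + 2 *\<^sub>C x1 + x * cas"
    using X_pCons[of 1 "[:2,1:]"] X_pCons_0_pCons[of 2 "[:1:]"] X_1(2) by simp
  have 2: "X (pCons 0 [:1, 2, 1:]) = x1 + 2 *\<^sub>C (x * cas) + x1 * cas"
  proof -
    have "X [:2, 1:] = 2 *\<^sub>C x + x1"
      using X_pCons[of 2 "[:1:]"] X_s by simp
    then show ?thesis
      using X_pCons_0_pCons[of 1 "[:2,1:]"] by (simp add: distrib_right)
  qed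
  have 3: "cas * X (pCons k p) = X ([:1, 2, 1:] * pCons k p)"
    unfolding eq X_add X_smult 1
    using pCons(2) w by (subst X_pCons) (simp add: distrib_left cas_x scaleC_add_right)
  have eq2: "pCons 0 (smult k [:1, 2, 1:] + pCons 0 ([:1, 2, 1:] * p))
     = smult k (pCons 0 [:1, 2, 1:]) + pCons 0 (pCons 0 ([:1, 2, 1:] * p))"
    by simp
  have "X (pCons 0 ([:1, 2, 1:] * pCons k p)) = k *\<^sub>C X (pCons 0 [:1, 2, 1:]) + cas * X p * cas"
    unfolding eq eq2 X_add X_smult using X_pCons_0_pCons[of 0 "[:1, 2, 1:] * p"] pCons(2) by simp
  also have "\<dots> = cas * X (pCons 0 (pCons k p))"
    unfolding 2 by (simp add: X_pCons_0_pCons distrib_left x1_cas scaleC_add_right mult.assoc)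
  finally have "cas * X (pCons 0 (pCons k p)) = X (pCons 0 ([:1, 2, 1:] * pCons k p))"
    by simp
  with 3 show ?case by blast
qed simp

lemma cas_X: "cas * X p = X ([:1, 2, 1:] * p)"
  using cas_X_aux by blast

lemma X_peval: "X p * peval cas r = X (pcompose r [:0, 0, 1:] * p)"
proof (induction r arbitrary: p)
  case (pCons k r)
  have "X p * peval cas (pCons k r) = k *\<^sub>C X p + (X p * cas) * peval cas r"
    by (simp add: distrib_left mult.assoc)
  also have "\<dots> = k *\<^sub>C X p + X (pcompose r [:0, 0, 1:] * ([:0, 0, 1:] * p))"
    by (simp only: X_cas pCons)
  also have "\<dots> = X (pcompose (pCons k r) [:0, 0, 1:] * p)"
    by (simp add: pcompose_pCons X_smult[symmetric] X_add[symmetric] distrib_right ac_simps)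
  finally show ?case .
qed simp

lemma peval_X: "peval cas r * X p = X (pcompose r [:1, 2, 1:] * p)"
proof (induction r)
  case (pCons k r)
  have "peval cas (pCons k r) * X p = k *\<^sub>C X p + cas * X (pcompose r [:1, 2, 1:] * p)"
    using pCons by (simp add: distrib_right mult.assoc)
  also have "\<dots> = X (smult k p + [:1, 2, 1:] * (pcompose r [:1, 2, 1:] * p))"
    by (simp only: cas_X X_add X_smult)
  also have "\<dots> = X (pcompose (pCons k r) [:1, 2, 1:] * p)"
    by (simp only: pcompose_pCons) (simp add: algebra_simps)
  finally show ?case .
qed simp

lemma comm_peval_x: "comm (peval cas r) x = X (pcompose r [:1, 2, 1:] - pcompose r [:0, 0, 1:])"
  using peval_X[of r 1] X_peval[of 1 r] by (simp add: comm_def X_1 X_diff)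

lemma w_X: "w = X [:1, 2:]"
  using X_pCons[of 1 "[:2:]"] X_smult[of 2 "[:0,1:]"] by (simp add: X_s x1_def)

definition t :: 'a where "t = om + peval cas zt"

lemma comm_t [simp]: "comm e t = 0" "comm h t = 0" "comm f t = 0" "comm cas t = 0"
proof -
  show *: "comm e t = 0" "comm h t = 0" "comm f t = 0"
    by (simp_all add: t_def comm_add_right peval_commute)
  then show "comm cas t = 0"
    by (simp add: cas_def comm_add_left comm_mult_left)
qed

text \<open>In \<open>comm_om_x\<close> a factor \<open>z\<close> on the left becomes zp((s + 1)^2),
  on the right zp(s^2), and \<open>w\<close> becomes 2 s + 1. Collecting terms gives (2 s + 3) zp((s
  + 1)^2) + (2 s - 1) zp(s^2), which is what the difference of \<open>zt\<close> cancels.\<close>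

lemma comm_xt [simp]: "comm x t = 0"
proof -
  have "comm om x = X (pcompose zp [:1, 2, 1:] * [:1, 2:]) + X (pcompose zp [:0, 0, 1:] * [:1, 2:])
     + 2 *\<^sub>C X (pcompose zp [:1, 2, 1:]) - 2 *\<^sub>C X (pcompose zp [:0, 0, 1:])"
    unfolding comm_om_x z_def w_X peval_X X_peval using peval_X[of zp 1] X_peval[of 1 zp]
    by (simp add: X_1)
  also have "\<dots> = X ([:3, 2:] * pcompose zp [:1, 2, 1:] + [:-1, 2:] * pcompose zp [:0, 0, 1:])"
  proof -
    have "[:3, 2:] * pcompose zp [:1, 2, 1:] + [:-1, 2:] * pcompose zp [:0, 0, 1:] =
      pcompose zp [:1, 2, 1:] * [:1, 2:] + pcompose zp [:0, 0, 1:] * [:1, 2:]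
      + smult 2 (pcompose zp [:1, 2, 1:]) - smult 2 (pcompose zp [:0, 0, 1:])"
    proof -
      have eqs: "[:3, 2:] = [:1, 2:] + [:2::complex:]" "[:-1, 2:] = [:1, 2:] - [:2::complex:]" "\<And>p. smult 2 p = [:2::complex:] * p"
        by simp_all
      show ?thesis
        unfolding eqs by (simp only: algebra_simps)
    qed
    then show ?thesis
      by (simp only: X_add X_diff X_smult)
  qed
  finally have "comm t x = 0"
    unfolding t_def comm_add_left comm_peval_x zt X_minus by simp
  then show ?thesis
    using comm_swap[of x t] by simp
qed

lemma comm_yt [simp]: "comm y t = 0"
  using comm_jacobi[of f x t] by (simp add: comm_fx)

lemma t_commute: "x * t = t * x" "y * t = t * y" "e * t = t * e" "f * t = t * f" "h * t = t * h"
    "cas * t = t * cas" "w * t = t * w"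
proof -
  show "x * t = t * x" "y * t = t * y" "e * t = t * e" "f * t = t * f" "h * t = t * h" "cas * t = t * cas"
    using comm_t comm_xt comm_yt by (simp_all add: comm_def)
  have "comm t w = 0"
    using comm_jacobi[of t cas x] comm_t(4) comm_xt
    by (simp add: w_def comm_swap[of t cas] comm_swap[of t x])
  then show "w * t = t * w"
    by (simp add: comm_def)
qed

end

section \<open>Highest weight vectors\<close>

context hecke
begin

text \<open>The analogue of \<open>X\<close> for polynomials in \<open>s\<close> with powers of
  \<open>t\<close> as coefficients: the inner variable is \<open>s\<close>, the outer one is
  \<open>t\<close>. These elements turn out to be all highest weight vectors of weight 1.\<close>

definition X2 :: "complex poly poly \<Rightarrow> 'a" where
  "X2 R = fold_coeffs (\<lambda>p b. X p + t * b) R 0"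

lemma X2_0 [simp]: "X2 0 = 0"
  by (simp add: X2_def)

lemma X2_pCons [simp]: "X2 (pCons p R) = X p + t * X2 R"
  by (cases "p = 0 \<and> R = 0") (auto simp: X2_def)

lemma X2_add: "X2 (R + S) = X2 R + X2 S"
  by (induction R S rule: poly_induct2) (simp_all add: X_add algebra_simps)

lemma X2_scale: "\<exists>S. c *\<^sub>C X2 R = X2 S"
proof (induction R)
  case (pCons p R)
  then obtain S where S: "c *\<^sub>C X2 R = X2 S" by blast
  have "c *\<^sub>C X2 (pCons p R) = X2 (pCons (smult c p) S)"
    by (simp add: X_smult scaleC_add_right flip: S)
  then show ?case by blast
qed (auto intro: exI[of _ 0])

lemma X_t: "X p * t = t * X p"
proof -
  have "X p * t = t * X p \<and> X (pCons 0 p) * t = t * X (pCons 0 p)"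
  proof (induction p)
    case (pCons k p)
    have "x1 * t = t * x1"
      by (simp add: x1_def t_commute left_diff_distrib right_diff_distrib)
    moreover have "X p * cas * t = t * (X p * cas)"
    proof -
      have "X p * cas * t = X p * t * cas"
        by (simp add: mult.assoc t_commute)
      also have "\<dots> = t * (X p * cas)"
        using pCons by (simp add: mult.assoc)
      finally show ?thesis .
    qed
    ultimately show ?case
      using pCons X_pCons[of k p] by (simp add: X_pCons_0_pCons t_commute distrib_left distrib_right)
  qed simp
  then show ?thesis ..
qed

lemma X_peval2: "\<exists>R. X p * peval2 cas t P = X2 R"
proof (induction P)
  case (pCons r P)
  then obtain R where R: "X p * peval2 cas t P = X2 R" by blast
  have "X p * t = t * X p"
    by (rule X_t)
  then have "X p * peval2 cas t (pCons r P) = X p * peval cas r + t * (X p * peval2 cas t P)"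
    by (simp add: distrib_left mult.assoc[symmetric])
  then show ?case
    unfolding R X_peval by (metis X2_pCons)
qed (auto intro: exI[of _ 0])

abbreviation Z2 :: "complex poly poly \<Rightarrow> 'a" where "Z2 \<equiv> peval2 cas t"

lemma comm_Z2 [simp]: "comm e (Z2 P) = 0" "comm h (Z2 P) = 0" "comm f (Z2 P) = 0"
  by (simp_all add: peval2_commute)

lemma Z2_peval: "peval cas r * Z2 P = Z2 (smult r P)"
  by (simp add: peval2_smult)

lemma Z2_cas: "cas * Z2 P = Z2 (smult [:0, 1:] P)" "Z2 P * cas = Z2 (smult [:0, 1:] P)"
proof -
  show *: "cas * Z2 P = Z2 (smult [:0, 1:] P)"
    using Z2_peval[of "[:0, 1:]" P] by simp
  have "comm cas (Z2 P) = 0" by (simp add: peval2_commute)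
  then show "Z2 P * cas = Z2 (smult [:0, 1:] P)"
    unfolding *[symmetric] by (simp add: comm_def)
qed

lemma Z2_scale: "c *\<^sub>C Z2 P = Z2 (smult [:c:] P)"
  using Z2_peval[of "[:c:]" P] by simp

lemma Z2_minus: "- Z2 P = Z2 (- P)"
proof -
  have "smult [:-1:] P = - P" by (rule poly_eqI) simp
  then show ?thesis using Z2_scale[of "- 1" P] by simp
qed

lemma Z2_om: "om * Z2 P = Z2 (pCons 0 P - smult zt P)"
proof -
  have "om = t - peval cas zt" by (simp add: t_def)
  then have "om * Z2 P = Z2 (pCons 0 P) + - Z2 (smult zt P)"
    by (simp add: left_diff_distrib Z2_peval)
  then show ?thesis
    unfolding Z2_minus peval2_add[symmetric] by simp
qed

text \<open>\<open>N d k\<close> is spanned by the \<open>e\<^sup>a x\<^sup>i w\<^sup>\<epsilon> c\<close> of weight \<open>k\<close> with \<open>i + \<epsilon> \<le> d\<close>. The filtration by \<open>d\<close> makes the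
  induction for closure under multiplication by \<open>cas\<close> work, since \<open>w * x\<close> involves \<open>z\<close>.\<close>

inductive N :: "nat \<Rightarrow> nat \<Rightarrow> 'a \<Rightarrow> bool" where
  N_Z2: "N 0 0 (Z2 P)"
| N_w: "N (Suc 0) (Suc 0) (w * Z2 P)"
| N_e: "N d k n \<Longrightarrow> N d (Suc (Suc k)) (e * n)"
| N_x: "N d k n \<Longrightarrow> N (Suc d) (Suc k) (x * n)"
| N_mono: "N d k n \<Longrightarrow> N (Suc d) k n"
| N_add: "N d k m \<Longrightarrow> N d k n \<Longrightarrow> N d k (m + n)"
| N_scale: "N d k n \<Longrightarrow> N d k (c *\<^sub>C n)"
| N_zero: "N d k 0"

lemma N_minus: "N d k n \<Longrightarrow> N d k (- n)"
  using N_scale[of d k n "-1"] by simp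

lemma N_diff: "N d k m \<Longrightarrow> N d k n \<Longrightarrow> N d k (m - n)"
  using N_add[of d k m "- n"] N_minus by simp

lemma N_le: "d \<le> d' \<Longrightarrow> N d k n \<Longrightarrow> N d' k n"
  by (induction d' rule: dec_induct) (auto intro: N_mono)

lemma N_weight: "N d k n \<Longrightarrow> comm e n = 0 \<and> comm h n = of_nat k *\<^sub>C n"
  by (induction rule: N.induct)
     (simp_all add: comm_mult_right comm_add_right comm_w comm_ex comm_hx comm_he scaleC_add_left
        scaleC_add_right scaleC_expand mult.commute distrib_right)

text \<open>A factor \<open>e\<close> adds 2 to the weight, a factor \<open>x\<close> or
  \<open>w\<close> adds 1. Hence weight 0 leaves only invariants, and weight 1 only a single
  \<open>x\<close> or \<open>w\<close> times an invariant; since \<open>w\<close> is x (2 s + 1),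
  both have the form \<open>X2 R\<close>.\<close>

lemma N_low: "N d k n \<Longrightarrow> (k = 0 \<longrightarrow> (\<exists>P. n = Z2 P)) \<and> (k = 1 \<longrightarrow> (\<exists>R. n = X2 R))"
proof (induction rule: N.induct)
  case (N_w P)
  then show ?case unfolding w_X using X_peval2 by simp
next
  case (N_x d k n)
  then show ?case using X_peval2[of 1] by (auto simp: X_1)
next
  case (N_add d k m n)
  then show ?case by (metis X2_add peval2_add)
next
  case (N_scale d k n c)
  then show ?case by (metis X2_scale Z2_scale)
next
  case (N_zero d k)
  then show ?case using X2_0 peval2_0 by metis
qed auto

lemma N_peval:
  assumes "\<And>n. N d k n \<Longrightarrow> N d k (cas * n)" and "N d k n"
  shows "N d k (peval cas r * n)"
proof (induction r)
  case (pCons c r)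
  then have "N d k (c *\<^sub>C n + cas * (peval cas r * n))"
    using assms by (intro N_add N_scale) auto
  then show ?case by (simp add: distrib_right mult.assoc)
qed (simp add: N_zero)

lemma w_Z2: "N (Suc 0) (Suc 0) (cas * (w * Z2 P))" "N (Suc (Suc 0)) (Suc (Suc 0)) (w * (w * Z2 P))"
proof -
  have "cas * (w * Z2 P) = w * (cas * Z2 P) + 4 *\<^sub>C (x * (cas * Z2 P)) + 2 *\<^sub>C (w * Z2 P) - x * Z2 P"
    using cas_w by (simp add: mult.assoc[symmetric] distrib_right left_diff_distrib)
  also have "N (Suc 0) (Suc 0) \<dots>"
    unfolding Z2_cas by (intro N.intros N_diff)
  finally show "N (Suc 0) (Suc 0) (cas * (w * Z2 P))" .
  have "w * (w * Z2 P) = 4 *\<^sub>C (x * (x * (cas * Z2 P))) - x * (x * Z2 P) + 4 *\<^sub>C (x * (w * Z2 P)) - 4 *\<^sub>C (e * (om * Z2 P))"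
    using w_w by (simp add: mult.assoc[symmetric] distrib_right left_diff_distrib)
  also have "N (Suc (Suc 0)) (Suc (Suc 0)) \<dots>"
    unfolding Z2_cas Z2_om
    by (intro N_diff N_add N_scale N_x N_w N_Z2 N_mono[OF N_mono[OF N_e]])
  finally show "N (Suc (Suc 0)) (Suc (Suc 0)) (w * (w * Z2 P))" .
qed

text \<open>The two closure properties need each other: \<open>cas * (x * n)\<close> produces
  \<open>w * n\<close>, and \<open>w * (x * n)\<close> produces \<open>z * n\<close>, with
  \<open>z\<close> a polynomial in \<open>cas\<close>. In both cases \<open>n\<close> has smaller
  degree than \<open>x * n\<close>, so the outer induction on \<open>d\<close> applies; the inner
  one follows the construction of the element.\<close>

lemma N_cas_w: "N d k n \<Longrightarrow> N d k (cas * n) \<and> N (Suc d) (Suc k) (w * n)"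
proof (induction d arbitrary: k n)
  case 0
  then show ?case
  proof (induction "0::nat" k n rule: N.induct)
    case (N_Z2 P)
    then show ?case unfolding Z2_cas by (auto intro: N.intros)
  next
    case (N_e k n)
    have "cas * (e * n) = e * (cas * n)" "w * (e * n) = e * (w * n)"
      using comm_cas(1) comm_w(1) by (simp_all add: comm_def flip: mult.assoc)
    then show ?case using N_e by (auto intro: N.intros)
  qed (auto intro: N.intros simp: distrib_left)
next
  case (Suc d)
  note outer = Suc.IH
  show ?case
    using Suc.prems
  proof (induction "Suc d" k n rule: N.induct)
    case (N_w P)
    then show ?case using w_Z2 by (simp del: peval2_pCons)
  next
    case (N_e k n)
    have "cas * (e * n) = e * (cas * n)" "w * (e * n) = e * (w * n)"
      using comm_cas(1) comm_w(1) by (simp_all add: comm_def flip: mult.assoc)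
    then show ?case using N_e by (auto intro: N.intros)
  next
    case (N_x k n)
    have "cas * (x * n) = x * (cas * n) + w * n"
      using cas_x by (simp add: distrib_right flip: mult.assoc)
    moreover have "w * (x * n) = x * (w * n) + 2 *\<^sub>C (x * (x * n)) - 4 *\<^sub>C (e * (z * n))"
      using w_x by (simp add: distrib_right left_diff_distrib flip: mult.assoc)
    moreover have "N (Suc (Suc d)) (Suc (Suc k)) (e * (z * n))"
      unfolding z_def using N_x outer by (intro N_mono N_e N_peval) auto
    ultimately show ?case
      using N_x outer[of k n] by (auto intro!: N_add N_diff N_scale N.N_x)
  next
    case (N_mono k n)
    then show ?case using outer by (blast intro: N.N_mono)
  qed (auto intro: N.intros simp: distrib_left)
qed

lemma N_cas_right: "N d k n \<Longrightarrow> N d k (n * cas)"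
proof (induction rule: N.induct)
  case (N_Z2 P)
  then show ?case unfolding Z2_cas by (rule N.N_Z2)
next
  case (N_w P)
  then show ?case unfolding mult.assoc Z2_cas by (rule N.N_w)
qed (auto intro: N.intros simp: distrib_right mult.assoc)

definition NN :: "nat \<Rightarrow> 'a \<Rightarrow> bool" where "NN k n \<longleftrightarrow> (\<exists>d. N d k n)"

lemma NN_add: "NN k m \<Longrightarrow> NN k n \<Longrightarrow> NN k (m + n)"
  unfolding NN_def by (meson N_add N_le max.cobounded1 max.cobounded2)

lemma NN_closed:
  "NN k n \<Longrightarrow> NN k (c *\<^sub>C n)" "NN k n \<Longrightarrow> NN k (- n)" "NN k 0" "NN k n \<Longrightarrow> NN (Suc (Suc k)) (e * n)"
  "NN k n \<Longrightarrow> NN (Suc k) (x * n)" "NN k n \<Longrightarrow> NN k (cas * n)" "NN k n \<Longrightarrow> NN (Suc k) (w * n)"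
  "NN k n \<Longrightarrow> NN k (n * cas)" "NN 0 (Z2 P)"
proof -
  show "NN k 0" "NN 0 (Z2 P)"
    unfolding NN_def using N_zero N_Z2 by blast+
  assume "NN k n"
  then obtain d where d: "N d k n" unfolding NN_def by blast
  show "NN k (c *\<^sub>C n)" "NN k (- n)" "NN (Suc (Suc k)) (e * n)" "NN (Suc k) (x * n)"
    unfolding NN_def using N_scale[OF d] N_minus[OF d] N_e[OF d] N_x[OF d] by blast+
  show "NN k (cas * n)" "NN (Suc k) (w * n)" "NN k (n * cas)"
    unfolding NN_def using N_cas_w[OF d] N_cas_right[OF d] by blast+
qed

lemma NN_diff: "NN k m \<Longrightarrow> NN k n \<Longrightarrow> NN k (m - n)"
  using NN_add[of k m "- n"] NN_closed(2) by simp

lemma NN_z: "NN k n \<Longrightarrow> NN k (z * n)"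
  unfolding NN_def z_def using N_peval N_cas_w by blast

lemma NN_weight: "NN k n \<Longrightarrow> comm e n = 0" "NN k n \<Longrightarrow> comm h n = of_nat k *\<^sub>C n"
  unfolding NN_def using N_weight by blast+

lemma NN_0: "NN 0 n \<Longrightarrow> \<exists>P. n = Z2 P" and NN_1: "NN 1 n \<Longrightarrow> \<exists>R. n = X2 R"
  unfolding NN_def using N_low by blast+

text \<open>Up to a factor, \<open>lw k n\<close> is the projection of \<open>y * n\<close> to the highest weight vectors
  of weight \<open>k - 1\<close>.\<close>

definition lw :: "nat \<Rightarrow> 'a \<Rightarrow> 'a" where
  "lw k n = x * comm f n - of_nat k *\<^sub>C (y * n)"

lemma lw_0: "NN 0 n \<Longrightarrow> lw 0 n = 0"
  using NN_0[of n] by (auto simp: lw_def)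

text \<open>Since \<open>comm f\<close> is a derivation, \<open>lw\<close> of a product is the outer
  factor times \<open>lw\<close> of the inner one, plus a correction: multiples of
  \<open>x * n\<close> and \<open>w * n\<close> for the factor \<open>e\<close>, a multiple of
  \<open>z * n\<close> for the factor \<open>x\<close>. The base case \<open>w * Z2 P\<close> gives
  \<open>om * Z2 P\<close>, which is again an invariant.\<close>

lemma NN_lw: "N d k n \<Longrightarrow> NN (k - 1) (lw k n)"
proof (induction rule: N.induct)
  case (N_Z2 P)
  then show ?case by (simp add: lw_def NN_closed)
next
  case (N_w P)
  have "lw (Suc 0) (w * Z2 P) = om * Z2 P"
    by (simp add: lw_def comm_mult_right comm_w om_def left_diff_distrib mult.assoc)
  then show ?case by (simp add: Z2_om NN_closed del: peval2_pCons)
next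
  case (N_e d k n)
  have "y * (e * n) = e * (y * n) - x * n" "x * (e * n) = e * (x * n)"
    by (rule order')+
  have *: "lw (Suc (Suc k)) (e * n) = (x * comm f e - 2 *\<^sub>C (y * e)) * n + e * lw k n + of_nat k *\<^sub>C (x * n)"
    by (simp add: lw_def comm_mult_right scaleC_add_left algebra_simps order' scaleC_diff_right)
  have n: "NN k n" using N_e.hyps by (auto simp: NN_def)
  \<comment> \<open>For \<open>k = 0\<close> the truncated \<open>k - 1\<close> would give the wrong
    weight, but there \<open>lw k n\<close> vanishes because \<open>n\<close> commutes with
    \<open>f\<close>.\<close>
  have "NN (Suc k) (e * lw k n)"
  proof (cases k)
    case 0
    then have "lw k n = 0" using N_e.hyps lw_0[of n] by (auto simp: NN_def)
    then show ?thesis by (simp add: NN_closed)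
  next
    case (Suc l)
    then show ?thesis using NN_closed(4)[OF N_e.IH] by simp
  qed
  then show ?case
    unfolding * y_e diff_Suc_1 mult_scaleC_left left_diff_distrib
    by (intro NN_add NN_closed NN_diff n)
next
  case (N_x d k n)
  have *: "lw (Suc k) (x * n) = x * lw k n + of_nat (Suc k) *\<^sub>C (z * n)"
    by (simp add: lw_def comm_mult_right comm_fx scaleC_add_left algebra_simps order' scaleC_diff_right)
  have n: "NN k n" using N_x.hyps by (auto simp: NN_def)
  have "NN k (x * lw k n)"
  proof (cases k)
    case 0
    then have "lw k n = 0" using N_x.hyps lw_0[of n] by (auto simp: NN_def)
    then show ?thesis by (simp add: NN_closed)
  next
    case (Suc l)
    then show ?thesis using NN_closed(5)[OF N_x.IH] by simp
  qed
  then show ?case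
    unfolding * diff_Suc_1 by (intro NN_add NN_closed NN_z n)
next
  case (N_mono d k n)
  then show ?case by simp
next
  case (N_add d k m n)
  have "lw k (m + n) = lw k m + lw k n"
    by (simp add: lw_def comm_add_right algebra_simps scaleC_add_right)
  then show ?case using N_add by (simp add: NN_add)
next
  case (N_scale d k n c)
  have "lw k (c *\<^sub>C n) = c *\<^sub>C lw k n"
    by (simp add: lw_def scaleC_diff_right mult.commute)
  then show ?case using N_scale by (simp add: NN_closed)
next
  case (N_zero d k)
  then show ?case by (simp add: lw_def NN_closed)
qed

end

section \<open>Left multiplication by the generators on the span of the highest weight
  modules\<close>

context hecke
begin

text \<open>\<open>M\<close> is the sl2-module generated by the highest weight vectors in \<open>NN\<close>. It turns out to be a left ideal
  containing 1.\<close>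

inductive M :: "'a \<Rightarrow> bool" where
  M_NN: "NN k n \<Longrightarrow> M n"
| M_add: "M m \<Longrightarrow> M n \<Longrightarrow> M (m + n)"
| M_scale: "M m \<Longrightarrow> M (c *\<^sub>C m)"
| M_comm: "M m \<Longrightarrow> M (comm f m)"

lemma M_minus: "M m \<Longrightarrow> M (- m)"
  using M_scale[of m "-1"] by simp

lemma M_diff: "M m \<Longrightarrow> M n \<Longrightarrow> M (m - n)"
  using M_add[of m "- n"] M_minus by simp

lemma M_scale_cancel: "M (c *\<^sub>C m) \<Longrightarrow> c \<noteq> 0 \<Longrightarrow> M m"
  using M_scale[of "c *\<^sub>C m" "inverse c"] by simp

lemma comm_fh: "comm f h = 2 *\<^sub>C f" and comm_fe: "comm f e = - h"
  using comm_hf comm_ef comm_swap[of f h] comm_swap[of f e] by simp_all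

lemma M_cas: "M m \<Longrightarrow> M (cas * m)"
proof (induction rule: M.induct)
  case (M_comm m)
  have "cas * comm f m = comm f (cas * m)" by (simp add: comm_mult_right)
  then show ?case using M_comm by (simp add: M.M_comm)
qed (auto intro: M.intros NN_closed simp: distrib_left)

text \<open>In V tensor the module of \<open>n\<close> there are components of highest weight k + 1
  and k - 1. The lowered vector \<open>comm f (x * n)\<close> belongs to the first and
  \<open>lw k n\<close> to the second, and their difference is k + 1 times
  \<open>y * n\<close>.\<close>

lemma M_y_NN:
  assumes "NN k n"
  shows "M (y * n)"
proof -
  have "NN (k - 1) (lw k n)"
    using assms NN_lw unfolding NN_def[of k] by blast
  then have "M (comm f (x * n) - lw k n)"
    using assms by (intro M_diff M_comm) (auto intro: M_NN NN_closed)
  also have "comm f (x * n) - lw k n = (1 + of_nat k) *\<^sub>C (y * n)"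
    by (simp add: lw_def comm_mult_right comm_fx scaleC_add_left)
  finally show ?thesis
    by (rule M_scale_cancel) (metis of_nat_0_eq_iff of_nat_Suc nat.distinct(1))
qed

lemma M_xy: "M m \<Longrightarrow> M (x * m) \<and> M (y * m)"
proof (induction rule: M.induct)
  case (M_NN k n)
  then show ?case using M_y_NN NN_closed(5) M.M_NN by blast
next
  case (M_comm m)
  have "x * comm f m = comm f (x * m) - y * m" "y * comm f m = comm f (y * m)"
    by (simp_all add: comm_mult_right comm_fx comm_fy)
  then show ?case using M_comm by (simp add: M.M_comm M_diff)
qed (auto intro: M.intros simp: distrib_left)

text \<open>Moving \<open>h\<close> and \<open>e\<close> from the right of \<open>n\<close> or
  \<open>comm f n\<close> to the left costs only multiples of \<open>n\<close>. With
  \<open>e * comm f n = comm f (e * n) + h * n\<close> the identity can be solved for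
  \<open>h * n\<close>, which is \<open>h_NN\<close>.\<close>

lemma comm_cas_hw:
  assumes "comm e n = 0" "comm h n = c *\<^sub>C n"
  shows "cas * n - n * cas = 4 *\<^sub>C (e * comm f n) + (2 * c) *\<^sub>C (h * n) - (c * (c + 2)) *\<^sub>C n"
proof -
  have 1: "n * h = h * n - c *\<^sub>C n"
    using assms(2) by (simp add: comm_def algebra_simps)
  have 2: "comm f n * e = e * comm f n - c *\<^sub>C n"
  proof -
    have "comm e (comm f n) = c *\<^sub>C n"
      using assms by (simp add: comm_jacobi comm_ef)
    then show ?thesis by (simp add: comm_def[of e] algebra_simps)
  qed
  have "cas * n - n * cas = comm cas n" by (simp add: comm_def)
  also have "\<dots> = c *\<^sub>C (n * h) + c *\<^sub>C (h * n) + (2 * c) *\<^sub>C n + 4 *\<^sub>C (comm f n * e)"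
    by (simp add: cas_def comm_add_left comm_mult_left assms)
  also have "\<dots> = 4 *\<^sub>C (e * comm f n) + (2 * c) *\<^sub>C (h * n) - (c * (c + 2)) *\<^sub>C n"
    unfolding 1 2 mult_2 scaleC_add_left distrib_left
    by (simp add: scaleC_diff_right) (simp add: scaleC_expand scaleC_diff_right distrib_left scaleC_add_left mult_2_right,
        simp flip: scaleC_add_left scaleC_diff_left scaleC_minus_left)
  finally show ?thesis .
qed

definition hz :: "nat \<Rightarrow> 'a \<Rightarrow> 'a" where
  "hz k n = cas * n - n * cas + (of_nat k * (of_nat k + 2)) *\<^sub>C n"

lemma NN_hz: "NN k n \<Longrightarrow> NN k (hz k n)"
  unfolding hz_def by (intro NN_add NN_diff NN_closed)

lemma h_NN:
  assumes "NN k n"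
  shows "(2 * of_nat k + 4) *\<^sub>C (h * n) = hz k n - 4 *\<^sub>C comm f (e * n)"
  using comm_cas_hw[OF NN_weight[OF assms]]
  by (simp add: hz_def comm_mult_right comm_fe scaleC_add_left scaleC_add_right scaleC_diff_right)

lemma of_nat_linear_nonzero: "of_nat a * of_nat k + numeral b \<noteq> (0::complex)"
proof -
  have "of_nat (a * k + numeral b) \<noteq> (0::complex)"
    unfolding of_nat_eq_0_iff by simp
  then show ?thesis by simp
qed

lemma M_h_NN:
  assumes "NN k n"
  shows "M (h * n)"
proof -
  have "M (hz k n - 4 *\<^sub>C comm f (e * n))"
    using assms by (intro M_diff M_scale M_comm) (auto intro: M_NN NN_hz NN_closed)
  then show ?thesis
    unfolding h_NN[OF assms, symmetric]
    using of_nat_linear_nonzero[of 2 k] by (auto dest: M_scale_cancel)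
qed

lemma h_comm_f: "h * comm f m = comm f (h * m) - 2 *\<^sub>C (f * m)"
  by (simp add: comm_mult_right comm_fh)

text \<open>In each case \<open>f\<close> times the element occurs in an identity whose other terms
  can be placed in \<open>M\<close>: in \<open>comm f (h * c)\<close> for an invariant
  \<open>c\<close>, in two computations of [cas, wy], in \<open>cas * m\<close> for the factor
  \<open>e\<close>, and in \<open>wy * m\<close> for the factor \<open>x\<close>. Remaining terms
  with \<open>h\<close> on a lowered vector are traded by \<open>h_comm_f\<close> for a lowered
  vector and one more multiple of \<open>f\<close>; only the coefficient changes, and it has to stay
  nonzero.\<close>

lemma M_f_NN: "N d k n \<Longrightarrow> M (f * n)"
proof (induction rule: N.induct)
  case (N_Z2 P)
  have "M (comm f (h * Z2 P))"
    by (intro M_comm M_h_NN) (rule NN_closed)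
  then have "M (2 *\<^sub>C (f * Z2 P))"
    by (simp add: comm_mult_right comm_fh)
  then show ?case by (rule M_scale_cancel) simp
next
  case (N_w P)
  let ?c = "Z2 P"
  have c: "M ?c" "NN 1 (w * ?c)" "comm f ?c = 0"
    by (auto intro: M_NN NN_closed simp: NN_closed(7)[of 0, simplified])
  have wyc: "wy * ?c = comm f (w * ?c)"
    by (simp add: comm_mult_right comm_w)
  have "comm f (comm cas w) = comm cas wy"
    by (simp add: comm_jacobi comm_w)
  then have "comm cas wy = 4 *\<^sub>C (cas * y) - y - 2 *\<^sub>C wy"
    unfolding comm_cas_w by (simp add: comm_diff_right comm_mult_right comm_fx comm_w)
  moreover have "comm cas wy = 4 *\<^sub>C (f * w) - 2 *\<^sub>C (h * wy) - 3 *\<^sub>C wy"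
    unfolding wy_eq[THEN arg_cong, of "comm cas"]
    using comm_swap[of cas f] comm_swap[of cas h]
    by (simp add: comm_diff_right comm_add_right comm_mult_right w_def wy_def)
  ultimately have "4 *\<^sub>C (f * w) = 2 *\<^sub>C (h * wy) + 4 *\<^sub>C (cas * y) - y + wy"
    by (simp add: algebra_simps) (simp add: scaleC_expand)
  from arg_cong[OF this, of "\<lambda>u. u * ?c"]
  have "4 *\<^sub>C (f * (w * ?c)) = 2 *\<^sub>C (h * comm f (w * ?c)) + 4 *\<^sub>C (cas * (y * ?c)) - y * ?c + comm f (w * ?c)"
    by (simp add: distrib_right left_diff_distrib mult.assoc flip: wyc)
  then have "8 *\<^sub>C (f * (w * ?c)) = 2 *\<^sub>C comm f (h * (w * ?c)) + 4 *\<^sub>C (cas * (y * ?c)) - y * ?c + comm f (w * ?c)"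
    unfolding h_comm_f by (simp add: scaleC_diff_right algebra_simps) (simp add: scaleC_expand)
  moreover have "M \<dots>"
    using c M_xy[of ?c] by (intro M_diff M_add M_scale M_comm M_cas M_h_NN) (auto intro: M_NN)
  ultimately show ?case
    using M_scale_cancel[of 8] by simp
next
  case (N_e d k m)
  have m: "NN k m" using N_e by (auto simp: NN_def)
  let ?K = "of_nat k :: complex"
  have 1: "cas * m = h * (h * m) + 2 *\<^sub>C (h * m) + m + 4 *\<^sub>C (f * (e * m))"
    by (simp add: cas_def distrib_right mult.assoc)
  have "(2 * ?K + 4) *\<^sub>C (h * (h * m)) = h * hz k m - 4 *\<^sub>C (h * comm f (e * m))"
    using arg_cong[OF h_NN[OF m], of "\<lambda>u. h * u"] by (simp add: right_diff_distrib)
  also have "\<dots> = h * hz k m - 4 *\<^sub>C comm f (h * (e * m)) + 8 *\<^sub>C (f * (e * m))"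
    unfolding h_comm_f by (simp add: scaleC_diff_right)
  finally have 2: "(2 * ?K + 4) *\<^sub>C (h * (h * m)) = \<dots>" .
  have "(2 * ?K + 4) *\<^sub>C (cas * m - 2 *\<^sub>C (h * m) - m) - h * hz k m + 4 *\<^sub>C comm f (h * (e * m))
     = (2 * ?K + 4) *\<^sub>C (h * (h * m)) + (2 * ?K + 4) *\<^sub>C 4 *\<^sub>C (f * (e * m)) - h * hz k m + 4 *\<^sub>C comm f (h * (e * m))"
    unfolding 1 by (simp add: scaleC_add_right flip: scaleC_scaleC)
  \<comment> \<open>The explicit term contributes 4 (2 k + 4), and eliminating
    \<open>h * (h * m)\<close> contributes 8 more. The shape \<open>of_nat 8 * ?K + 24\<close> is
    the one covered by \<open>of_nat_linear_nonzero\<close>.\<close>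
  also have "\<dots> = (of_nat 8 * ?K + 24) *\<^sub>C (f * (e * m))"
  proof -
    have "of_nat 8 * ?K + 24 = (2 * ?K + 4) * 4 + 8" by simp
    then show ?thesis unfolding 2 by (simp add: scaleC_add_left) (simp add: scaleC_expand)
  qed
  finally have 3: "(of_nat 8 * ?K + 24) *\<^sub>C (f * (e * m)) = (2 * ?K + 4) *\<^sub>C (cas * m - 2 *\<^sub>C (h * m) - m) - h * hz k m + 4 *\<^sub>C comm f (h * (e * m))"
    by simp
  have "M \<dots>"
    using m by (intro M_diff M_add M_scale M_comm M_cas M_h_NN NN_hz) (auto intro: M_NN M_h_NN NN_hz NN_closed)
  then show ?case
    unfolding 3[symmetric] using M_scale_cancel of_nat_linear_nonzero by blast
next
  case (N_x d k m)
  have m: "NN k m" using N_x by (auto simp: NN_def)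
  let ?K = "of_nat k :: complex"
  have 1: "cas * (y * m) - y * (cas * m) + 3 *\<^sub>C (y * m) = 4 *\<^sub>C (f * (x * m)) - 2 *\<^sub>C (h * (y * m))"
  proof -
    have "cas * (y * m) - y * (cas * m) = wy * m"
      by (simp add: wy_def comm_def left_diff_distrib mult.assoc)
    then show ?thesis
      unfolding wy_eq by (simp add: left_diff_distrib mult.assoc)
  qed
  have "(?K + 1) *\<^sub>C (y * m) = comm f (x * m) - lw k m"
    by (simp add: lw_def comm_mult_right comm_fx scaleC_add_left)
  from arg_cong[OF this, of "\<lambda>u. h * u"]
  have 2: "(?K + 1) *\<^sub>C (h * (y * m)) = comm f (h * (x * m)) - 2 *\<^sub>C (f * (x * m)) - h * lw k m"
    by (simp add: right_diff_distrib h_comm_f)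
  have "(?K + 1) *\<^sub>C (cas * (y * m) - y * (cas * m) + 3 *\<^sub>C (y * m)) + 2 *\<^sub>C comm f (h * (x * m)) - 2 *\<^sub>C (h * lw k m)
     = (4 * (?K + 1)) *\<^sub>C (f * (x * m)) - 2 *\<^sub>C ((?K + 1) *\<^sub>C (h * (y * m))) + 2 *\<^sub>C comm f (h * (x * m)) - 2 *\<^sub>C (h * lw k m)"
    unfolding 1 by (simp add: scaleC_diff_right mult.commute)
  also have "\<dots> = (of_nat 4 * ?K + 8) *\<^sub>C (f * (x * m))"
  proof -
    have "of_nat 4 * ?K + 8 = 4 * (?K + 1) + 4" by simp
    then show ?thesis unfolding 2 by (simp add: scaleC_diff_right scaleC_add_left) (simp add: scaleC_expand)
  qed
  finally have 3: "(of_nat 4 * ?K + 8) *\<^sub>C (f * (x * m)) = (?K + 1) *\<^sub>C (cas * (y * m) - y * (cas * m) + 3 *\<^sub>C (y * m)) + 2 *\<^sub>C comm f (h * (x * m)) - 2 *\<^sub>C (h * lw k m)"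
    by simp
  have "NN (k - 1) (lw k m)"
    using NN_lw N_x by blast
  then have "M ((?K + 1) *\<^sub>C (cas * (y * m) - y * (cas * m) + 3 *\<^sub>C (y * m)) + 2 *\<^sub>C comm f (h * (x * m)) - 2 *\<^sub>C (h * lw k m))"
    using m M_y_NN[of k m] M_y_NN[of k "cas * m"] NN_closed
    by (intro M_diff M_add M_scale M_comm M_cas M_h_NN) auto
  then show ?case
    unfolding 3[symmetric] using M_scale_cancel of_nat_linear_nonzero by blast
qed (auto intro: M.intros simp: distrib_left NN_closed)

lemma M_efh: "M m \<Longrightarrow> M (e * m) \<and> M (f * m) \<and> M (h * m)"
proof (induction rule: M.induct)
  case (M_NN k n)
  then obtain d where "N d k n" by (auto simp: NN_def)
  with M_NN show ?case
    using M.M_NN[OF NN_closed(4)] M_f_NN M_h_NN by blast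
next
  case (M_comm m)
  have "e * comm f m = comm f (e * m) + h * m" "f * comm f m = comm f (f * m)"
    by (simp_all add: comm_mult_right comm_fe)
  then show ?case using M_comm by (simp add: h_comm_f M.M_comm M_diff M_add M_scale)
qed (auto intro: M.intros simp: distrib_left)

end

section \<open>Weights and nilpotency\<close>

lemma funpow_comm_add: "(comm g ^^ n) (a + b) = (comm g ^^ n) a + (comm (g::'a::ring) ^^ n) b"
  by (induction n) (simp_all add: comm_add_right)

lemma funpow_comm_scaleC: "(comm g ^^ n) (c *\<^sub>C a) = c *\<^sub>C (comm (g::'a::complex_algebra) ^^ n) a"
  by (induction n) simp_all

lemma funpow_comm_zero [simp]: "(comm g ^^ n) 0 = (0::'a::ring)"
  by (induction n) simp_all

lemma funpow_comm_sum: "(comm g ^^ n) (sum v A) = (\<Sum>i\<in>A. (comm (g::'a::ring) ^^ n) (v i))"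
  by (induction A rule: infinite_finite_induct) (simp_all add: funpow_comm_add)

lemma funpow_comm_mono: "(comm g ^^ m) a = (0::'a::ring) \<Longrightarrow> m \<le> n \<Longrightarrow> (comm g ^^ n) a = 0"
  by (metis add_diff_inverse_nat funpow_add funpow_comm_zero linorder_not_less add.commute comp_apply)

lemma funpow_comm_mult:
  "(comm g ^^ i) a = 0 \<Longrightarrow> (comm g ^^ j) b = 0 \<Longrightarrow> (comm (g::'a::ring) ^^ (i + j)) (a * b) = 0"
proof (induction "i + j" arbitrary: i j a b)
  case (Suc n)
  show ?case
  proof (cases "i = 0 \<or> j = 0")
    case False
    then obtain i' j' where ij: "i = Suc i'" "j = Suc j'"
      by (meson not0_implies_Suc)
    have "(comm g ^^ (i' + j)) (comm g a * b) = 0"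
      using Suc.prems Suc.hyps ij by (intro Suc.hyps(1)) (auto simp: funpow_swap1)
    moreover have "(comm g ^^ (i + j')) (a * comm g b) = 0"
      using Suc.prems Suc.hyps ij by (intro Suc.hyps(1)) (auto simp: funpow_swap1)
    moreover have "(comm g ^^ (i + j)) (a * b) = (comm g ^^ (i' + j)) (comm g (a * b))"
      using ij by (simp add: funpow_swap1)
    ultimately show ?thesis
      using ij by (simp add: comm_mult_right funpow_comm_add comm_add_right)
  qed (use Suc in auto)
qed auto

definition nilp :: "'a::ring \<Rightarrow> 'a \<Rightarrow> bool" where
  "nilp g a \<longleftrightarrow> (\<exists>n. (comm g ^^ n) a = 0)"

lemma nilp_mult: "nilp g a \<Longrightarrow> nilp g b \<Longrightarrow> nilp g (a * b)"
  unfolding nilp_def using funpow_comm_mult by blast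

lemma nilp_add: "nilp g a \<Longrightarrow> nilp g b \<Longrightarrow> nilp g (a + b)"
  unfolding nilp_def by (metis funpow_comm_add funpow_comm_mono add_0 max.cobounded1 max.cobounded2)

lemma nilp_scale: "nilp g a \<Longrightarrow> nilp g (c *\<^sub>C a)"
  unfolding nilp_def by (metis funpow_comm_scaleC scaleC_zero_right)

lemma nilp_3: "comm g (comm g (comm g a)) = 0 \<Longrightarrow> nilp g a"
  unfolding nilp_def by (rule exI[of _ 3]) (simp add: eval_nat_numeral)

context sl2_triple
begin

definition weight :: "int \<Rightarrow> 'a \<Rightarrow> bool" where
  "weight j v \<longleftrightarrow> comm h v = of_int j *\<^sub>C v"

lemma weight_add: "weight j u \<Longrightarrow> weight j v \<Longrightarrow> weight j (u + v)"
  and weight_scale: "weight j u \<Longrightarrow> weight j (c *\<^sub>C u)"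
  and weight_0: "weight j 0"
  and weight_f: "weight j u \<Longrightarrow> weight (j - 2) (comm f u)"
  and weight_e: "weight j u \<Longrightarrow> weight (j + 2) (comm e u)"
  by (simp_all add: weight_def comm_add_right scaleC_add_right mult.commute comm_jacobi[of h] comm_hf
      comm_he scaleC_diff_left scaleC_add_left comm_mult_right)
   (simp_all add: comm_def scaleC_expand algebra_simps)

lemma weight_funpow_f: "weight j v \<Longrightarrow> weight (j - 2 * int i) ((comm f ^^ i) v)"
proof (induction i)
  case (Suc i)
  then show ?case using weight_f[of "j - 2 * int i"] by (simp add: algebra_simps)
qed simp

lemma weight_funpow_e: "weight j v \<Longrightarrow> weight (j + 2 * int i) ((comm e ^^ i) v)"
proof (induction i)
  case (Suc i)
  then show ?case using weight_e[of "j + 2 * int i"] by (simp add: algebra_simps)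
qed simp

lemma weight_independent:
  "finite J \<Longrightarrow> (\<And>j. j \<in> J \<Longrightarrow> weight j (v j)) \<Longrightarrow> sum v J = 0 \<Longrightarrow> j \<in> J \<Longrightarrow> v j = 0"
proof (induction J arbitrary: v j rule: finite_induct)
  case (insert k J)
  have "(\<Sum>j\<in>J. of_int (j - k) *\<^sub>C v j) = comm h (sum v (insert k J)) - of_int k *\<^sub>C sum v (insert k J)"
    using insert.hyps insert.prems(1)
    by (simp add: comm_add_right comm_sum_right weight_def scaleC_add_right scaleC_sum_right
        scaleC_diff_left sum_subtractf)
  also have "\<dots> = 0" using insert.prems by simp
  finally have "(\<Sum>j\<in>J. of_int (j - k) *\<^sub>C v j) = 0" .
  then have *: "of_int (j - k) *\<^sub>C v j = 0" if "j \<in> J" for j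
    using insert.prems(1) that by (intro insert.IH[of "\<lambda>j. of_int (j - k) *\<^sub>C v j" j]) (auto intro: weight_scale)
  have 0: "v j = 0" if "j \<in> J" for j
    using *[OF that] that insert.hyps by (auto simp flip: of_int_diff)
  then have "v k = 0"
    using insert.prems(2) insert.hyps by (simp add: sum.neutral)
  then show ?case using insert.prems 0 by auto
qed simp

lemma weight_component:
  assumes "finite J" "\<And>j. weight j (v j)" "\<And>j. j \<notin> J \<Longrightarrow> v j = 0" "weight k (sum v J)"
  shows "sum v J = v k" "j \<noteq> k \<Longrightarrow> v j = 0"
proof -
  let ?u = "\<lambda>j. if j = k then v k - sum v J else v j"
  have sum: "sum ?u (insert k J) = 0"
  proof -
    have "sum ?u (insert k J) = v k - sum v J + sum v (J - {k})"
      using assms(1) by (simp add: sum.insert_remove)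
    also have "\<dots> = 0"
      using assms(1,3) by (cases "k \<in> J") (simp_all add: sum_diff1)
    finally show ?thesis .
  qed
  have w: "weight j (?u j)" for j
    using assms(2)[of k] assms(2)[of j] assms(4) weight_add[of k "v k" "(-1) *\<^sub>C sum v J"] weight_scale[of k _ "-1"]
    by auto
  show "sum v J = v k"
    using weight_independent[OF _ w sum, of k] assms(1) by auto
  show "v j = 0" if "j \<noteq> k"
    using weight_independent[OF _ w sum, of j] assms(1,3) that by (cases "j \<in> J") auto
qed

lemma comm_e_funpow_f:
  assumes "comm e n = 0" "weight j n"
  shows "comm e ((comm f ^^ Suc i) n) = (of_nat (Suc i) * of_int (j - int i)) *\<^sub>C (comm f ^^ i) n"
proof (induction i)
  case 0
  then show ?case using assms by (simp add: comm_jacobi comm_ef weight_def)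
next
  case (Suc i)
  have w: "weight (j - 2 * int i) ((comm f ^^ i) n)" for i
    using assms(2) by (rule weight_funpow_f)
  have "comm e ((comm f ^^ Suc (Suc i)) n) = comm h ((comm f ^^ Suc i) n) + comm f (comm e ((comm f ^^ Suc i) n))"
    by (simp add: comm_jacobi[of e f] comm_ef)
  also have "\<dots> = (of_int (j - 2 * int (Suc i)) + of_nat (Suc i) * of_int (j - int i)) *\<^sub>C (comm f ^^ Suc i) n"
    unfolding Suc using w[of "Suc i"] by (simp add: weight_def scaleC_add_left)
  also have "of_int (j - 2 * int (Suc i)) + of_nat (Suc i) * of_int (j - int i)
      = (of_nat (Suc (Suc i)) * of_int (j - int (Suc i)) :: complex)"
    by (simp add: algebra_simps)
  finally show ?case .
qed

lemma funpow_e_funpow_f: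
  assumes "comm e n = 0" "weight j n" "int K \<le> j"
  shows "\<exists>c. c \<noteq> 0 \<and> (comm e ^^ K) ((comm f ^^ K) n) = c *\<^sub>C n"
  using assms(3)
proof (induction K)
  case (Suc K)
  then obtain c where c: "c \<noteq> 0" "(comm e ^^ K) ((comm f ^^ K) n) = c *\<^sub>C n" by auto
  have "(comm e ^^ Suc K) ((comm f ^^ Suc K) n) = (comm e ^^ K) (comm e ((comm f ^^ Suc K) n))"
    by (simp add: funpow_swap1)
  also have "\<dots> = (of_nat (Suc K) * of_int (j - int K) * c) *\<^sub>C n"
    unfolding comm_e_funpow_f[OF assms(1,2)] by (simp add: funpow_comm_scaleC c)
  finally show ?case
    using c(1) Suc.prems by (intro exI[of _ "of_nat (Suc K) * of_int (j - int K) * c"]) (auto simp del: of_int_diff of_nat_Suc)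
qed (auto intro: exI[of _ 1])

lemma funpow_e_funpow_f_0:
  assumes "comm e n = 0" "weight j n" "i < K"
  shows "(comm e ^^ K) ((comm f ^^ i) n) = 0"
proof -
  have "(comm e ^^ Suc i) ((comm f ^^ i) n) = 0"
  proof (induction i)
    case (Suc i)
    have "(comm e ^^ Suc (Suc i)) ((comm f ^^ Suc i) n) = (comm e ^^ Suc i) (comm e ((comm f ^^ Suc i) n))"
      by (simp add: funpow_swap1)
    then show ?case
      unfolding comm_e_funpow_f[OF assms(1,2)] funpow_comm_scaleC Suc by simp
  qed (simp add: assms)
  then show ?thesis
    by (rule funpow_comm_mono) (use assms(3) in simp)
qed

text \<open>Induction on the nilpotency exponent. If ad \<open>e\<close> kills \<open>v\<close>
  after n + 1 steps, then (ad e)^n sends [e, [f, v]] to c (ad e)^n v with c = (n + 1) (j + n), so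
  [e, [f, v]] - c v is killed after n steps and lies in the image of ad \<open>e\<close>. As j > 0
  gives c nonzero, so does \<open>v\<close>.\<close>

lemma comm_e_surj:
  assumes "weight j v" "j > 0" "nilp e v"
  shows "\<exists>b. weight (j - 2) b \<and> comm e b = v"
proof -
  obtain n where "(comm e ^^ n) v = 0" using assms(3) by (auto simp: nilp_def)
  then show ?thesis
    using assms(1)
  proof (induction n arbitrary: v)
    case 0
    then show ?case by (auto intro: exI[of _ 0] simp: weight_0)
  next
    case (Suc n)
    have wt: "weight (j + 2 * int i) ((comm e ^^ i) v)" for i
      using Suc.prems(2) by (rule weight_funpow_e)
    have step: "(comm e ^^ i) (comm e (comm f v)) = comm f ((comm e ^^ Suc i) v)
        + (of_nat (Suc i) * of_int (j + int i)) *\<^sub>C (comm e ^^ i) v" for i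
    proof (induction i)
      case 0
      then show ?case using Suc.prems(2) by (simp add: comm_jacobi[of e f] comm_ef weight_def)
    next
      case (Suc i)
      have "(comm e ^^ Suc i) (comm e (comm f v)) = comm h ((comm e ^^ Suc i) v) + comm f (comm e ((comm e ^^ Suc i) v))
         + (of_nat (Suc i) * of_int (j + int i)) *\<^sub>C (comm e ^^ Suc i) v"
        using Suc by (simp add: comm_add_right comm_jacobi[of e f] comm_ef)
      also have "\<dots> = comm f ((comm e ^^ Suc (Suc i)) v)
         + (of_int (j + 2 * int (Suc i)) + of_nat (Suc i) * of_int (j + int i)) *\<^sub>C (comm e ^^ Suc i) v"
        using wt[of "Suc i"] by (simp add: weight_def scaleC_add_left)
      also have "of_int (j + 2 * int (Suc i)) + of_nat (Suc i) * of_int (j + int i)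
         = (of_nat (Suc (Suc i)) * of_int (j + int (Suc i)) :: complex)"
        by (simp add: algebra_simps)
      finally show ?case .
    qed
    define c :: complex where "c = of_nat (Suc n) * of_int (j + int n)"
    have c: "c \<noteq> 0"
      unfolding c_def using assms(2) by (auto simp del: of_int_add of_nat_Suc)
    let ?v = "comm e (comm f v) + (- c) *\<^sub>C v"
    have "(comm e ^^ n) ?v = 0"
      using step[of n] Suc.prems(1) unfolding funpow_comm_add funpow_comm_scaleC c_def by simp
    moreover have "weight j ?v"
      using weight_e[OF weight_f[OF Suc.prems(2)]] Suc.prems(2) by (intro weight_add weight_scale) auto
    ultimately obtain b where b: "weight (j - 2) b" "comm e b = ?v"
      using Suc.IH by blast
    have "comm e (inverse c *\<^sub>C (comm f v + (- 1) *\<^sub>C b)) = v"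
      using b c by (simp add: comm_diff_right scaleC_add_right scaleC_diff_right)
    moreover have "weight (j - 2) (inverse c *\<^sub>C (comm f v + (- 1) *\<^sub>C b))"
      by (intro weight_scale weight_add weight_f b Suc.prems)
    ultimately show ?case by blast
  qed
qed

lemma comm_e_inj:
  assumes "weight j v" "j < 0" "comm e v = 0" "nilp f v"
  shows "v = 0"
proof (rule ccontr)
  assume "v \<noteq> 0"
  have "(comm f ^^ i) v \<noteq> 0" for i
  proof (induction i)
    case (Suc i)
    have "(of_nat (Suc i) * of_int (j - int i)) *\<^sub>C (comm f ^^ i) v \<noteq> 0"
      using Suc assms(2) by (auto simp del: of_int_diff of_nat_Suc)
    then show ?case
      using comm_e_funpow_f[OF assms(3,1), of i] by auto
  qed (simp add: \<open>v \<noteq> 0\<close>)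
  then show False using assms(4) by (auto simp: nilp_def)
qed

text \<open>The vector [e, v] has weight 0, and lowering it gives a highest weight vector of weight
  -2, which vanishes by nilpotency of ad \<open>f\<close>. Then ad \<open>e\<close> sends (ad
  f)^(i+1) v to a nonzero multiple of (ad f)^i v for every i, so no power of ad \<open>f\<close>
  could kill a nonzero \<open>v\<close>.\<close>

lemma comm_e_e_inj:
  assumes "weight (-2) v" "comm e (comm e v) = 0" "nilp f v" "nilp f (comm f (comm e v))"
  shows "v = 0"
proof (rule ccontr)
  assume "v \<noteq> 0"
  let ?u = "comm e v"
  have u: "weight 0 ?u" using weight_e[OF assms(1)] by simp
  have "comm e (comm f ?u) = 0"
    using u assms(2) by (simp add: comm_jacobi[of e f] comm_ef weight_def)
  then have fu: "comm f ?u = 0"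
    using comm_e_inj[OF weight_f[OF u]] assms(4) by simp
  have wt: "weight (- 2 - 2 * int i) ((comm f ^^ i) v)" for i
    using assms(1) by (rule weight_funpow_f)
  have eq: "comm e ((comm f ^^ Suc i) v) = (- of_nat (Suc i) * of_nat (Suc (Suc i))) *\<^sub>C (comm f ^^ i) v" for i
  proof (induction i)
    case 0
    then show ?case using assms(1) fu by (simp add: comm_jacobi[of e f] comm_ef weight_def)
  next
    case (Suc i)
    have "comm e ((comm f ^^ Suc (Suc i)) v) = comm h ((comm f ^^ Suc i) v) + comm f (comm e ((comm f ^^ Suc i) v))"
      by (simp add: comm_jacobi[of e f] comm_ef)
    also have "\<dots> = (of_int (- 2 - 2 * int (Suc i)) + (- of_nat (Suc i) * of_nat (Suc (Suc i)))) *\<^sub>C (comm f ^^ Suc i) v"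
      unfolding Suc using wt[of "Suc i"] unfolding weight_def scaleC_add_left by simp
    also have "of_int (- 2 - 2 * int (Suc i)) + (- of_nat (Suc i) * of_nat (Suc (Suc i)))
       = (- of_nat (Suc (Suc i)) * of_nat (Suc (Suc (Suc i))) :: complex)"
      by (simp add: algebra_simps)
    finally show ?case .
  qed
  have "(comm f ^^ i) v \<noteq> 0" for i
  proof (induction i)
    case (Suc i)
    have "(- of_nat (Suc i) * of_nat (Suc (Suc i)) :: complex) \<noteq> 0"
      by (simp del: of_nat_Suc)
    then have "(- of_nat (Suc i) * of_nat (Suc (Suc i))) *\<^sub>C (comm f ^^ i) v \<noteq> 0"
      using Suc by simp
    then show ?case
      using eq[of i] by auto
  qed (simp add: \<open>v \<noteq> 0\<close>)
  then show False using assms(3) by (auto simp: nilp_def)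
qed

end

section \<open>Derivations\<close>

definition derivation :: "('a::complex_algebra \<Rightarrow> 'a) \<Rightarrow> bool" where
  "derivation d \<longleftrightarrow> (\<forall>a b. d (a + b) = d a + d b) \<and> (\<forall>c a. d (c *\<^sub>C a) = c *\<^sub>C d a) \<and>
     (\<forall>a b. d (a * b) = d a * b + a * d b)"

lemma derivationD:
  assumes "derivation d"
  shows "d (a + b) = d a + d b" "d (c *\<^sub>C a) = c *\<^sub>C d a" "d (a * b) = d a * b + a * d b"
    "d 0 = 0" "d 1 = 0" "d (- a) = - d a" "d (a - b) = d a - d b" "d (comm a b) = comm (d a) b + comm a (d b)"
proof -
  show add: "d (a + b) = d a + d b" and mult: "d (a * b) = d a * b + a * d b"
    and scale: "d (c *\<^sub>C a) = c *\<^sub>C d a" for a b c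
    using assms by (auto simp: derivation_def)
  show "d 0 = 0" using scale[of 0 0] by simp
  show "d 1 = 0" using mult[of 1 1] by simp
  show minus: "d (- a) = - d a" for a using scale[of "-1" a] by simp
  show diff: "d (a - b) = d a - d b" for a b using add[of a "- b"] minus[of b] by simp
  show "d (comm a b) = comm (d a) b + comm a (d b)"
    by (simp add: comm_def diff mult)
qed

lemma derivation_comm: "derivation (comm a)"
  by (simp add: derivation_def comm_add_right comm_mult_right)

lemma derivation_diff: "derivation d \<Longrightarrow> derivation d' \<Longrightarrow> derivation (\<lambda>b. d b - d' b)"
  by (simp add: derivation_def algebra_simps scaleC_diff_right)

section \<open>Weight spaces and highest weight vectors when the generators generate the
  algebra\<close>

locale hecke_gen = hecke +
  assumes generated: "S 1 \<Longrightarrow> (\<And>a b. S a \<Longrightarrow> S b \<Longrightarrow> S (a + b)) \<Longrightarrow> (\<And>c a. S a \<Longrightarrow> S (c *\<^sub>C a)) \<Longrightarrow>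
    (\<And>a. S a \<Longrightarrow> S (e * a) \<and> S (f * a) \<and> S (h * a) \<and> S (x * a) \<and> S (y * a)) \<Longrightarrow> S a"
begin

lemma M_all: "M a"
proof (rule generated)
  have "NN 0 1" using NN_closed(9)[of 1] by (simp add: one_pCons)
  then show "M 1" by (rule M_NN)
qed (use M_efh M_xy in \<open>auto intro: M.intros\<close>)

lemma nilp_e: "nilp e a"
proof (rule generated)
  have "nilp e e" "nilp e f" "nilp e h" "nilp e x" "nilp e y"
    using comm_swap[of e h] by (auto intro!: nilp_3 simp: comm_ef comm_he comm_ex comm_ey comm_minus_right)
  then show "nilp e (e * a) \<and> nilp e (f * a) \<and> nilp e (h * a) \<and> nilp e (x * a) \<and> nilp e (y * a)" if "nilp e a" for a
    using that by (auto intro: nilp_mult)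
qed (auto intro: nilp_add nilp_scale nilp_3)

lemma nilp_f: "nilp f a"
proof (rule generated)
  have "nilp f e" "nilp f f" "nilp f h" "nilp f x" "nilp f y"
    by (auto intro!: nilp_3 simp: comm_fe comm_fh comm_fx comm_fy comm_minus_right)
  then show "nilp f (e * a) \<and> nilp f (f * a) \<and> nilp f (h * a) \<and> nilp f (x * a) \<and> nilp f (y * a)" if "nilp f a" for a
    using that by (auto intro: nilp_mult)
qed (auto intro: nilp_add nilp_scale nilp_3)

lemma derivation_eqI:
  assumes d: "derivation d" and d': "derivation d'"
    and "d e = d' e" "d f = d' f" "d h = d' h" "d x = d' x" "d y = d' y"
  shows "d a = d' a"
  by (rule generated) (simp_all add: derivationD[OF d] derivationD[OF d'] assms(3-))

text \<open>A graded form of \<open>M\<close>. Recording the weight during the construction yields a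
  finite weight decomposition of every element of \<open>M\<close>, hence of the whole algebra;
  \<open>V_zero\<close> fills the weights outside the finite support.\<close>

inductive V :: "int \<Rightarrow> 'a \<Rightarrow> bool" where
  V_NN: "NN k n \<Longrightarrow> V (int k) n"
| V_comm: "V j m \<Longrightarrow> V (j - 2) (comm f m)"
| V_add: "V j m \<Longrightarrow> V j n \<Longrightarrow> V j (m + n)"
| V_scale: "V j m \<Longrightarrow> V j (c *\<^sub>C m)"
| V_zero: "V j 0"

lemma NN_weight': "NN k n \<Longrightarrow> weight (int k) n"
  using NN_weight by (simp add: weight_def)

lemma V_weight: "V j m \<Longrightarrow> weight j m"
  by (induction rule: V.induct) (auto intro: NN_weight' weight_f weight_add weight_scale weight_0)

lemma V_decomp: "M m \<Longrightarrow> \<exists>J v. finite J \<and> (\<forall>j. V j (v j)) \<and> (\<forall>j. j \<notin> J \<longrightarrow> v j = 0) \<and> m = sum v J"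
proof (induction rule: M.induct)
  case (M_NN k n)
  then show ?case
    by (intro exI[of _ "{int k}"] exI[of _ "\<lambda>j. if j = int k then n else 0"]) (auto intro: V.intros)
next
  case (M_add m n)
  then obtain J v K u where *: "finite J" "\<And>j. V j (v j)" "\<And>j. j \<notin> J \<Longrightarrow> v j = 0" "m = sum v J"
    "finite K" "\<And>j. V j (u j)" "\<And>j. j \<notin> K \<Longrightarrow> u j = 0" "n = sum u K" by metis
  have "m = sum v (J \<union> K)" "n = sum u (J \<union> K)"
    using * by (auto intro!: sum.mono_neutral_left)
  then show ?case
    using * by (intro exI[of _ "J \<union> K"] exI[of _ "\<lambda>j. v j + u j"]) (auto intro: V_add simp: sum.distrib)
next
  case (M_scale m c)
  then obtain J v where "finite J" "\<And>j. V j (v j)" "\<And>j. j \<notin> J \<Longrightarrow> v j = 0" "m = sum v J" by metis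
  then show ?case
    by (intro exI[of _ J] exI[of _ "\<lambda>j. c *\<^sub>C v j"]) (auto intro: V_scale simp: scaleC_sum_right)
next
  case (M_comm m)
  then obtain J v where *: "finite J" "\<And>j. V j (v j)" "\<And>j. j \<notin> J \<Longrightarrow> v j = 0" "m = sum v J" by metis
  have "comm f m = (\<Sum>j\<in>(\<lambda>j. j - 2) ` J. comm f (v (j + 2)))"
    unfolding *(4) comm_sum_right by (subst sum.reindex) (auto simp: inj_on_def)
  moreover have "V j (comm f (v (j + 2)))" for j
    using V_comm[OF *(2)[of "j + 2"]] by simp
  moreover have "j \<notin> (\<lambda>j. j - 2) ` J \<Longrightarrow> v (j + 2) = 0" for j
    using *(3)[of "j + 2"] by force
  ultimately show ?case
    using *(1) by (intro exI[of _ "(\<lambda>j. j - 2) ` J"] exI[of _ "\<lambda>j. comm f (v (j + 2))"]) auto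
qed

lemma weight_V: "weight j v \<Longrightarrow> V j v"
proof -
  assume j: "weight j v"
  obtain J u where *: "finite J" "\<And>j. V j (u j)" "\<And>j. j \<notin> J \<Longrightarrow> u j = 0" "v = sum u J"
    using V_decomp[OF M_all[of v]] by metis
  then show ?thesis
    using weight_component(1)[of J u j] j V_weight by metis
qed

lemma weight_decomp: "\<exists>J v. finite J \<and> (\<forall>j. weight j (v j)) \<and> (\<forall>j. j \<notin> J \<longrightarrow> v j = 0) \<and> a = sum v J"
  using V_decomp[OF M_all[of a]] V_weight by metis

lemma V_powers: "V j m \<Longrightarrow> \<exists>K n. (\<forall>i. if j + 2 * int i < 0 then n i = 0 else NN (nat (j + 2 * int i)) (n i)) \<and>
    (\<forall>i\<ge>K. n i = 0) \<and> m = (\<Sum>i<K. (comm f ^^ i) (n i))"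
proof (induction rule: V.induct)
  case (V_NN k n)
  then show ?case
    by (intro exI[of _ 1] exI[of _ "\<lambda>i. if i = 0 then n else 0"]) (auto simp: NN_closed)
next
  case (V_comm j m)
  then obtain K n where *: "\<And>i. if j + 2 * int i < 0 then n i = 0 else NN (nat (j + 2 * int i)) (n i)"
    "\<forall>i\<ge>K. n i = 0" "m = (\<Sum>i<K. (comm f ^^ i) (n i))" by blast
  define n' where "n' = (\<lambda>i. case i of 0 \<Rightarrow> 0 | Suc i \<Rightarrow> n i)"
  have "if j - 2 + 2 * int i < 0 then n' i = 0 else NN (nat (j - 2 + 2 * int i)) (n' i)" for i
    using *(1)[of "i - 1"] by (cases i) (auto simp: n'_def NN_closed algebra_simps)
  moreover have "\<forall>i\<ge>Suc K. n' i = 0"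
    using *(2) by (auto simp: n'_def split: nat.split)
  moreover have "comm f m = (\<Sum>i<Suc K. (comm f ^^ i) (n' i))"
    unfolding *(3) comm_sum_right by (simp add: sum.lessThan_Suc_shift n'_def del: sum.lessThan_Suc)
  ultimately show ?case by blast
next
  case (V_add j m m')
  obtain K n where *: "\<And>i. if j + 2 * int i < 0 then n i = 0 else NN (nat (j + 2 * int i)) (n i)"
    "\<And>i. i \<ge> K \<Longrightarrow> n i = 0" "m = (\<Sum>i<K. (comm f ^^ i) (n i))" using V_add.IH(1) by blast
  obtain L l where **: "\<And>i. if j + 2 * int i < 0 then l i = 0 else NN (nat (j + 2 * int i)) (l i)"
    "\<And>i. i \<ge> L \<Longrightarrow> l i = 0" "m' = (\<Sum>i<L. (comm f ^^ i) (l i))" using V_add.IH(2) by blast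
  have "m = (\<Sum>i<max K L. (comm f ^^ i) (n i))" "m' = (\<Sum>i<max K L. (comm f ^^ i) (l i))"
    unfolding * ** using *(2) **(2) by (intro sum.mono_neutral_left; simp)+
  then have "m + m' = (\<Sum>i<max K L. (comm f ^^ i) (n i + l i))"
    by (simp add: funpow_comm_add sum.distrib)
  moreover have "if j + 2 * int i < 0 then n i + l i = 0 else NN (nat (j + 2 * int i)) (n i + l i)" for i
    using *(1)[of i] **(1)[of i] by (auto intro: NN_add)
  ultimately show ?case
    using *(2) **(2) by (intro exI[of _ "max K L"] exI[of _ "\<lambda>i. n i + l i"]) auto
next
  case (V_scale j m c)
  then obtain K n where *: "\<And>i. if j + 2 * int i < 0 then n i = 0 else NN (nat (j + 2 * int i)) (n i)"
    "\<And>i. i \<ge> K \<Longrightarrow> n i = 0" "m = (\<Sum>i<K. (comm f ^^ i) (n i))" by blast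
  have "if j + 2 * int i < 0 then c *\<^sub>C n i = 0 else NN (nat (j + 2 * int i)) (c *\<^sub>C n i)" for i
    using *(1)[of i] by (auto intro: NN_closed)
  then show ?case
    using *(2,3) by (intro exI[of _ K] exI[of _ "\<lambda>i. c *\<^sub>C n i"]) (auto simp: scaleC_sum_right funpow_comm_scaleC)
next
  case (V_zero j)
  then show ?case by (intro exI[of _ 0] exI[of _ "\<lambda>_. 0"]) (auto simp: NN_closed)
qed

text \<open>Write \<open>v\<close> as a sum of (ad f)^i (n i) with \<open>n i\<close> of highest
  weight k + 2 i. The power (ad e)^K kills \<open>v\<close> for K > 0 and all terms with i < K, and
  it turns the term i = K into a nonzero multiple of \<open>n K\<close>. So the last term vanishes,
  and the sum shrinks until only \<open>n 0\<close> is left.\<close>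

lemma highest_weight:
  assumes "comm e v = 0" "weight (int k) v"
  shows "NN k v"
proof -
  obtain K n where *: "\<And>i. if int k + 2 * int i < 0 then n i = 0 else NN (nat (int k + 2 * int i)) (n i)"
    "v = (\<Sum>i<K. (comm f ^^ i) (n i))"
    using V_powers[OF weight_V[OF assms(2)]] by blast
  have n: "NN (k + 2 * i) (n i)" for i
    using *(1)[of i] by (simp add: nat_add_distrib nat_mult_distrib)
  show ?thesis
    using *(2)
  proof (induction K)
    case (Suc K)
    show ?case
    proof (cases K)
      case 0
      then show ?thesis using Suc.prems n[of 0] by simp
    next
      case K: (Suc K')
      have hw: "comm e (n i) = 0" "weight (int k + 2 * int i) (n i)" for i
        using NN_weight(1)[OF n] NN_weight'[OF n[of i]] by auto
      have "(comm e ^^ K) v = 0"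
        using assms(1) K by (simp add: funpow_swap1)
      moreover have "(comm e ^^ K) v = (comm e ^^ K) ((comm f ^^ K) (n K))"
        unfolding Suc.prems funpow_comm_sum using funpow_e_funpow_f_0[OF hw]
        by (simp add: sum.neutral)
      ultimately have "n K = 0"
        using funpow_e_funpow_f[OF hw, of K K] by auto
      then have "v = (\<Sum>i<K. (comm f ^^ i) (n i))"
        using Suc.prems by simp
      then show ?thesis by (rule Suc.IH)
    qed
  qed (simp add: NN_closed)
qed

text \<open>The operator k - ad \<open>h\<close> multiplies the component of weight j by k - j. Its
  image has no component of weight k, and it is injective on all other weights.\<close>

lemma weight_from_equation:
  assumes "of_int k *\<^sub>C a - comm h a = b" "weight k b"
  shows "weight k a" "b = 0"
proof -
  obtain J v where *: "finite J" "\<And>j. weight j (v j)" "\<And>j. j \<notin> J \<Longrightarrow> v j = 0" "a = sum v J"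
    using weight_decomp by metis
  let ?u = "\<lambda>j. of_int (k - j) *\<^sub>C v j"
  have "b = sum ?u J"
    using assms(1) *(2)
    by (simp add: *(4) comm_sum_right weight_def scaleC_sum_right scaleC_diff_left sum_subtractf)
  have w: "weight j (?u j)" for j
    by (intro weight_scale *(2))
  have z: "?u j = 0" if "j \<notin> J" for j
    using *(3)[OF that] by simp
  note component = weight_component[of J ?u k, OF *(1) w z, folded \<open>b = sum ?u J\<close>, OF _ assms(2)]
  show "b = 0" using component(1) by simp
  have "v j = 0" if "j \<noteq> k" for j
    using component(2)[OF _ that] that by (auto simp flip: of_int_diff)
  then have "a = (\<Sum>j\<in>J. if j = k then v j else 0)"
    unfolding *(4) by (intro sum.cong) auto
  also have "\<dots> = v k"
    using *(1,3) by simp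
  finally have "a = v k" .
  then show "weight k a" using *(2) by simp
qed

text \<open>A direct proof of Whitehead's first lemma for the inclusion of sl2.\<close>

lemma derivation_inner_on_sl2:
  assumes d: "derivation d"
  shows "\<exists>a. d e = comm a e \<and> d f = comm a f \<and> d h = comm a h"
proof -
  obtain J v where *: "finite J" "\<And>j. weight j (v j)" "\<And>j. j \<notin> J \<Longrightarrow> v j = 0" "d h = sum v J"
    using weight_decomp by metis
  \<comment> \<open>Dividing the component of nonzero weight j by j inverts ad \<open>h\<close>
    there, so subtracting this inner derivation leaves only the weight 0 part of
    \<open>d h\<close>.\<close>
  define a1 where "a1 = - (\<Sum>j\<in>J - {0}. inverse (of_int j) *\<^sub>C v j)"
  define d1 where "d1 = (\<lambda>b. d b - comm a1 b)"
  have d1: "derivation d1"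
    unfolding d1_def by (intro derivation_diff d derivation_comm)
  have "comm a1 h = (\<Sum>j\<in>J - {0}. v j)"
    using *(2) unfolding comm_swap[of a1 h]
    by (simp add: a1_def comm_minus_right comm_sum_right weight_def)
  moreover have "sum v J = v 0 + (\<Sum>j\<in>J - {0}. v j)"
    using *(1,3) by (cases "0 \<in> J") (simp_all add: sum.remove)
  ultimately have d1h: "d1 h = v 0"
    by (simp add: d1_def *(4))
  have v0: "weight 0 (v 0)" "comm h (v 0) = 0"
    using *(2)[of 0] by (simp_all add: weight_def)
  have we: "weight 2 e" "weight (-2) f"
    by (simp_all add: weight_def comm_he comm_hf)
  have weight_comm: "weight i (comm (v 0) b)" if "weight i b" for i b
    using v0 that by (simp add: weight_def comm_jacobi[of h])
  \<comment> \<open>Applying the derivation to [h, e] = 2 e forces both that \<open>d1 e\<close> has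
    weight 2 and that \<open>v 0\<close> commutes with \<open>e\<close>. The second fact is what
    later removes \<open>v 0\<close>.\<close>
  have "d1 (comm h e) = comm (v 0) e + comm h (d1 e)"
    by (simp add: derivationD[OF d1] d1h)
  then have "of_int 2 *\<^sub>C d1 e - comm h (d1 e) = comm (v 0) e"
    by (simp add: comm_he derivationD[OF d1])
  from weight_from_equation[OF this weight_comm[OF we(1)]]
  have d1e: "weight 2 (d1 e)" "comm (v 0) e = 0" by auto
  obtain b where b: "weight 0 b" "comm e b = d1 e"
    using comm_e_surj[OF d1e(1) _ nilp_e] by auto
  define d2 where "d2 = (\<lambda>u. d1 u - comm (- b) u)"
  have d2: "derivation d2"
    unfolding d2_def by (intro derivation_diff d1 derivation_comm)
  have swap: "comm (- b) u = comm u b" for u by (simp add: comm_def)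
  have d2e: "d2 e = 0" and d2h: "d2 h = v 0"
    using b by (simp_all add: d2_def swap d1h weight_def)
  have "d2 (comm h f) = comm (v 0) f + comm h (d2 f)"
    by (simp add: derivationD[OF d2] d2h)
  then have "of_int (-2) *\<^sub>C d2 f - comm h (d2 f) = comm (v 0) f"
    by (simp add: comm_hf derivationD[OF d2] algebra_simps)
  from weight_from_equation[OF this weight_comm[OF we(2)]]
  have d2f: "weight (-2) (d2 f)" by auto
  have ef: "comm e (d2 f) = v 0"
    using derivationD(8)[OF d2, of e f] by (simp add: comm_ef d2e d2h)
  \<comment> \<open>Since [e, d2 f] = v 0 and [e, v 0] = 0, applying ad \<open>e\<close> twice kills
    \<open>d2 f\<close>, an element of weight -2.\<close>
  have "d2 f = 0"
    using comm_e_e_inj[OF d2f _ nilp_f nilp_f] d1e(2) comm_swap[of e "v 0"] by (simp add: ef)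
  then have "d2 f = 0" "d2 h = 0"
    using ef d2h by simp_all
  then have "d u = comm (a1 - b) u" if "u \<in> {e, f, h}" for u
    using d2e that by (auto simp: d2_def d1_def comm_diff_left swap comm_swap[of b] diff_eq_eq add.commute)
  then show ?thesis by blast
qed

end

section \<open>Polynomial difference equations\<close>

text \<open>The binomial coefficients "s over k" as polynomials in s. The forward difference lowers
  k by one on them, so in this basis a difference equation is solved by an index shift.\<close>

fun binom_poly :: "nat \<Rightarrow> complex poly" where
  "binom_poly 0 = 1"
| "binom_poly (Suc k) = smult (inverse (of_nat (Suc k))) ([:- of_nat k, 1:] * binom_poly k)"

lemma binom_poly_shift: "pcompose (binom_poly (Suc k)) [:1, 1:] = binom_poly (Suc k) + binom_poly k"
proof (induction k)
  case 0
  then show ?case by (simp add: pcompose_pCons one_pCons)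
next
  case (Suc k)
  have nz: "of_nat (Suc (Suc k)) \<noteq> (0::complex)" by (rule of_nat_neq_0)
  have "poly (binom_poly (Suc (Suc k))) (1 + s) = poly (binom_poly (Suc (Suc k))) s + poly (binom_poly (Suc k)) s" for s
  proof -
    have B: "of_nat (Suc k) * poly (binom_poly (Suc k)) s = (s - of_nat k) * poly (binom_poly k) s"
      using of_nat_neq_0[of k, where ?'a = complex] by (simp del: of_nat_Suc add: field_simps)
    have IH: "poly (binom_poly (Suc k)) (1 + s) = poly (binom_poly (Suc k)) s + poly (binom_poly k) s"
      using arg_cong[OF Suc, of "\<lambda>p. poly p s"] by (simp add: poly_pcompose del: binom_poly.simps)
    have unfold: "of_nat (Suc (Suc k)) * poly (binom_poly (Suc (Suc k))) u
        = (u - of_nat (Suc k)) * poly (binom_poly (Suc k)) u" for u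
      using nz by (subst binom_poly.simps) (simp del: of_nat_Suc binom_poly.simps add: field_simps)
    have "of_nat (Suc (Suc k)) * poly (binom_poly (Suc (Suc k))) (1 + s)
        = (s - of_nat k) * (poly (binom_poly (Suc k)) s + poly (binom_poly k) s)"
      unfolding unfold IH by simp
    also have "\<dots> = (s - of_nat k) * poly (binom_poly (Suc k)) s + of_nat (Suc k) * poly (binom_poly (Suc k)) s"
      unfolding B by (simp add: distrib_left)
    also have "\<dots> = of_nat (Suc (Suc k)) * (poly (binom_poly (Suc (Suc k))) s + poly (binom_poly (Suc k)) s)"
      unfolding distrib_left[of "of_nat (Suc (Suc k))"] unfold by (simp add: algebra_simps del: binom_poly.simps)
    finally show ?thesis
      using nz by simp
  qed
  then show ?case
    by (intro poly_eq_poly_eq_iff[THEN iffD1] ext) (simp add: poly_pcompose del: binom_poly.simps)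
qed

inductive binom_span :: "complex poly \<Rightarrow> bool" where
  "binom_span (binom_poly k)"
| "binom_span p \<Longrightarrow> binom_span q \<Longrightarrow> binom_span (p + q)"
| "binom_span p \<Longrightarrow> binom_span (smult c p)"

lemma binom_span_all: "binom_span p"
proof (induction p)
  case 0
  have "binom_span (smult 0 (binom_poly 0))" by (intro binom_span.intros)
  then show ?case by simp
next
  case (pCons a p)
  have "binom_span (pCons 0 p)"
    using pCons(2)
  proof (induction rule: binom_span.induct)
    case (1 k)
    have "pCons 0 (binom_poly k) = smult (of_nat (Suc k)) (binom_poly (Suc k)) + smult (of_nat k) (binom_poly k)"
      by (simp del: of_nat_Suc)
    then show ?case by (metis binom_span.intros)
  next
    case (2 p q)
    have "pCons 0 (p + q) = pCons 0 p + pCons 0 q" by simp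
    with 2 show ?case by (metis binom_span.intros(2))
  next
    case (3 p c)
    have "pCons 0 (smult c p) = smult c (pCons 0 p)" by simp
    with 3 show ?case by (metis binom_span.intros(3))
  qed
  moreover have "binom_span (smult a (binom_poly 0))" by (intro binom_span.intros)
  moreover have "pCons a p = smult a (binom_poly 0) + pCons 0 p" by (simp add: one_pCons)
  ultimately show ?case by (metis binom_span.intros(2))
qed

lemma difference_surj: "\<exists>F::complex poly. pcompose F [:1, 1:] - F = p"
  using binom_span_all[of p]
proof (induction rule: binom_span.induct)
  case (1 k)
  then show ?case using binom_poly_shift[of k] by (metis add_diff_cancel_left')
next
  case (2 p q)
  then obtain F G where FG: "pcompose F [:1, 1:] - F = p" "pcompose G [:1, 1:] - G = q" by blast
  have "pcompose (F + G) [:1, 1:] - (F + G) = p + q"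
    unfolding FG[symmetric] pcompose_add by simp
  then show ?case by blast
next
  case (3 p c)
  then obtain F where F: "pcompose F [:1, 1:] - F = p" by blast
  have "pcompose (smult c F) [:1, 1:] - smult c F = smult c p"
    unfolding F[symmetric] pcompose_smult smult_diff_right ..
  then show ?case by blast
qed

lemma even_poly:
  fixes p :: "complex poly"
  assumes "pcompose p [:0, -1:] = p"
  shows "\<exists>r. p = pcompose r [:0, 0, 1:]"
  using assms
proof (induction p rule: measure_induct_rule[of degree])
  case (less p)
  obtain a q0 where p0: "p = pCons a q0" by (cases p)
  obtain b q where q0: "q0 = pCons b q" by (cases q0)
  have p: "p = pCons a (pCons b q)" using p0 q0 by simp
  show ?case
  proof (cases "q = 0")
    case True
    then have "b = - b" using less.prems by (simp add: p pcompose_pCons)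
    then have "p = pcompose [:a:] [:0, 0, 1:]" using True p by (simp add: pcompose_pCons)
    then show ?thesis by blast
  next
    case False
    have "pCons a (pCons (- b) (pcompose q [:0, -1:])) = pCons a (pCons b q)"
      using less.prems by (simp add: p pcompose_pCons)
    then have b: "b = 0" and q: "pcompose q [:0, -1:] = q" by auto
    have "degree q < degree p" using False by (simp add: p)
    from less.IH[OF this q] obtain r where r: "q = pcompose r [:0, 0, 1:]" by blast
    have "p = pcompose (pCons a r) [:0, 0, 1:]"
      by (simp add: p b pcompose_pCons r)
    then show ?thesis by blast
  qed
qed

text \<open>Let F be a sum of p, that is F(s + 1) - F(s) = p(s). Antisymmetry says that F(-s) is a
  sum of p as well, hence so is the even polynomial (F(s) + F(-s)) / 2, and an even polynomial has
  the form r(s^2).\<close>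

lemma antisymmetric_poly:
  fixes p :: "complex poly"
  assumes "pcompose p [:-1, -1:] = - p"
  shows "\<exists>r. p = pcompose r [:1, 2, 1:] - pcompose r [:0, 0, 1:]"
proof -
  obtain F where F: "pcompose F [:1, 1:] - F = p" using difference_surj by blast
  have F': "poly F (s + 1) - poly F s = poly p s" for s
    using arg_cong[OF F, of "\<lambda>p. poly p s"] by (simp add: poly_pcompose add.commute)
  have p: "poly p (- 1 - s) = - poly p s" for s
    using arg_cong[OF assms, of "\<lambda>p. poly p s"] by (simp add: poly_pcompose)
  define E where "E = smult (1/2) (F + pcompose F [:0, -1:])"
  have E: "poly E s = (poly F s + poly F (- s)) / 2" for s
    by (simp add: E_def poly_pcompose)
  have "pcompose E [:0, -1:] = E"
    by (intro poly_eq_poly_eq_iff[THEN iffD1] ext) (simp add: poly_pcompose E add.commute)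
  then obtain r where r: "E = pcompose r [:0, 0, 1:]" using even_poly by blast
  have rE: "poly r (s * s) = poly E s" for s
    unfolding r by (simp add: poly_pcompose)
  have "poly p s = poly E (s + 1) - poly E s" for s
  proof -
    have "poly F (- s) - poly F (- 1 - s) = - poly p s"
      using F'[of "- 1 - s"] p[of s] by simp
    moreover have "- (s + 1) = - 1 - s" by simp
    ultimately have "poly F (- (s + 1)) - poly F (- s) = poly p s"
      by (simp add: algebra_simps)
    with F'[of s] show ?thesis unfolding E by (simp add: field_simps)
  qed
  then have "p = pcompose r [:1, 2, 1:] - pcompose r [:0, 0, 1:]"
    by (intro poly_eq_poly_eq_iff[THEN iffD1] ext)
       (simp add: poly_pcompose flip: rE, simp add: algebra_simps)
  then show ?thesis by blast
qed

text \<open>Under s to -1 - s the squares (s + 1)^2 and s^2 are exchanged, while 2 s + 3 becomes -(2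
  s - 1) and 2 s - 1 becomes -(2 s + 3). So the right-hand side is antisymmetric.\<close>

lemma zt_exists:
  fixes zp :: "complex poly"
  shows "\<exists>zt. pcompose zt [:1, 2, 1:] - pcompose zt [:0, 0, 1:]
      = - ([:3, 2:] * pcompose zp [:1, 2, 1:] + [:-1, 2:] * pcompose zp [:0, 0, 1:])"
proof -
  have *: "1 + (- 1 - s) * (2 + (- 1 - s)) = s * s" "(- 1 - s) * (- 1 - s) = 1 + s * (2 + s)" for s :: complex
    by (simp_all add: algebra_simps)
  have "pcompose (- ([:3, 2:] * pcompose zp [:1, 2, 1:] + [:-1, 2:] * pcompose zp [:0, 0, 1:])) [:-1, -1:]
     = - (- ([:3, 2:] * pcompose zp [:1, 2, 1:] + [:-1, 2:] * pcompose zp [:0, 0, 1:]))"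
    by (intro poly_eq_poly_eq_iff[THEN iffD1] ext) (simp add: poly_pcompose *, simp add: algebra_simps)
  from antisymmetric_poly[OF this] show ?thesis
    by (elim exE, intro exI) (erule sym)
qed

lemma poly_constant_if_periodic:
  fixes q :: "complex poly"
  assumes "\<And>n::int. poly q (of_int n + 1/2) = poly q (of_int n - 1/2)"
  shows "\<exists>k. q = [:k:]"
proof -
  have step: "poly q (of_int (n + 1) + 1/2) = poly q (of_int n + 1/2)" for n :: int
    using assms[of "n + 1"] by (simp add: algebra_simps)
  have c: "poly q (of_int (int n) + 1/2) = poly q (1/2)" for n
  proof (induction n)
    case (Suc n)
    then show ?case using step[of "int n"] by (simp add: algebra_simps)
  qed simp
  have "infinite (range (\<lambda>n::nat. of_nat n + 1/2 :: complex))"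
    by (rule range_inj_infinite) (auto simp: inj_on_def)
  moreover have "range (\<lambda>n::nat. of_nat n + 1/2 :: complex) \<subseteq> {s. poly (q - [:poly q (1/2):]) s = 0}"
    using c by auto
  ultimately have "q - [:poly q (1/2):] = 0"
    using poly_roots_finite finite_subset by blast
  then show ?thesis by auto
qed

lemma poly_zero_if_squares:
  fixes q :: "complex poly"
  assumes "\<And>n::int. poly q ((of_int n + 1/2)^2) = 0"
  shows "q = 0"
proof -
  have "inj (\<lambda>n::nat. (of_nat n + 1/2 :: complex)^2)"
  proof (rule injI)
    fix m n :: nat
    assume "(of_nat m + 1/2 :: complex)^2 = (of_nat n + 1/2)^2"
    then have "complex_of_real ((real m + 1/2)^2) = complex_of_real ((real n + 1/2)^2)"
      by simp
    then have "(real m + 1/2)^2 = (real n + 1/2)^2"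
      unfolding of_real_eq_iff .
    then show "m = n"
      by (simp add: power2_eq_iff_nonneg)
  qed
  then have "infinite (range (\<lambda>n::nat. (of_nat n + 1/2 :: complex)^2))"
    by (rule range_inj_infinite)
  moreover have "range (\<lambda>n::nat. (of_nat n + 1/2 :: complex)^2) \<subseteq> {s. poly q s = 0}"
    using assms[of "int _"] by auto
  ultimately show ?thesis
    using poly_roots_finite finite_subset by blast
qed

text \<open>The constants \<open>[:c:]\<close> are the scalars by which \<open>t\<close> acts. The
  value 0 is excluded because some applications first cancel a factor \<open>c\<close>.\<close>

lemma poly_poly_zero:
  fixes S :: "complex poly poly"
  assumes "\<And>c. c \<noteq> 0 \<Longrightarrow> poly S [:c:] = 0"
  shows "S = 0"
proof -
  have "infinite (range (\<lambda>n::nat. [:of_nat (Suc n) :: complex:]))"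
    by (rule range_inj_infinite) (auto simp: inj_on_def)
  moreover have "range (\<lambda>n::nat. [:of_nat (Suc n) :: complex:]) \<subseteq> {s. poly S s = 0}"
    using assms by (auto simp del: of_nat_Suc)
  ultimately show ?thesis
    using poly_roots_finite finite_subset by blast
qed

section \<open>Gelfand-Tsetlin modules\<close>

text \<open>A Gelfand-Tsetlin type module: the Casimir element acts at \<open>(n, k)\<close> by the square of
  \<open>n + 1/2\<close> and \<open>h\<close> by \<open>k\<close>. The half-integral shift keeps the denominators nonzero.\<close>

type_synonym gt = "int \<Rightarrow> int \<Rightarrow> complex"

definition half :: "int \<Rightarrow> complex" where "half n = of_int n + 1/2"

lemma half_shift [simp]: "half (n + 1) = half n + 1" "half (n - 1) = half n - 1"
  by (simp_all add: half_def)

lemma half_nonzero [simp]: "half n \<noteq> 0" "half n \<noteq> 1" "half n + 1 \<noteq> 0"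
proof -
  have *: "half m \<noteq> 0" for m
  proof
    assume "half m = 0"
    then have "of_int (2 * m + 1) = (0::complex)" by (simp add: field_simps half_def)
    then have "2 * m + 1 = 0" unfolding of_int_eq_0_iff .
    then show False by presburger
  qed
  show "half n \<noteq> 0" "half n \<noteq> 1" "half n + 1 \<noteq> 0"
    using *[of n] *[of "n - 1"] *[of "n + 1"] by auto
qed

text \<open>With the other coefficient of \<open>x\<close> normalised to 1, the relation [x, y] = z
  reads c(n + 1) (half n + 1) - c(n) (half n - 1) = zp((half n)^2). The denominator is chosen so
  that, after multiplication by \<open>half n\<close>, the left-hand side is G(half n) - G(half n -
  1).\<close>

definition gt_c :: "complex poly \<Rightarrow> int \<Rightarrow> complex" where
  "gt_c G n = poly G (half n - 1) / (half n * (half n - 1))"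

definition gt_e :: "gt \<Rightarrow> gt" where "gt_e \<psi> n k = \<psi> n (k - 2)"
text \<open>Since \<open>e\<close> is a bare shift, the factor is forced by the value of
  \<open>cas\<close>: f e = (cas - (h + 1)^2) / 4. In the same way \<open>gt_y\<close> below is the
  commutator of \<open>gt_f\<close> and \<open>gt_x\<close>.\<close>

definition gt_f :: "gt \<Rightarrow> gt" where
  "gt_f \<psi> n k = (half n ^ 2 - (of_int k + 1)^2) / 4 * \<psi> n (k + 2)"
definition gt_h :: "gt \<Rightarrow> gt" where "gt_h \<psi> n k = of_int k * \<psi> n k"
definition gt_x :: "complex poly \<Rightarrow> gt \<Rightarrow> gt" where
  "gt_x G \<psi> n k = \<psi> (n + 1) (k - 1) + gt_c G n * \<psi> (n - 1) (k - 1)"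
definition gt_y :: "complex poly \<Rightarrow> gt \<Rightarrow> gt" where
  "gt_y G \<psi> n k = - (half n + of_int k + 1) / 2 * \<psi> (n + 1) (k + 1)
     + (half n - of_int k - 1) / 2 * gt_c G n * \<psi> (n - 1) (k + 1)"

lemmas gt_defs = gt_e_def gt_f_def gt_h_def gt_x_def gt_y_def

text \<open>The invariant \<open>om\<close> acts by 4 G(s) - (2 s - 1) zp(s^2) at s = half n, so
  asking that t = om + zt(cas) act by 4 \<tau> leaves exactly this G. The difference equation for G
  is then a reformulation of the equation for \<open>zt\<close>.\<close>

definition gpoly :: "complex poly \<Rightarrow> complex poly \<Rightarrow> complex \<Rightarrow> complex poly" where
  "gpoly zp zt \<tau> = smult (1/4) ([:-1, 2:] * pcompose zp [:0, 0, 1:] - pcompose zt [:0, 0, 1:]) + [:\<tau>:]"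

lemma gpoly_difference:
  assumes zt: "pcompose zt [:1, 2, 1:] - pcompose zt [:0, 0, 1:]
      = - ([:3, 2:] * pcompose zp [:1, 2, 1:] + [:-1, 2:] * pcompose zp [:0, 0, 1:])"
  shows "poly (gpoly zp zt \<tau>) s - poly (gpoly zp zt \<tau>) (s - 1) = s * poly zp (s * s)"
proof -
  have "1 + (s - 1) * (2 + (s - 1)) = s * s"
    by (simp add: algebra_simps)
  then have "poly zt (s * s) - poly zt ((s - 1) * (s - 1))
     = - ((3 + (s - 1) * 2) * poly zp (s * s) + ((s - 1) * 2 - 1) * poly zp ((s - 1) * (s - 1)))"
    using arg_cong[OF zt, of "\<lambda>p. poly p (s - 1)"]
    by (simp add: poly_pcompose) (simp add: algebra_simps)
  then have "poly zt (s * s) = poly zt ((s - 1) * (s - 1))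
     - ((3 + (s - 1) * 2) * poly zp (s * s) + ((s - 1) * 2 - 1) * poly zp ((s - 1) * (s - 1)))"
    by (simp only: diff_eq_eq) simp
  moreover have "poly (gpoly zp zt \<tau>) u = ((2 * u - 1) * poly zp (u * u) - poly zt (u * u)) / 4 + \<tau>" for u
    by (simp add: gpoly_def poly_pcompose field_simps) (simp add: algebra_simps)?
  moreover have "((2 * s - 1) * a - (v - ((3 + (s - 1) * 2) * a + ((s - 1) * 2 - 1) * b))) / 4 + \<tau>
      - (((2 * (s - 1) - 1) * b - v) / 4 + \<tau>) = s * a" for a b v :: complex
    by (simp add: field_simps)
  ultimately show ?thesis
    by metis
qed

text \<open>One module for each \<tau>. A single one would not see polynomials in \<open>t\<close>,
  because \<open>t\<close> acts on it by a scalar.\<close>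

locale hecke_rep = hecke_gen +
  fixes rep :: "complex \<Rightarrow> 'a \<Rightarrow> gt \<Rightarrow> gt"
  assumes rep_add: "rep \<tau> (a + b) \<psi> n k = rep \<tau> a \<psi> n k + rep \<tau> b \<psi> n k"
    and rep_mult: "rep \<tau> (a * b) \<psi> = rep \<tau> a (rep \<tau> b \<psi>)"
    and rep_scale: "rep \<tau> (c *\<^sub>C a) \<psi> n k = c * rep \<tau> a \<psi> n k"
    and rep_1: "rep \<tau> 1 \<psi> = \<psi>"
    and rep_e: "rep \<tau> e = gt_e" and rep_f: "rep \<tau> f = gt_f" and rep_h: "rep \<tau> h = gt_h"
    and rep_x: "rep \<tau> x = gt_x (gpoly zp zt \<tau>)"
    and rep_y: "rep \<tau> y = gt_y (gpoly zp zt \<tau>)"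
begin

lemma rep_0: "rep \<tau> 0 \<psi> n k = 0"
  using rep_scale[of \<tau> 0 0] by simp

lemma rep_minus: "rep \<tau> (- a) \<psi> n k = - rep \<tau> a \<psi> n k"
  using rep_scale[of \<tau> "-1" a] by simp

lemma rep_diff: "rep \<tau> (a - b) \<psi> n k = rep \<tau> a \<psi> n k - rep \<tau> b \<psi> n k"
  using rep_add[of \<tau> a "- b"] by (simp add: rep_minus)

lemmas rep_simps = rep_add rep_mult rep_scale rep_1 rep_e rep_f rep_h rep_x rep_y rep_0 rep_minus rep_diff

lemma rep_cas: "rep \<tau> cas \<psi> n k = half n ^ 2 * \<psi> n k"
  unfolding cas_def by (simp add: rep_simps gt_defs) (simp add: field_simps power2_eq_square)

lemma rep_peval: "rep \<tau> (peval cas r) \<psi> n k = poly r (half n ^ 2) * \<psi> n k"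
  by (induction r) (simp_all add: rep_simps rep_cas algebra_simps)

text \<open>The action of x p(s). Passing from n + 1 to n changes \<open>cas\<close> from (half n +
  1)^2 to (half n)^2, so s^2 and (s + 1)^2 take these values at s = - half n - 1; passing from n - 1
  to n corresponds to s = half n - 1.\<close>

definition xop :: "complex \<Rightarrow> complex poly \<Rightarrow> gt \<Rightarrow> gt" where
  "xop \<tau> p \<psi> n k = poly p (- half n - 1) * \<psi> (n + 1) (k - 1)
     + poly p (half n - 1) * gt_c (gpoly zp zt \<tau>) n * \<psi> (n - 1) (k - 1)"

lemma xop_add: "xop \<tau> (p + q) \<psi> n k = xop \<tau> p \<psi> n k + xop \<tau> q \<psi> n k"
  and xop_smult: "xop \<tau> (smult c p) \<psi> n k = c * xop \<tau> p \<psi> n k"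
  and xop_0: "xop \<tau> 0 \<psi> n k = 0"
  by (simp_all add: xop_def algebra_simps)

lemma rep_x1: "rep \<tau> x1 \<psi> n k = xop \<tau> [:0, 1:] \<psi> n k"
proof -
  have "rep \<tau> w \<psi> n k = half n ^ 2 * gt_x (gpoly zp zt \<tau>) \<psi> n k - gt_x (gpoly zp zt \<tau>) (\<lambda>n k. half n ^ 2 * \<psi> n k) n k"
    unfolding w_def comm_def by (simp add: rep_diff rep_mult rep_cas[abs_def] rep_x)
  then show ?thesis
    unfolding x1_def
    by (simp add: rep_scale rep_diff rep_x gt_x_def xop_def)
       (simp add: field_simps power2_eq_square)
qed

lemma rep_X: "rep \<tau> (X p) \<psi> n k = xop \<tau> p \<psi> n k"
proof -
  have "(\<forall>\<psi> n k. rep \<tau> (X p) \<psi> n k = xop \<tau> p \<psi> n k) \<and> (\<forall>\<psi> n k. rep \<tau> (X (pCons 0 p)) \<psi> n k = xop \<tau> (pCons 0 p) \<psi> n k)"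
  proof (induction p)
    case (pCons c p)
    have 1: "rep \<tau> (X (pCons c p)) \<psi> n k = xop \<tau> (pCons c p) \<psi> n k" for \<psi> n k
      unfolding X_pCons[of c p] rep_simps pCons(2)[THEN conjunct2, rule_format]
      by (simp add: gt_x_def xop_def algebra_simps)
    have 2: "rep \<tau> (X (pCons 0 (pCons c p))) \<psi> n k = xop \<tau> (pCons 0 (pCons c p)) \<psi> n k" for \<psi> n k
      unfolding X_pCons_0_pCons rep_add rep_scale rep_mult rep_x1 pCons(2)[THEN conjunct1, rule_format]
      by (simp add: rep_cas xop_def power2_eq_square) (simp add: algebra_simps)
    show ?case using 1 2 by blast
  qed (simp add: rep_0 xop_0)
  then show ?thesis by blast
qed

lemma rep_comm_f_X:
  "rep \<tau> (comm f (X p)) \<psi> n k = - (half n + of_int k + 1) / 2 * poly p (- half n - 1) * \<psi> (n + 1) (k + 1)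
     + (half n - of_int k - 1) / 2 * poly p (half n - 1) * gt_c (gpoly zp zt \<tau>) n * \<psi> (n - 1) (k + 1)"
  unfolding comm_def rep_diff rep_mult rep_X[abs_def] rep_f
  by (simp add: xop_def gt_f_def) (simp add: field_simps power2_eq_square)

lemma gpoly_half: "poly (gpoly zp zt \<tau>) (half n) = poly (gpoly zp zt \<tau>) (half n - 1) + half n * poly zp (half n ^ 2)"
  using gpoly_difference[OF zt, of \<tau> "half n"] by (simp add: algebra_simps power2_eq_square)

lemma rep_t: "rep \<tau> t \<psi> n k = 4 * \<tau> * \<psi> n k"
proof -
  let ?G = "poly (gpoly zp zt \<tau>)"
  let ?c = "gt_c (gpoly zp zt \<tau>)"
  have c: "?G (half n - 1) = ?c n * (half n * (half n - 1))" "?G (half n) = ?c (n + 1) * (half n * (half n + 1))"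
    by (simp_all add: gt_c_def)
  have "wy = comm f (X [:1, 2:])" by (simp add: w_X[symmetric] comm_w)
  then have "rep \<tau> om \<psi> n k = (?c (n + 1) * (half n + 1) * (2 * half n + 1) + ?c n * (half n - 1) * (2 * half n - 1)) * \<psi> n k"
    unfolding om_def w_X
    by (simp add: rep_diff rep_mult rep_X[abs_def] rep_comm_f_X[abs_def] rep_x rep_y)
       (simp add: gt_x_def gt_y_def xop_def, simp add: field_simps)
  also have "\<dots> = (?G (half n) * (2 * half n + 1) + ?G (half n - 1) * (2 * half n - 1)) / half n * \<psi> n k"
    unfolding c by (simp add: field_simps)
  finally have "rep \<tau> om \<psi> n k = \<dots>" .
  moreover have "?G (half n) = ((2 * half n - 1) * poly zp (half n ^ 2) - poly zt (half n ^ 2)) / 4 + \<tau>"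
    by (simp add: gpoly_def poly_pcompose power2_eq_square field_simps)
  moreover have "(g * (2 * half n + 1) + (g - half n * a) * (2 * half n - 1)) / half n * q + b * q = 4 * u * q"
    if "g = ((2 * half n - 1) * a - b) / 4 + u" for g a b u q
    unfolding that by (simp add: field_simps)
  ultimately show ?thesis
    unfolding t_def rep_add rep_peval using gpoly_half[of \<tau> n] by (metis add_diff_cancel_right')
qed

lemma rep_X2: "rep \<tau> (X2 R) \<psi> n k = xop \<tau> (poly R [:4 * \<tau>:]) \<psi> n k"
proof (induction R arbitrary: n k)
  case (pCons p R)
  then show ?case
    by (simp add: rep_add rep_mult rep_X rep_t xop_add xop_smult)
qed (simp add: rep_0 xop_0)

lemma rep_Z2: "rep \<tau> (Z2 P) \<psi> n k = poly (poly P [:4 * \<tau>:]) (half n ^ 2) * \<psi> n k"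
proof (induction P arbitrary: n k)
  case (pCons p P)
  then show ?case
    by (simp add: rep_add rep_mult rep_peval rep_t algebra_simps)
qed (simp add: rep_0)

text \<open>The squares of \<open>half n\<close> are infinitely many, so an invariant that acts by
  zero for a given \<tau> has its polynomial zero at t = 4 \<tau>. The extra factor \<open>t\<close>
  acts by a nonzero scalar as soon as \<tau> is nonzero.\<close>

lemma Z2_eq_0: "Z2 P * t = 0 \<Longrightarrow> P = 0"
proof (rule poly_poly_zero)
  fix c :: complex
  assume P: "Z2 P * t = 0" and c: "c \<noteq> 0"
  have "poly (poly P [:c:]) (half n ^ 2) = 0" for n
    using arg_cong[OF P, of "\<lambda>a. rep (c / 4) a (\<lambda>_ _. 1) n 0"] c
    by (simp add: rep_mult rep_Z2 rep_t rep_0)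
  then show "poly P [:c:] = 0"
    using poly_zero_if_squares by (simp add: half_def)
qed

section \<open>The images of x modulo inner derivations, and the relation [x, y] = z\<close>

definition symmetric :: "complex poly \<Rightarrow> bool" where
  "symmetric p \<longleftrightarrow> pcompose p [:-1, -1:] = p"

lemma symmetric_poly_poly:
  assumes "\<And>i. symmetric (coeff S i)"
  shows "symmetric (poly S [:c:])"
  using assms
proof (induction S)
  case (pCons p S)
  have "symmetric (coeff S i)" for i
    using pCons.prems[of "Suc i"] by simp
  moreover have "symmetric p"
    using pCons.prems[of 0] by simp
  ultimately show ?case
    using pCons.IH by (simp add: symmetric_def pcompose_add pcompose_smult)
qed (simp add: symmetric_def)

text \<open>Each coefficient in \<open>t\<close> is split into its symmetric and antisymmetric
  halves under s to -1 - s. The antisymmetric half is r((s + 1)^2) - r(s^2), which is the commutator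
  of r(cas) with \<open>x\<close>.\<close>

lemma symmetric_decomposition: "\<exists>Q S. (\<forall>i. symmetric (coeff S i)) \<and> X2 R = comm (Z2 Q) x + X2 S"
proof (induction R)
  case 0
  show ?case by (intro exI[of _ 0]) (simp add: symmetric_def)
next
  case (pCons p R)
  then obtain Q S where QS: "\<And>i. symmetric (coeff S i)" "X2 R = comm (Z2 Q) x + X2 S" by blast
  have invol: "pcompose (pcompose p [:-1, -1:]) [:-1, -1:] = p"
    by (intro poly_eq_poly_eq_iff[THEN iffD1] ext) (simp add: poly_pcompose)
  define q where "q = smult (1/2) (p + pcompose p [:-1, -1:])"
  have q: "symmetric q"
    by (simp add: symmetric_def q_def pcompose_add pcompose_smult invol add.commute)
  have pq: "p - q = smult (1/2) (p - pcompose p [:-1, -1:])"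
    by (rule poly_eqI) (simp add: q_def field_simps)
  have "pcompose (p - q) [:-1, -1:] = - (p - q)"
    unfolding pq by (simp add: pcompose_diff pcompose_smult invol smult_diff_right)
  then obtain r where r: "p - q = pcompose r [:1, 2, 1:] - pcompose r [:0, 0, 1:]"
    using antisymmetric_poly by blast
  have "X p = comm (peval cas r) x + X q"
    unfolding comm_peval_x r[symmetric] by (simp add: X_diff)
  moreover have "comm (t * Z2 Q) x = t * comm (Z2 Q) x"
    using comm_xt comm_swap[of t x] by (simp add: comm_mult_left)
  ultimately have "X2 (pCons p R) = comm (Z2 (pCons r Q)) x + X2 (pCons q S)"
    by (simp add: QS(2) comm_add_left distrib_left)
  moreover have "symmetric (coeff (pCons q S) i)" for i
    using q QS(1) by (simp add: coeff_pCons split: nat.split)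
  ultimately show ?case by blast
qed

text \<open>The hypothesis is a derivation applied to [x, y] = z. In its action the terms that shift
  n by two cancel at weight 0, and those returning to n through n + 1 carry p(half n) + p(- half n -
  1), which symmetry turns into 2 p(half n); likewise through n - 1. Clearing the denominators of
  \<open>gt_c\<close> shows that G p agrees at half n and half n - 1, so it is constant.\<close>

lemma symmetric_derivation_periodic:
  assumes sym: "\<And>i. symmetric (coeff S i)"
    and eq: "comm (X2 S) y + comm x (comm f (X2 S)) = 0"
  shows "\<exists>k. gpoly zp zt \<tau> * poly S [:4 * \<tau>:] = [:k:]"
proof (rule poly_constant_if_periodic)
  fix n :: int
  let ?p = "poly S [:4 * \<tau>:]" and ?G = "poly (gpoly zp zt \<tau>)"
  have "symmetric ?p"
    using sym by (rule symmetric_poly_poly)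
  then have p: "poly ?p u = poly ?p s" if "u = - 1 - s" for u s
    unfolding symmetric_def that using poly_pcompose[of ?p "[:-1, -1:]" s] by simp
  let ?c = "gt_c (gpoly zp zt \<tau>)"
  have c: "?G (half n - 1) = ?c n * (half n * (half n - 1))" "?G (half n) = ?c (n + 1) * (half n * (half n + 1))"
    by (simp_all add: gt_c_def)
  have X2: "rep \<tau> (X2 S) = xop \<tau> ?p" "rep \<tau> (X ?p) = xop \<tau> ?p"
    by (intro ext rep_X2 rep_X)+
  have comm_f: "rep \<tau> (comm f (X2 S)) = rep \<tau> (comm f (X ?p))"
    by (intro ext) (simp add: comm_def rep_diff rep_mult X2)
  have "poly ?p (- half n - 1) = poly ?p (half n)" "poly ?p (- half n) = poly ?p (half n - 1)"
    "poly ?p (- half n - 2) = poly ?p (half n + 1)"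
    by (rule p, simp)+
  note ps = this
  have "rep \<tau> (comm (X2 S) y + comm x (comm f (X2 S))) (\<lambda>_ _. 1) n 0
     = 2 * (?c (n + 1) * (half n + 1) * poly ?p (half n) - ?c n * (half n - 1) * poly ?p (half n - 1))"
    by (simp add: comm_def[of x] comm_def[of _ y] rep_diff rep_add rep_mult X2 comm_f rep_comm_f_X[abs_def] rep_x rep_y)
       (simp add: gt_x_def gt_y_def xop_def ps, simp add: field_simps)
  then have "?c (n + 1) * (half n + 1) * poly ?p (half n) = ?c n * (half n - 1) * poly ?p (half n - 1)"
    unfolding eq by (simp add: rep_0)
  then have "?G (half n) * poly ?p (half n) = ?G (half n - 1) * poly ?p (half n - 1)"
    unfolding c by (simp add: mult.assoc)
  then show "poly (gpoly zp zt \<tau> * ?p) (of_int n + 1/2) = poly (gpoly zp zt \<tau> * ?p) (of_int n - 1/2)"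
    by (simp add: half_def)
qed

end

section \<open>Derivations of infinitesimal Hecke algebras\<close>

lemma derivation_peval: "derivation d \<Longrightarrow> d a = 0 \<Longrightarrow> d (peval a p) = 0"
  by (induction p) (simp_all add: derivationD)

context hecke_gen
begin

lemma central_if:
  assumes "comm c e = 0" "comm c f = 0" "comm c h = 0" "comm c x = 0" "comm c y = 0"
  shows "comm c a = 0"
proof -
  have "derivation (\<lambda>_::'a. 0::'a)" by (simp add: derivation_def)
  from derivation_eqI[OF derivation_comm this] show ?thesis using assms by simp
qed

lemma t_central: "comm t a = 0"
  by (rule central_if) (simp_all add: comm_swap[of t])

lemma invariant_Z2:
  assumes "comm e c = 0" "comm h c = 0"
  shows "\<exists>P. c = Z2 P"
proof -
  have "NN 0 c"
    using assms by (intro highest_weight) (simp_all add: weight_def)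
  then show ?thesis by (rule NN_0)
qed

lemma derivation_cas:
  assumes "derivation d" "d e = 0" "d f = 0" "d h = 0"
  shows "d cas = 0"
  by (simp add: cas_def derivationD[OF assms(1)] assms(2-))

end

context hecke_rep
begin

lemma derivation_normal_form:
  assumes d: "derivation d"
  obtains a S where "\<And>\<tau>. \<exists>k. gpoly zp zt \<tau> * poly S [:4 * \<tau>:] = [:k:]"
    "d e = comm a e" "d f = comm a f" "d h = comm a h"
    "d x = comm a x + X2 S" "d y = comm a y + comm f (X2 S)"
proof -
  obtain a where a: "d e = comm a e" "d f = comm a f" "d h = comm a h"
    using derivation_inner_on_sl2[OF d] by blast
  define d1 where "d1 = (\<lambda>b. d b - comm a b)"
  have d1: "derivation d1"
    unfolding d1_def by (intro derivation_diff d derivation_comm)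
  have d1g: "d1 e = 0" "d1 f = 0" "d1 h = 0"
    by (simp_all add: d1_def a)
  \<comment> \<open>As \<open>d1\<close> vanishes on sl2, applying it to [e, x] = 0 and [h, x] = x
    shows that \<open>d1 x\<close> is again a highest weight vector of weight 1.\<close>
  have "comm e (d1 x) = 0" "comm h (d1 x) = d1 x"
    using derivationD(8)[OF d1, of e x] derivationD(8)[OF d1, of h x]
    by (simp_all add: d1g comm_ex comm_hx derivationD(4)[OF d1])
  then have "NN 1 (d1 x)"
    by (intro highest_weight) (simp_all add: weight_def)
  then obtain R where "d1 x = X2 R" using NN_1 by blast
  then obtain Q S where S: "\<And>i. symmetric (coeff S i)" and QS: "d1 x = comm (Z2 Q) x + X2 S"
    using symmetric_decomposition[of R] by auto
  define d2 where "d2 = (\<lambda>b. d1 b - comm (Z2 Q) b)"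
  have d2: "derivation d2"
    unfolding d2_def by (intro derivation_diff d1 derivation_comm)
  have Q: "comm (Z2 Q) e = 0" "comm (Z2 Q) f = 0" "comm (Z2 Q) h = 0"
    using comm_swap[of "Z2 Q"] by simp_all
  have d2g: "d2 e = 0" "d2 f = 0" "d2 h = 0"
    by (simp_all add: d2_def d1g Q)
  have d2x: "d2 x = X2 S"
    by (simp add: d2_def QS)
  have d2y: "d2 y = comm f (X2 S)"
    using derivationD(8)[OF d2, of f x] by (simp add: d2g comm_fx d2x)
  have "d2 (comm x y) = 0"
    unfolding comm_xy using derivation_peval[OF d2 derivation_cas[OF d2 d2g]] .
  then have "comm (X2 S) y + comm x (comm f (X2 S)) = 0"
    by (simp add: derivationD(8)[OF d2] d2x d2y)
  from symmetric_derivation_periodic[OF S this]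
  have "\<exists>k. gpoly zp zt \<tau> * poly S [:4 * \<tau>:] = [:k:]" for \<tau> .
  moreover have "d b = comm (a + Z2 Q) b + d2 b" for b
    by (simp add: d2_def d1_def comm_add_left)
  ultimately show thesis
    using that[of S "a + Z2 Q"] d2g d2x d2y by simp
qed

text \<open>A constant G would give half n * zp((half n)^2) = 0 for all n and hence zp = 0. So G has
  positive degree for every \<tau>, and a constant product of G with a value of \<open>S\<close>
  forces that value to vanish.\<close>

theorem derivation_inner:
  assumes "zp \<noteq> 0" and d: "derivation (d :: 'a \<Rightarrow> 'a)"
  shows "\<exists>a. \<forall>b. d b = comm a b"
proof -
  obtain a S where S: "\<And>\<tau>. \<exists>k. gpoly zp zt \<tau> * poly S [:4 * \<tau>:] = [:k:]"
    and eqs: "d e = comm a e" "d f = comm a f" "d h = comm a h"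
    "d x = comm a x + X2 S" "d y = comm a y + comm f (X2 S)"
    using derivation_normal_form[OF d] by blast
  have deg: "degree (gpoly zp zt \<tau>) \<noteq> 0" for \<tau>
  proof
    assume "degree (gpoly zp zt \<tau>) = 0"
    then obtain k where k: "gpoly zp zt \<tau> = [:k:]"
      by (metis degree_eq_zeroE)
    have "poly zp (half n ^ 2) = 0" for n
      using gpoly_half[of \<tau> n] unfolding k by simp
    then have "zp = 0"
      using poly_zero_if_squares by (simp add: half_def)
    then show False using assms(1) by simp
  qed
  have "S = 0"
  proof (rule poly_poly_zero)
    fix c :: complex
    obtain k where k: "gpoly zp zt (c / 4) * poly S [:c:] = [:k:]"
      using S[of "c / 4"] by auto
    show "poly S [:c:] = 0"
    proof (rule ccontr)
      assume nz: "poly S [:c:] \<noteq> 0"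
      moreover have "gpoly zp zt (c / 4) \<noteq> 0"
        using deg[of "c / 4"] by auto
      ultimately have "degree [:k:] = degree (gpoly zp zt (c / 4)) + degree (poly S [:c:])"
        unfolding k[symmetric] by (intro degree_mult_eq)
      then show False using deg[of "c / 4"] by simp
    qed
  qed
  then have "d b = comm a b" for b
    using eqs by - (rule derivation_eqI[OF d derivation_comm], simp_all)
  then show ?thesis by blast
qed

text \<open>Splits off the constant terms in \<open>s\<close>. A polynomial in \<open>t\<close>
  alone, times \<open>x\<close>, is a central multiple of \<open>x\<close>, as the Euler derivation
  requires.\<close>

lemma constant_coefficients_decomposition:
  "\<exists>T U c. S = T + U \<and> (\<forall>u. \<exists>k. poly T [:u:] = [:k:]) \<and> (\<forall>u. coeff (poly U [:u:]) 0 = 0) \<and>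
     X2 T = c * x \<and> (\<forall>a. comm c a = 0)"
proof (induction S)
  case 0
  show ?case by (intro exI[of _ 0]) simp
next
  case (pCons p S)
  then obtain T U c where IH: "S = T + U" "\<And>u. \<exists>k. poly T [:u:] = [:k:]"
    "\<And>u. coeff (poly U [:u:]) 0 = 0" "X2 T = c * x" "\<And>a. comm c a = 0" by blast
  let ?k = "coeff p 0"
  have "pCons p S = pCons [:?k:] T + pCons (p - [:?k:]) U"
    by (simp add: IH(1))
  moreover have "\<exists>k. poly (pCons [:?k:] T) [:u:] = [:k:]" for u
    using IH(2)[of u] by auto
  moreover have "coeff (poly (pCons (p - [:?k:]) U) [:u:]) 0 = 0" for u
    using IH(3)[of u] by (simp add: coeff_mult)
  moreover have "X2 (pCons [:?k:] T) = (?k *\<^sub>C 1 + t * c) * x"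
    using X_pCons[of ?k 0] by (simp add: IH(4) distrib_right mult.assoc)
  moreover have "comm (?k *\<^sub>C 1 + t * c) a = 0" for a
    by (simp add: comm_add_left comm_mult_left IH(5) t_central)
  ultimately show ?case by blast
qed

text \<open>For zero parameter \<open>gpoly\<close> is the constant \<tau>, so the normal form says
  that \<tau> times the value of \<open>S\<close> at t = 4 \<tau> is constant in \<open>s\<close>.
  For nonzero \<tau> this leaves nothing for the part \<open>U\<close> without constant
  term.\<close>

theorem derivation_euler:
  assumes zp: "zp = 0" "zt = 0" and d: "derivation (d :: 'a \<Rightarrow> 'a)" and E: "derivation E"
    and Eg: "E e = 0" "E f = 0" "E h = 0" "E x = x" "E y = y"
  shows "\<exists>c a. (\<forall>b. comm c b = 0) \<and> (\<forall>b. d b = c * E b + comm a b)"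
proof -
  obtain a S where S: "\<And>\<tau>. \<exists>k. gpoly zp zt \<tau> * poly S [:4 * \<tau>:] = [:k:]"
    and eqs: "d e = comm a e" "d f = comm a f" "d h = comm a h"
    "d x = comm a x + X2 S" "d y = comm a y + comm f (X2 S)"
    using derivation_normal_form[OF d] by blast
  obtain T U c where TU: "S = T + U" "\<And>u. \<exists>k. poly T [:u:] = [:k:]"
    "\<And>u. coeff (poly U [:u:]) 0 = 0" "X2 T = c * x" "\<And>a. comm c a = 0"
    using constant_coefficients_decomposition[of S] by blast
  have "U = 0"
  proof (rule poly_poly_zero)
    fix u :: complex
    assume u: "u \<noteq> 0"
    obtain k where k: "[:u / 4:] * poly S [:u:] = [:k:]"
      using S[of "u / 4"] by (auto simp: gpoly_def zp)
    obtain l where l: "poly T [:u:] = [:l:]" using TU(2) by blast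
    have "poly S [:u:] = smult (4 / u) ([:u / 4:] * poly S [:u:])"
      using u by simp
    moreover have "poly U [:u:] = poly S [:u:] - poly T [:u:]"
      using TU(1) by simp
    ultimately have "poly U [:u:] = [:4 / u * k - l:]"
      unfolding k l by simp
    then show "poly U [:u:] = 0"
      using TU(3)[of u] by simp
  qed
  then have X2S: "X2 S = c * x" using TU by simp
  have "derivation (\<lambda>b. c * E b + comm a b)"
  proof -
    have "c * (u * E v) = u * (c * E v)" for u v
      using TU(5)[of u] by (simp add: comm_eq_0_iff flip: mult.assoc)
    then show ?thesis
      by (simp add: derivation_def derivationD(1-3)[OF E] comm_add_right comm_mult_right
          distrib_left distrib_right mult.assoc scaleC_add_right add_ac)
  qed
  then have "d b = c * E b + comm a b" for b
    using TU(5)[of f] comm_swap[of f c]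
    by - (rule derivation_eqI[OF d], simp_all add: Eg eqs X2S comm_mult_right comm_fx add.commute)
  then show ?thesis using TU(5) by blast
qed

text \<open>For zero parameter \<open>om\<close> equals the central element \<open>t\<close>, and it
  is quadratic in \<open>x\<close> and \<open>y\<close>, so the Euler derivation doubles it while
  every inner derivation kills it. This gives 2 c t = 0, and the central \<open>c\<close> is a
  polynomial in \<open>cas\<close> and \<open>t\<close>.\<close>

theorem euler_not_inner:
  assumes zp: "zp = 0" "zt = 0" and E: "derivation E"
    and Eg: "E e = 0" "E f = 0" "E h = 0" "E x = x" "E y = y"
    and c: "\<And>b. comm c b = 0" and inner: "\<And>b. c * E b = comm a b"
  shows "c = 0"
proof -
  have "comm e c = 0" "comm h c = 0"
    using c[of e] c[of h] comm_swap[of _ c] by simp_all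
  then obtain P where P: "c = Z2 P" using invariant_Z2 by blast
  have cas: "E cas = 0" using derivation_cas[OF E Eg(1-3)] .
  have om: "om = t" unfolding t_def by (simp add: zp)
  have "E w = w" "E wy = wy"
    by (simp_all add: w_def wy_def derivationD[OF E] cas Eg)
  then have "E om = om + om"
    by (simp add: om_def derivationD[OF E] Eg)
  moreover have "comm a t = 0"
    using t_central[of a] comm_swap[of a t] by simp
  ultimately have "2 *\<^sub>C (c * t) = 0"
    using inner[of om] by (simp add: om distrib_left scaleC_expand)
  then have "P = 0"
    using Z2_eq_0 P by simp
  then show ?thesis using P by simp
qed

end

section \<open>Quotients of the free algebra\<close>

lemma poly_mapping_single_induct [case_names zero single add]:
  fixes p :: "'w \<Rightarrow>\<^sub>0 'b::monoid_add"
  assumes "P 0" "\<And>w c. P (Poly_Mapping.single w c)" "\<And>p q. P p \<Longrightarrow> P q \<Longrightarrow> P (p + q)"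
  shows "P p"
proof (induction p rule: update_induct)
  case (update p w c)
  have "Poly_Mapping.update w c p = Poly_Mapping.single w c + p"
    using update(1) by (intro poly_mapping_eqI) (auto simp: lookup_update lookup_add lookup_single in_keys_iff)
  then show ?case using update assms by simp
qed (rule assms)

instantiation complex :: complex_algebra
begin
definition scaleC_complex :: "complex \<Rightarrow> complex \<Rightarrow> complex" where "scaleC_complex = (*)"
instance by standard (simp_all add: scaleC_complex_def algebra_simps)
end

instantiation poly_mapping :: (monoid_add, complex_algebra) complex_algebra
begin

definition scaleC_poly_mapping :: "complex \<Rightarrow> ('a \<Rightarrow>\<^sub>0 'b) \<Rightarrow> 'a \<Rightarrow>\<^sub>0 'b" where
  "scaleC_poly_mapping c p = Poly_Mapping.single 0 (c *\<^sub>C 1) * p"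

instance
proof
  fix a b :: "'a \<Rightarrow>\<^sub>0 'b" and c d :: complex
  have "a * Poly_Mapping.single 0 (c *\<^sub>C 1) = Poly_Mapping.single 0 (c *\<^sub>C 1) * a"
    by (induction a rule: poly_mapping_single_induct) (simp_all add: mult_single distrib_left distrib_right)
  then show "a * (c *\<^sub>C b) = c *\<^sub>C (a * b)"
    by (simp add: scaleC_poly_mapping_def flip: mult.assoc)
qed (simp_all add: scaleC_poly_mapping_def algebra_simps single_add scaleC_add_left mult_single flip: mult.assoc)

end

abbreviation const :: "complex \<Rightarrow> 'g ncpoly" where
  "const c \<equiv> Poly_Mapping.single 0 c"

lemma scaleC_ncpoly: "c *\<^sub>C p = const c * (p :: 'g ncpoly)"
  by (simp add: scaleC_poly_mapping_def scaleC_complex_def)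

lemma ncpoly_induct [case_names one add scale gen]:
  fixes p :: "'g ncpoly"
  assumes "P 1" "\<And>p q. P p \<Longrightarrow> P q \<Longrightarrow> P (p + q)" "\<And>c p. P p \<Longrightarrow> P (c *\<^sub>C p)"
    "\<And>g p. P p \<Longrightarrow> P (gen g * p)"
  shows "P p"
proof (induction p rule: poly_mapping_single_induct)
  case zero
  show ?case using assms(3)[OF assms(1), of 0] by (simp add: scaleC_ncpoly)
next
  case (single w c)
  have "P (Poly_Mapping.single (Word l) 1)" for l
  proof (induction l)
    case Nil
    then show ?case using assms(1) by (simp flip: zero_word_def)
  next
    case (Cons g l)
    have "Poly_Mapping.single (Word (g # l)) 1 = gen g * Poly_Mapping.single (Word l) 1"
      by (simp add: gen_def mult_single plus_word_def)
    then show ?case using Cons assms(4) by simp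
  qed
  from assms(3)[OF this, of c "letters w"] show ?case
    by (simp add: mult_single scaleC_ncpoly)
qed (rule assms)

lemma carrier_free_alg [simp]: "carrier (free_alg UNIV) = UNIV"
  by (simp add: free_alg_def)

lemma free_alg_simps [simp]:
  "monoid.mult (free_alg S) = (*)" "one (free_alg S) = 1" "zero (free_alg S) = 0" "add (free_alg S) = (+)"
  "module.smult (free_alg S) c p = c *\<^sub>C p"
  by (simp_all add: free_alg_def mult_map_scale_conv_mult scaleC_ncpoly)

lemma ring_free_alg: "ring (free_alg S)"
proof (intro ringI abelian_groupI monoidI)
  have carrier: "p \<in> carrier (free_alg S) \<longleftrightarrow> (\<forall>w\<in>Poly_Mapping.keys p. set (letters w) \<subseteq> S)" for p
    by (simp add: free_alg_def)
  show "p \<oplus>\<^bsub>free_alg S\<^esub> q \<in> carrier (free_alg S)"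
    if "p \<in> carrier (free_alg S)" "q \<in> carrier (free_alg S)" for p q
    using that keys_add[of p q] unfolding carrier by auto
  show "p \<otimes>\<^bsub>free_alg S\<^esub> q \<in> carrier (free_alg S)"
    if "p \<in> carrier (free_alg S)" "q \<in> carrier (free_alg S)" for p q
    using that keys_mult[of p q] unfolding carrier by (force simp: plus_word_def)
  show "\<exists>q\<in>carrier (free_alg S). q \<oplus>\<^bsub>free_alg S\<^esub> p = \<zero>\<^bsub>free_alg S\<^esub>"
    if "p \<in> carrier (free_alg S)" for p
    using that by (intro bexI[of _ "- p"]) (auto simp: carrier in_keys_iff)
qed (simp_all add: algebra_simps, simp_all add: free_alg_def zero_word_def)

lemma free_alg_minus: "p \<in> carrier (free_alg S) \<Longrightarrow> a_inv (free_alg S) p = - p"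
proof -
  interpret ring "free_alg S" by (rule ring_free_alg)
  assume p: "p \<in> carrier (free_alg S)"
  then have "- p \<in> carrier (free_alg S)" by (auto simp: free_alg_def in_keys_iff)
  then show ?thesis using p by (intro minus_equality) simp_all
qed

lemma ideal_free_alg_iff:
  "ideal I (free_alg (UNIV :: 'g set)) \<longleftrightarrow> 0 \<in> I \<and> (\<forall>p\<in>I. \<forall>q\<in>I. p + q \<in> I) \<and> (\<forall>p\<in>I. \<forall>q. q * p \<in> I \<and> p * q \<in> I)"
proof
  assume "ideal I (free_alg (UNIV :: 'g set))"
  then interpret ideal I "free_alg (UNIV :: 'g set)" .
  show "0 \<in> I \<and> (\<forall>p\<in>I. \<forall>q\<in>I. p + q \<in> I) \<and> (\<forall>p\<in>I. \<forall>q. q * p \<in> I \<and> p * q \<in> I)"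
    using I_l_closed I_r_closed additive_subgroup.zero_closed[OF additive_subgroup_axioms]
      additive_subgroup.a_closed[OF additive_subgroup_axioms] by simp
next
  assume *: "0 \<in> I \<and> (\<forall>p\<in>I. \<forall>q\<in>I. p + q \<in> I) \<and> (\<forall>p\<in>I. \<forall>q. q * p \<in> I \<and> p * q \<in> I)"
  interpret ring "free_alg (UNIV :: 'g set)" by (rule ring_free_alg)
  have "- p \<in> I" if "p \<in> I" for p
    using * that by (metis mult_minus1)
  moreover have "inv\<^bsub>add_monoid (free_alg UNIV)\<^esub> p = - p" for p :: "'g ncpoly"
    unfolding a_inv_def[symmetric] by (simp add: free_alg_minus)
  ultimately have "subgroup I (add_monoid (free_alg (UNIV :: 'g set)))"
    using * by (intro group.subgroupI a_group) auto
  then show "ideal I (free_alg (UNIV :: 'g set))"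
    using * by (intro idealI ring_free_alg) auto
qed

text \<open>The ideal is a parameter of the type class, so that its quotient becomes a type with ring structure.\<close>

class ncideal =
  fixes nc_ideal :: "'a itself \<Rightarrow> sl2V ncpoly set"
  assumes ideal_nc_ideal: "ideal (nc_ideal TYPE('a)) (free_alg UNIV)"
    and nc_ideal_proper: "1 \<notin> nc_ideal TYPE('a)"
begin

lemma nc_ideal_closed:
  "0 \<in> nc_ideal TYPE('a)"
  "p \<in> nc_ideal TYPE('a) \<Longrightarrow> q \<in> nc_ideal TYPE('a) \<Longrightarrow> p + q \<in> nc_ideal TYPE('a)"
  "p \<in> nc_ideal TYPE('a) \<Longrightarrow> q * p \<in> nc_ideal TYPE('a)"
  "p \<in> nc_ideal TYPE('a) \<Longrightarrow> p * q \<in> nc_ideal TYPE('a)"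
  "p \<in> nc_ideal TYPE('a) \<Longrightarrow> - p \<in> nc_ideal TYPE('a)"
  "p \<in> nc_ideal TYPE('a) \<Longrightarrow> q \<in> nc_ideal TYPE('a) \<Longrightarrow> p - q \<in> nc_ideal TYPE('a)"
proof -
  show "0 \<in> nc_ideal TYPE('a)"
    and add: "p \<in> nc_ideal TYPE('a) \<Longrightarrow> q \<in> nc_ideal TYPE('a) \<Longrightarrow> p + q \<in> nc_ideal TYPE('a)"
    and mult: "p \<in> nc_ideal TYPE('a) \<Longrightarrow> q * p \<in> nc_ideal TYPE('a)"
    and "p \<in> nc_ideal TYPE('a) \<Longrightarrow> p * q \<in> nc_ideal TYPE('a)" for p q
    using ideal_nc_ideal unfolding ideal_free_alg_iff by blast+
  show minus: "p \<in> nc_ideal TYPE('a) \<Longrightarrow> - p \<in> nc_ideal TYPE('a)" for p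
    using mult[of p "-1"] by simp
  show "p \<in> nc_ideal TYPE('a) \<Longrightarrow> q \<in> nc_ideal TYPE('a) \<Longrightarrow> p - q \<in> nc_ideal TYPE('a)"
    using add[of p "- q"] minus[of q] by simp
qed

end

quotient_type (overloaded) 'a ncquot = "sl2V ncpoly" / "\<lambda>p q. p - q \<in> nc_ideal TYPE('a::ncideal)"
proof (rule equivpI)
  show "reflp (\<lambda>p q. p - q \<in> nc_ideal TYPE('a))"
    by (rule reflpI) (simp add: nc_ideal_closed)
  show "symp (\<lambda>p q. p - q \<in> nc_ideal TYPE('a))"
    by (rule sympI) (metis minus_diff_eq nc_ideal_closed(5))
  show "transp (\<lambda>p q. p - q \<in> nc_ideal TYPE('a))"
  proof (rule transpI)
    fix p q r :: "sl2V ncpoly"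
    assume "p - q \<in> nc_ideal TYPE('a)" "q - r \<in> nc_ideal TYPE('a)"
    then have "(p - q) + (q - r) \<in> nc_ideal TYPE('a)"
      by (rule nc_ideal_closed)
    then show "p - r \<in> nc_ideal TYPE('a)" by simp
  qed
qed

instantiation ncquot :: (ncideal) complex_algebra
begin

lift_definition zero_ncquot :: "'a ncquot" is 0 .
lift_definition one_ncquot :: "'a ncquot" is 1 .
lift_definition plus_ncquot :: "'a ncquot \<Rightarrow> 'a ncquot \<Rightarrow> 'a ncquot" is "(+)"
  by (metis add_diff_add nc_ideal_closed(2))
lift_definition uminus_ncquot :: "'a ncquot \<Rightarrow> 'a ncquot" is uminus
  by (metis minus_diff_minus nc_ideal_closed(5))
lift_definition minus_ncquot :: "'a ncquot \<Rightarrow> 'a ncquot \<Rightarrow> 'a ncquot" is "(-)"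
proof -
  fix p q r s :: "sl2V ncpoly"
  assume "p - q \<in> nc_ideal TYPE('a)" "r - s \<in> nc_ideal TYPE('a)"
  then have "(p - q) - (r - s) \<in> nc_ideal TYPE('a)"
    by (rule nc_ideal_closed(6))
  then show "p - r - (q - s) \<in> nc_ideal TYPE('a)"
    by (simp add: algebra_simps)
qed
lift_definition times_ncquot :: "'a ncquot \<Rightarrow> 'a ncquot \<Rightarrow> 'a ncquot" is "(*)"
proof -
  fix p q r s :: "sl2V ncpoly"
  assume "p - q \<in> nc_ideal TYPE('a)" "r - s \<in> nc_ideal TYPE('a)"
  then have "(p - q) * r + q * (r - s) \<in> nc_ideal TYPE('a)"
    by (intro nc_ideal_closed(2-4))
  then show "p * r - q * s \<in> nc_ideal TYPE('a)"
    by (simp add: algebra_simps)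
qed
lift_definition scaleC_ncquot :: "complex \<Rightarrow> 'a ncquot \<Rightarrow> 'a ncquot" is "\<lambda>c p. c *\<^sub>C p"
  by (simp add: nc_ideal_closed scaleC_ncpoly flip: right_diff_distrib)

lemma eq_ncquotI: "p = q \<Longrightarrow> p - q \<in> nc_ideal TYPE('a::ncideal)"
  by (simp add: nc_ideal_closed)

instance
proof
  fix a b c :: "'a ncquot" and k l :: complex
  show "a + b + c = a + (b + c)" "a + b = b + a" "0 + a = a" "- a + a = 0" "a - b = a + - b"
    by (transfer, rule eq_ncquotI, simp add: algebra_simps)+
  show "a * b * c = a * (b * c)" "1 * a = a" "a * 1 = a" "(a + b) * c = a * c + b * c" "a * (b + c) = a * b + a * c"
    by (transfer, rule eq_ncquotI, simp add: algebra_simps)+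
  show "(0 :: 'a ncquot) \<noteq> 1"
  proof (transfer, rule notI)
    assume "0 - 1 \<in> nc_ideal TYPE('a)"
    from nc_ideal_closed(5)[OF this] show False using nc_ideal_proper[where 'a='a] by simp
  qed
  show "k *\<^sub>C (a + b) = k *\<^sub>C a + k *\<^sub>C b" "(k + l) *\<^sub>C a = k *\<^sub>C a + l *\<^sub>C a"
    "k *\<^sub>C l *\<^sub>C a = (k * l) *\<^sub>C a" "1 *\<^sub>C a = a" "(k *\<^sub>C a) * b = k *\<^sub>C (a * b)"
    "a * (k *\<^sub>C b) = k *\<^sub>C (a * b)"
    by (transfer, rule eq_ncquotI, simp add: scaleC_add_right scaleC_add_left)+
qed

end

lemma abs_ncquot_simps:
  "abs_ncquot p + abs_ncquot q = abs_ncquot (p + q)" "abs_ncquot p * abs_ncquot q = abs_ncquot (p * q)"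
  "c *\<^sub>C abs_ncquot p = abs_ncquot (c *\<^sub>C p)" "abs_ncquot p - abs_ncquot q = abs_ncquot (p - q)"
  "- abs_ncquot p = abs_ncquot (- p)"
  by (simp_all add: plus_ncquot.abs_eq times_ncquot.abs_eq scaleC_ncquot.abs_eq minus_ncquot.abs_eq uminus_ncquot.abs_eq)

lemma abs_ncquot_eq_iff: "abs_ncquot p = (abs_ncquot q :: 'a::ncideal ncquot) \<longleftrightarrow> p - q \<in> nc_ideal TYPE('a)"
  by (rule ncquot.abs_eq_iff)

lemma abs_ncquot_1: "abs_ncquot 1 = 1" and abs_ncquot_0: "abs_ncquot 0 = 0"
  by (simp_all add: one_ncquot_def zero_ncquot_def)

section \<open>The free algebra acting on Gelfand-Tsetlin modules\<close>

definition gt_linear :: "(gt \<Rightarrow> gt) \<Rightarrow> bool" where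
  "gt_linear T \<longleftrightarrow> (\<forall>\<psi> \<phi> c. T (\<lambda>n k. \<psi> n k + c * \<phi> n k) = (\<lambda>n k. T \<psi> n k + c * T \<phi> n k))"

lemma gt_linear_0: "gt_linear T \<Longrightarrow> T (\<lambda>n k. 0) = (\<lambda>n k. 0)"
  unfolding gt_linear_def by (drule spec[of _ "\<lambda>n k. 0"], drule spec[of _ "\<lambda>n k. 0"], drule spec[of _ "-1"])
     (simp add: fun_eq_iff)

lemma gt_linear_scale:
  assumes "gt_linear T"
  shows "T (\<lambda>n k. c * \<phi> n k) = (\<lambda>n k. c * T \<phi> n k)"
  using assms[unfolded gt_linear_def, rule_format, of "\<lambda>n k. 0" c \<phi>] gt_linear_0[OF assms] by simp

lemma gt_linear_add: "gt_linear T \<Longrightarrow> T (\<lambda>n k. \<psi> n k + \<phi> n k) = (\<lambda>n k. T \<psi> n k + T \<phi> n k)"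
  unfolding gt_linear_def
  by (drule spec[of _ \<psi>], drule spec[of _ \<phi>], drule spec[of _ 1]) simp

definition act :: "('g \<Rightarrow> gt \<Rightarrow> gt) \<Rightarrow> 'g ncpoly \<Rightarrow> gt \<Rightarrow> gt" where
  "act T p \<psi> n k = (\<Sum>w\<in>Poly_Mapping.keys p. Poly_Mapping.lookup p w * foldr T (letters w) \<psi> n k)"

lemma act_0: "act T 0 \<psi> n k = 0"
  by (simp add: act_def)

lemma act_single: "act T (Poly_Mapping.single w c) \<psi> n k = c * foldr T (letters w) \<psi> n k"
  by (cases "c = 0") (simp_all add: act_def)

lemma act_add: "act T (p + q) \<psi> n k = act T p \<psi> n k + act T q \<psi> n k"
  unfolding act_def
  by (rule setsum_keys_plus_distrib[where f = "\<lambda>w c. c * foldr T (letters w) \<psi> n k"]) (simp_all add: distrib_right)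

lemma foldr_gt_linear: "(\<And>g. gt_linear (T g)) \<Longrightarrow> gt_linear (foldr T l)"
  by (induction l) (simp_all add: gt_linear_def)

lemma act_mult:
  assumes "\<And>g. gt_linear (T g)"
  shows "act T (p * q) \<psi> = act T p (act T q \<psi>)"
proof -
  have lin: "gt_linear (foldr T l)" for l
    by (rule foldr_gt_linear) (rule assms)
  have single: "act T (Poly_Mapping.single u a * q) \<psi> n k = act T (Poly_Mapping.single u a) (act T q \<psi>) n k" for u a n k
  proof (induction q rule: poly_mapping_single_induct)
    case zero
    then show ?case
      using gt_linear_0[OF lin] by (simp add: act_0[abs_def] act_single)
  next
    case (single v b)
    show ?case
      using gt_linear_scale[OF lin]
      by (simp add: mult_single act_single[abs_def] plus_word_def)
  next
    case (add q r)
    show ?case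
      using add gt_linear_add[OF lin] by (simp add: distrib_left act_add[abs_def] act_single)
  qed
  have "act T (p * q) \<psi> n k = act T p (act T q \<psi>) n k" for n k
    by (induction p rule: poly_mapping_single_induct) (simp_all add: act_0 single distrib_right act_add)
  then show ?thesis by blast
qed

lemma act_gen: "act T (gen g) \<psi> = T g \<psi>"
  by (intro ext) (simp add: gen_def act_single)

lemma act_1: "act T 1 \<psi> = \<psi>"
  by (intro ext) (simp add: act_single zero_word_def flip: single_one)

lemma act_scale: "act T (c *\<^sub>C p) \<psi> n k = c * act T p \<psi> n k"
  by (induction p rule: poly_mapping_single_induct)
     (simp_all add: act_0 act_add act_single scaleC_ncpoly mult_single distrib_left)

lemma act_minus: "act T (- p) \<psi> n k = - act T p \<psi> n k"
  using act_scale[of T "-1" p] by simp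

lemma act_diff: "act T (p - q) \<psi> n k = act T p \<psi> n k - act T q \<psi> n k"
  using act_add[of T p "- q"] by (simp add: act_minus)

definition act_kernel :: "('g \<Rightarrow> gt \<Rightarrow> gt) \<Rightarrow> 'g ncpoly set" where
  "act_kernel T = {p. \<forall>\<psi> n k. act T p \<psi> n k = 0}"

lemma act_kernel_iff: "p - q \<in> act_kernel T \<longleftrightarrow> act T p = act T q"
  by (simp add: act_kernel_def act_diff fun_eq_iff)

lemma ideal_act_kernel:
  assumes "\<And>g. gt_linear (T g)"
  shows "ideal (act_kernel T) (free_alg UNIV)"
proof -
  have 0: "act T q (\<lambda>n k. 0) n k = 0" for q n k
    using gt_linear_0[OF foldr_gt_linear, of T] assms by (simp add: act_def)
  have D: "act T p \<psi> = (\<lambda>n k. 0)" if "p \<in> act_kernel T" for p \<psi>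
    using that by (simp add: act_kernel_def fun_eq_iff)
  have I: "p \<in> act_kernel T" if "\<And>\<psi> n k. act T p \<psi> n k = 0" for p
    using that by (simp add: act_kernel_def)
  show ?thesis
    unfolding ideal_free_alg_iff
    by (intro conjI ballI allI I) (simp_all add: act_0 act_add act_mult[OF assms] D 0)
qed

lemma one_notin_act_kernel: "1 \<notin> act_kernel T"
  by (auto simp: act_kernel_def act_1 intro!: exI[of _ "\<lambda>_ _. 1"])

fun gt_op :: "complex poly \<Rightarrow> sl2V \<Rightarrow> gt \<Rightarrow> gt" where
  "gt_op G Ge = gt_e" | "gt_op G Gf = gt_f" | "gt_op G Gh = gt_h" | "gt_op G Gx = gt_x G" | "gt_op G Gy = gt_y G"

lemma gt_linear_gt_op: "gt_linear (gt_op G g)"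
  by (cases g) (simp_all add: gt_linear_def gt_defs fun_eq_iff field_simps)

definition nccas :: "sl2V ncpoly" where
  "nccas = gen Gh * gen Gh + 2 *\<^sub>C gen Gh + 1 + 4 *\<^sub>C (gen Gf * gen Ge)"

lemmas act_simps = act_mult[OF gt_linear_gt_op] act_add act_scale act_1 act_gen act_diff act_minus act_0

lemma act_nccas: "act (gt_op G) nccas \<psi> n k = half n ^ 2 * \<psi> n k"
  unfolding nccas_def by (simp add: act_simps gt_defs) (simp add: field_simps power2_eq_square)

lemma act_peval_nccas: "act (gt_op G) (peval nccas r) \<psi> n k = poly r (half n ^ 2) * \<psi> n k"
  by (induction r) (simp_all add: act_simps act_nccas algebra_simps)

lemma ncpoly_numeral: "2 * p = 2 *\<^sub>C (p :: 'g ncpoly)"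
  by (simp add: numeral_scaleC)

lemma relations_act_kernel: "sl2_relations \<union> action_relations \<subseteq> act_kernel (gt_op G)"
proof -
  have "p \<in> act_kernel (gt_op G)" if "p \<in> sl2_relations \<union> action_relations" for p
    using that unfolding sl2_relations_def action_relations_def comm_def ncpoly_numeral
    by (auto simp: act_kernel_def act_simps gt_defs) (simp_all add: field_simps power2_eq_square)
  then show ?thesis by blast
qed

text \<open>The only defining relation that constrains G; the others hold on the modules for every
  polynomial G.\<close>

lemma act_comm_xy:
  assumes "\<And>s. poly G s - poly G (s - 1) = s * poly r (s * s)"
  shows "act (gt_op G) (comm (gen Gx) (gen Gy)) = act (gt_op G) (peval nccas r)"
proof (intro ext)
  fix \<psi> :: gt and n k
  have c: "poly G (half n - 1) = gt_c G n * (half n * (half n - 1))" "poly G (half n) = gt_c G (n + 1) * (half n * (half n + 1))"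
    by (simp_all add: gt_c_def)
  have "half n * poly r (half n ^ 2) = half n * (gt_c G (n + 1) * (half n + 1) - gt_c G n * (half n - 1))"
    using assms[of "half n"] unfolding c by (simp add: power2_eq_square algebra_simps)
  then have r: "poly r (half n ^ 2) = gt_c G (n + 1) * (half n + 1) - gt_c G n * (half n - 1)"
    by simp
  show "act (gt_op G) (comm (gen Gx) (gen Gy)) \<psi> n k = act (gt_op G) (peval nccas r) \<psi> n k"
    unfolding act_peval_nccas r comm_def
    by (simp add: act_simps gt_x_def gt_y_def, simp add: field_simps)
qed

definition hecke_relations :: "complex poly \<Rightarrow> sl2V ncpoly set" where
  "hecke_relations r = sl2_relations \<union> action_relations \<union> {comm (gen Gx) (gen Gy) - peval nccas r}"

lemma abs_ncquot_comm: "comm (abs_ncquot p) (abs_ncquot q) = (abs_ncquot (comm p q) :: 'a::ncideal ncquot)"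
  by (simp add: comm_def abs_ncquot_simps)

lemma abs_ncquot_peval: "peval (abs_ncquot a) r = abs_ncquot (peval a r)"
  by (induction r) (simp_all add: abs_ncquot_0 abs_ncquot_simps flip: abs_ncquot_1)

abbreviation qgen :: "sl2V \<Rightarrow> 'a::ncideal ncquot" where "qgen g \<equiv> abs_ncquot (gen g)"

lemma hecke_gen_ncquot:
  assumes rel: "hecke_relations zp \<subseteq> nc_ideal TYPE('a::ncideal)"
    and zt: "pcompose zt [:1, 2, 1:] - pcompose zt [:0, 0, 1:]
      = - ([:3, 2:] * pcompose zp [:1, 2, 1:] + [:-1, 2:] * pcompose zp [:0, 0, 1:])"
  shows "hecke_gen (qgen Ge :: 'a ncquot) (qgen Gf) (qgen Gh) (qgen Gx) (qgen Gy) zp zt"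
    and "sl2_triple.cas (qgen Ge :: 'a ncquot) (qgen Gf) (qgen Gh) = abs_ncquot nccas"
proof -
  have *: "abs_ncquot p = (abs_ncquot q :: 'a ncquot)" if "p - q \<in> hecke_relations zp" for p q
    unfolding abs_ncquot_eq_iff using rel that by blast
  have "sl2_triple (qgen Ge :: 'a ncquot) (qgen Gf) (qgen Gh)"
    unfolding sl2_triple_def abs_ncquot_comm abs_ncquot_simps
    by (intro conjI *) (simp_all add: hecke_relations_def sl2_relations_def ncpoly_numeral)
  then interpret sl2_triple "qgen Ge :: 'a ncquot" "qgen Gf" "qgen Gh" .
  show cas: "cas = abs_ncquot nccas"
    unfolding cas_def nccas_def by (simp add: abs_ncquot_simps flip: abs_ncquot_1)
  interpret hecke "qgen Ge :: 'a ncquot" "qgen Gf" "qgen Gh" "qgen Gx" "qgen Gy" zp zt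
  proof
    show "comm (qgen Gx) (qgen Gy) = peval cas zp"
      unfolding cas abs_ncquot_comm abs_ncquot_peval
      by (rule *) (simp add: hecke_relations_def)
  qed (unfold abs_ncquot_comm abs_ncquot_simps abs_ncquot_0[symmetric],
      (rule *; simp add: hecke_relations_def action_relations_def)+, rule zt)
  show "hecke_gen (qgen Ge :: 'a ncquot) (qgen Gf) (qgen Gh) (qgen Gx) (qgen Gy) zp zt"
  proof
    fix S :: "'a ncquot \<Rightarrow> bool" and a
    assume S: "S 1" "\<And>a b. S a \<Longrightarrow> S b \<Longrightarrow> S (a + b)" "\<And>c a. S a \<Longrightarrow> S (c *\<^sub>C a)"
      "\<And>a. S a \<Longrightarrow> S (qgen Ge * a) \<and> S (qgen Gf * a) \<and> S (qgen Gh * a) \<and> S (qgen Gx * a) \<and> S (qgen Gy * a)"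
    have "S (abs_ncquot p)" for p
    proof (induction p rule: ncpoly_induct)
      case (gen g p)
      then show ?case using S(4)[of "abs_ncquot p"] by (cases g) (simp_all add: abs_ncquot_simps)
    qed (use S in \<open>auto simp: abs_ncquot_1 simp flip: abs_ncquot_simps\<close>)
    then show "S a" by (metis ncquot.abs_induct)
  qed
qed

text \<open>A class acts through an arbitrarily chosen representative; that the ideal acts by zero
  makes the choice irrelevant.\<close>

lemma hecke_rep_ncquot:
  assumes rel: "hecke_relations zp \<subseteq> nc_ideal TYPE('a::ncideal)"
    and zt: "pcompose zt [:1, 2, 1:] - pcompose zt [:0, 0, 1:]
      = - ([:3, 2:] * pcompose zp [:1, 2, 1:] + [:-1, 2:] * pcompose zp [:0, 0, 1:])"
    and ker: "\<And>\<tau>. nc_ideal TYPE('a) \<subseteq> act_kernel (gt_op (gpoly zp zt \<tau>))"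
  shows "hecke_rep (qgen Ge :: 'a ncquot) (qgen Gf) (qgen Gh) (qgen Gx) (qgen Gy) zp zt
    (\<lambda>\<tau> a. act (gt_op (gpoly zp zt \<tau>)) (rep_ncquot a))"
proof -
  interpret hecke_gen "qgen Ge :: 'a ncquot" "qgen Gf" "qgen Gh" "qgen Gx" "qgen Gy" zp zt
    using rel zt by (rule hecke_gen_ncquot)
  have rep: "act (gt_op (gpoly zp zt \<tau>)) (rep_ncquot (abs_ncquot p :: 'a ncquot)) = act (gt_op (gpoly zp zt \<tau>)) p" for \<tau> p
  proof -
    have "abs_ncquot (rep_ncquot (abs_ncquot p :: 'a ncquot)) = (abs_ncquot p :: 'a ncquot)"
      by (metis Quotient_abs_rep Quotient_ncquot)
    then show ?thesis
      unfolding abs_ncquot_eq_iff using ker[of \<tau>] act_kernel_iff by blast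
  qed
  show ?thesis
  proof (unfold_locales, goal_cases)
    case (1 \<tau> a b \<psi> n k)
    show ?case
      by (induction a rule: ncquot.abs_induct, induction b rule: ncquot.abs_induct)
         (simp add: abs_ncquot_simps rep act_add)
  next
    case (2 \<tau> a b \<psi>)
    show ?case
      by (induction a rule: ncquot.abs_induct, induction b rule: ncquot.abs_induct)
         (simp add: abs_ncquot_simps rep act_mult[OF gt_linear_gt_op])
  next
    case (3 \<tau> c a \<psi> n k)
    show ?case
      by (induction a rule: ncquot.abs_induct) (simp add: abs_ncquot_simps rep act_scale)
  next
    case (4 \<tau> \<psi>)
    show ?case by (simp add: rep act_1 flip: abs_ncquot_1)
  qed (simp_all add: rep fun_eq_iff act_gen)
qed

section \<open>Transfer to algebras given as records\<close>

lemma quot_module_simps: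
  "carrier (quot_module M N) = a_rcosets\<^bsub>M\<^esub> N" "monoid.mult (quot_module M N) = rcoset_mult M N"
  "one (quot_module M N) = N +>\<^bsub>M\<^esub> \<one>\<^bsub>M\<^esub>" "zero (quot_module M N) = N" "add (quot_module M N) = set_add M"
  "c \<odot>\<^bsub>quot_module M N\<^esub> B = (\<Union>a\<in>B. N +>\<^bsub>M\<^esub> (c \<odot>\<^bsub>M\<^esub> a))"
  by (simp_all add: quot_module_def FactRing_def)

text \<open>The computations take place in a type of class \<open>complex_algebra\<close>, the
  theorem speaks of records whose elements are cosets. The bijection \<Phi> carries derivations,
  center and cohomology from one to the other.\<close>

locale algebra_iso =
  fixes A :: "(complex, 'r) module" and \<Phi> :: "'h::complex_algebra \<Rightarrow> 'r"
  assumes bij: "bij_betw \<Phi> UNIV (carrier A)"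
    and iso_add: "\<Phi> a \<oplus>\<^bsub>A\<^esub> \<Phi> b = \<Phi> (a + b)" and iso_mult: "\<Phi> a \<otimes>\<^bsub>A\<^esub> \<Phi> b = \<Phi> (a * b)"
    and iso_one: "\<one>\<^bsub>A\<^esub> = \<Phi> 1" and iso_zero: "\<zero>\<^bsub>A\<^esub> = \<Phi> 0"
    and iso_scale: "c \<odot>\<^bsub>A\<^esub> \<Phi> a = \<Phi> (c *\<^sub>C a)"
begin

lemma carrier_iso: "carrier A = range \<Phi>"
  using bij by (simp add: bij_betw_def)

lemma iso_eq_iff [simp]: "\<Phi> a = \<Phi> b \<longleftrightarrow> a = b"
  using bij by (auto simp: bij_betw_def inj_on_def)

lemma iso_in_carrier [simp]: "\<Phi> a \<in> carrier A"
  by (simp add: carrier_iso)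

lemma inv_iso [simp]: "inv_into UNIV \<Phi> (\<Phi> a) = a"
  by (rule inv_f_f) (use bij in \<open>simp add: bij_betw_def\<close>)

sublocale ring A
proof (intro ringI abelian_groupI monoidI)
  show "\<exists>b\<in>carrier A. b \<oplus>\<^bsub>A\<^esub> a = \<zero>\<^bsub>A\<^esub>" if "a \<in> carrier A" for a
  proof -
    obtain a' where "a = \<Phi> a'" using \<open>a \<in> carrier A\<close> by (auto simp: carrier_iso)
    then show ?thesis
      by (intro bexI[of _ "\<Phi> (- a')"]) (simp_all add: iso_add iso_zero)
  qed
qed (auto simp: carrier_iso iso_add iso_mult iso_one iso_zero algebra_simps)

lemma iso_minus: "\<Phi> a \<ominus>\<^bsub>A\<^esub> \<Phi> b = \<Phi> (a - b)"
proof -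
  have "\<ominus>\<^bsub>A\<^esub> \<Phi> b = \<Phi> (- b)"
    by (rule minus_equality) (simp_all add: iso_add iso_zero)
  then show ?thesis by (simp add: minus_eq iso_add)
qed

definition lift :: "('h \<Rightarrow> 'h) \<Rightarrow> 'r \<Rightarrow> 'r" where
  "lift d = (\<lambda>b\<in>carrier A. \<Phi> (d (inv_into UNIV \<Phi> b)))"

lemma lift_iso [simp]: "lift d (\<Phi> b) = \<Phi> (d b)"
  by (simp add: lift_def)

lemma lift_eqI: "(\<And>b. F (\<Phi> b) = \<Phi> (d b)) \<Longrightarrow> F \<in> extensional (carrier A) \<Longrightarrow> F = lift d"
  by (rule extensionalityI[of _ "carrier A"]) (auto simp: carrier_iso lift_def)

lemma lift_inject: "lift d = lift d' \<longleftrightarrow> d = d'"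
  by (metis ext iso_eq_iff lift_iso)

lemma derivations_iso: "derivations A = lift ` {d. derivation d}"
proof (intro equalityI subsetI)
  fix D assume D: "D \<in> derivations A"
  define d where "d b = inv_into UNIV \<Phi> (D (\<Phi> b))" for b
  have d: "D (\<Phi> b) = \<Phi> (d b)" for b
  proof -
    have "D (\<Phi> b) \<in> range \<Phi>"
      using D unfolding derivations_def carrier_iso by (auto simp: PiE_iff)
    then show ?thesis by (auto simp: d_def)
  qed
  have ext: "D \<in> extensional (carrier A)"
    using D by (auto simp: derivations_def PiE_iff)
  have "d (a + b) = d a + d b" for a b
  proof -
    have "D (\<Phi> a \<oplus>\<^bsub>A\<^esub> \<Phi> b) = D (\<Phi> a) \<oplus>\<^bsub>A\<^esub> D (\<Phi> b)"
      using D by (simp add: derivations_def)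
    then show ?thesis by (simp add: iso_add d)
  qed
  moreover have "d (c *\<^sub>C a) = c *\<^sub>C d a" for c a
  proof -
    have "D (c \<odot>\<^bsub>A\<^esub> \<Phi> a) = c \<odot>\<^bsub>A\<^esub> D (\<Phi> a)"
      using D by (simp add: derivations_def)
    then show ?thesis by (simp add: iso_scale d)
  qed
  moreover have "d (a * b) = d a * b + a * d b" for a b
  proof -
    have "D (\<Phi> a \<otimes>\<^bsub>A\<^esub> \<Phi> b) = D (\<Phi> a) \<otimes>\<^bsub>A\<^esub> \<Phi> b \<oplus>\<^bsub>A\<^esub> \<Phi> a \<otimes>\<^bsub>A\<^esub> D (\<Phi> b)"
      using D by (simp add: derivations_def)
    then show ?thesis by (simp add: iso_add iso_mult d)
  qed
  ultimately have "derivation d" by (simp add: derivation_def)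
  moreover have "D = lift d" using d ext by (rule lift_eqI)
  ultimately show "D \<in> lift ` {d. derivation d}" by blast
next
  fix D assume "D \<in> lift ` {d. derivation d}"
  then obtain d where "derivation d" "D = lift d" by blast
  then show "D \<in> derivations A"
    by (auto simp: derivations_def carrier_iso iso_add iso_mult iso_scale derivationD(1-3) PiE_iff)
       (simp_all add: lift_def carrier_iso)
qed

lemma inner_derivation_iso: "inner_derivation A (\<Phi> a) = lift (comm a)"
  unfolding inner_derivation_def by (rule lift_eqI) (simp_all add: iso_mult iso_minus comm_def)

lemma inner_derivations_iso: "inner_derivations A = range (\<lambda>a. lift (comm a))"
  by (simp add: inner_derivations_def carrier_iso image_image inner_derivation_iso)

lemma derivations_inner:
  assumes "\<And>d :: 'h \<Rightarrow> 'h. derivation d \<Longrightarrow> \<exists>a. \<forall>b. d b = comm a b"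
  shows "derivations A \<subseteq> inner_derivations A"
proof
  fix D assume "D \<in> derivations A"
  then obtain d where d: "derivation d" "D = lift d" by (auto simp: derivations_iso)
  then obtain a where "d = comm a" using assms by blast
  then show "D \<in> inner_derivations A" using d by (auto simp: inner_derivations_iso)
qed

lemma center_iso: "center A = \<Phi> ` {c. \<forall>a. comm c a = 0}"
  by (auto simp: center_def carrier_iso iso_mult comm_eq_0_iff)

lemma cring_center: "cring (center_ring A)"
proof -
  have [simp]: "monoid.mult (center_ring A) = monoid.mult A" "add (center_ring A) = add A"
    "one (center_ring A) = one A" "zero (center_ring A) = zero A" "carrier (center_ring A) = \<Phi> ` {c. \<forall>a. comm c a = 0}"
    by (simp_all add: center_ring_def center_iso)
  have "ring (center_ring A)"
  proof (intro ringI abelian_groupI monoidI)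
    fix u assume "u \<in> carrier (center_ring A)"
    then obtain c where c: "u = \<Phi> c" "\<And>a. comm c a = 0" by auto
    then have "comm (- c) a = 0" for a by (simp add: comm_def)
    then show "\<exists>v\<in>carrier (center_ring A). v \<oplus>\<^bsub>center_ring A\<^esub> u = \<zero>\<^bsub>center_ring A\<^esub>"
      using c by (intro bexI[of _ "\<Phi> (- c)"]) (simp_all add: iso_add iso_zero)
  qed (auto simp: iso_add iso_mult iso_one iso_zero algebra_simps comm_add_left comm_mult_left)
  moreover have "u \<otimes>\<^bsub>center_ring A\<^esub> v = v \<otimes>\<^bsub>center_ring A\<^esub> u"
    if uv: "u \<in> carrier (center_ring A)" "v \<in> carrier (center_ring A)" for u v
  proof -
    obtain c c' where c: "u = \<Phi> c" "comm c c' = 0" "v = \<Phi> c'" using uv by auto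
    show ?thesis using c(2) by (simp add: c(1,3) iso_mult comm_def)
  qed
  ultimately show ?thesis
    by (intro cring.intro monoid.monoid_comm_monoidI ring.is_monoid)
qed

text \<open>The cohomology class of \<open>d\<close>, see \<open>coset_hclass\<close>. Writing it as
  a range over \<open>a\<close> lets the set operations of the quotient be computed by algebra in
  the type.\<close>

definition hclass :: "('h \<Rightarrow> 'h) \<Rightarrow> ('r \<Rightarrow> 'r) set" where
  "hclass d = range (\<lambda>a. lift (\<lambda>b. comm a b + d b))"

lemma lift_add: "(\<lambda>b\<in>carrier A. lift d b \<oplus>\<^bsub>A\<^esub> lift d' b) = lift (\<lambda>b. d b + d' b)"
  by (rule lift_eqI) (simp_all add: iso_add)

lemma lift_mult: "(\<lambda>b\<in>carrier A. \<Phi> c \<otimes>\<^bsub>A\<^esub> lift d b) = lift (\<lambda>b. c * d b)"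
  by (rule lift_eqI) (simp_all add: iso_mult)

lemma coset_hclass: "inner_derivations A +>\<^bsub>derivation_module A\<^esub> lift d = hclass d"
  by (auto simp: a_r_coset_def r_coset_def derivation_module_def inner_derivations_iso hclass_def lift_add)

lemma carrier_HH1: "carrier (HH1 A) = hclass ` {d. derivation d}"
proof -
  have "carrier (HH1 A) = (\<lambda>D. inner_derivations A +>\<^bsub>derivation_module A\<^esub> D) ` derivations A"
    unfolding HH1_def quot_module_simps A_RCOSETS_def' by (auto simp: derivation_module_def)
  also have "\<dots> = hclass ` {d. derivation d}"
    by (simp add: derivations_iso image_image coset_hclass)
  finally show ?thesis .
qed

lemma zero_HH1: "\<zero>\<^bsub>HH1 A\<^esub> = hclass (\<lambda>_. 0)"
  by (simp add: HH1_def quot_module_simps inner_derivations_iso hclass_def)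

lemma hclass_eqI: "(\<And>b. d b = comm a b + d' b) \<Longrightarrow> hclass d = hclass d'"
proof -
  assume *: "\<And>b. d b = comm a b + d' b"
  have 1: "(\<lambda>b. comm u b + d b) = (\<lambda>b. comm (u + a) b + d' b)" for u
    by (simp add: * comm_add_left add.assoc)
  have 2: "(\<lambda>b. comm u b + d' b) = (\<lambda>b. comm (u - a) b + d b)" for u
    by (simp add: * comm_diff_left add.assoc)
  show ?thesis
    unfolding hclass_def
  proof (intro equalityI image_subsetI)
    show "lift (\<lambda>b. comm u b + d b) \<in> range (\<lambda>a. lift (\<lambda>b. comm a b + d' b))" for u
      unfolding 1[of u] by (rule rangeI)
    show "lift (\<lambda>b. comm u b + d' b) \<in> range (\<lambda>a. lift (\<lambda>b. comm a b + d b))" for u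
      unfolding 2[of u] by (rule rangeI)
  qed
qed

lemma hclass_eqD: "hclass d = hclass d' \<Longrightarrow> \<exists>a. \<forall>b. d b = comm a b + d' b"
proof -
  assume "hclass d = hclass d'"
  moreover have "lift (\<lambda>b. comm 0 b + d b) \<in> hclass d" unfolding hclass_def by blast
  ultimately have "lift (\<lambda>b. comm 0 b + d b) \<in> hclass d'" by simp
  then obtain a where "lift (\<lambda>b. comm 0 b + d b) = lift (\<lambda>b. comm a b + d' b)"
    by (auto simp: hclass_def)
  then have "(\<lambda>b. comm 0 b + d b) = (\<lambda>b. comm a b + d' b)" unfolding lift_inject .
  then show ?thesis by (auto simp: fun_eq_iff)
qed

lemma add_HH1: "hclass d \<oplus>\<^bsub>HH1 A\<^esub> hclass d' = hclass (\<lambda>b. d b + d' b)"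
proof -
  have "hclass d \<oplus>\<^bsub>HH1 A\<^esub> hclass d' = (\<Union>D\<in>hclass d. \<Union>D'\<in>hclass d'. {\<lambda>b\<in>carrier A. D b \<oplus>\<^bsub>A\<^esub> D' b})"
    by (simp add: HH1_def quot_module_simps set_add_def set_mult_def derivation_module_def)
  also have "\<dots> = {lift (\<lambda>b. (comm a b + d b) + (comm a' b + d' b)) | a a'. True}"
    by (auto simp: hclass_def lift_add)
  also have "\<dots> = {lift (\<lambda>b. comm (a + a') b + (d b + d' b)) | a a'. True}"
    by (simp add: comm_add_left add_ac)
  also have "\<dots> = hclass (\<lambda>b. d b + d' b)"
    unfolding hclass_def by (auto, metis add_0_right)
  finally show ?thesis .
qed

text \<open>Scalar multiplication in the quotient is a union over all representatives. For central
  \<open>c\<close> one has c [a, b] = [c a, b], so all the cosets in the union coincide.\<close>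

lemma smult_HH1:
  assumes c: "\<And>a. comm c a = 0"
  shows "\<Phi> c \<odot>\<^bsub>HH1 A\<^esub> hclass d = hclass (\<lambda>b. c * d b)"
proof -
  have "comm (c * a) b = c * comm a b" for a b
    using c by (simp add: comm_mult_left)
  then have "hclass (\<lambda>b. c * (comm a b + d b)) = hclass (\<lambda>b. c * d b)" for a
    by (intro hclass_eqI[of _ "c * a"]) (simp add: distrib_left)
  then show ?thesis
    by (simp add: HH1_def quot_module_simps derivation_module_def hclass_def[of d] lift_mult)
       (simp add: coset_hclass[unfolded derivation_module_def])
qed

lemma derivation_add: "derivation d \<Longrightarrow> derivation d' \<Longrightarrow> derivation (\<lambda>b. d b + d' b :: 'h)"
  and derivation_zero: "derivation (\<lambda>_. 0 :: 'h)"
  and derivation_minus: "derivation d \<Longrightarrow> derivation (\<lambda>b. - d b :: 'h)"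
  by (simp_all add: derivation_def algebra_simps scaleC_add_right)

lemma derivation_central_mult:
  assumes "\<And>a. comm c a = 0" "derivation d"
  shows "derivation (\<lambda>b. c * d b :: 'h)"
proof -
  have "c * (u * d v) = u * (c * d v)" for u v
    using assms(1)[of u] by (simp add: comm_eq_0_iff flip: mult.assoc)
  then show ?thesis
    by (simp add: derivation_def derivationD(1-3)[OF assms(2)] distrib_left mult.assoc)
qed

lemma abelian_group_HH1: "abelian_group (HH1 A)"
proof (rule abelian_groupI)
  show "\<exists>y\<in>carrier (HH1 A). y \<oplus>\<^bsub>HH1 A\<^esub> m = \<zero>\<^bsub>HH1 A\<^esub>" if m: "m \<in> carrier (HH1 A)" for m
  proof -
    obtain d where d: "derivation d" "m = hclass d" using m by (auto simp: carrier_HH1)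
    then show ?thesis
      by (intro bexI[of _ "hclass (\<lambda>b. - d b)"]) (auto simp: add_HH1 zero_HH1 carrier_HH1 derivation_minus)
  qed
qed (auto simp: carrier_HH1 add_HH1 zero_HH1 derivation_add derivation_zero add_ac)

lemma module_HH1: "module (center_ring A) (HH1 A)"
proof (rule moduleI[OF cring_center abelian_group_HH1])
  have [simp]: "monoid.mult (center_ring A) = monoid.mult A" "add (center_ring A) = add A"
    "one (center_ring A) = one A" "carrier (center_ring A) = \<Phi> ` {c. \<forall>a. comm c a = 0}"
    by (simp_all add: center_ring_def center_iso)
  fix c1 c2 m1 m2
  assume "c1 \<in> carrier (center_ring A)" "c2 \<in> carrier (center_ring A)" "m1 \<in> carrier (HH1 A)" "m2 \<in> carrier (HH1 A)"
  then obtain a1 a2 d1 d2 where c: "c1 = \<Phi> a1" "\<And>b. comm a1 b = 0" "c2 = \<Phi> a2" "\<And>b. comm a2 b = 0"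
    and m: "m1 = hclass d1" "derivation d1" "m2 = hclass d2" "derivation d2"
    by (auto simp: carrier_HH1)
  have c': "comm (a1 + a2) b = 0" "comm (a1 * a2) b = 0" for b
    using c by (simp_all add: comm_add_left comm_mult_left)
  show "c1 \<odot>\<^bsub>HH1 A\<^esub> m1 \<in> carrier (HH1 A)"
    using c m by (auto simp: smult_HH1 carrier_HH1 derivation_central_mult)
  show "(c1 \<oplus>\<^bsub>center_ring A\<^esub> c2) \<odot>\<^bsub>HH1 A\<^esub> m1 = c1 \<odot>\<^bsub>HH1 A\<^esub> m1 \<oplus>\<^bsub>HH1 A\<^esub> c2 \<odot>\<^bsub>HH1 A\<^esub> m1"
    using c m c' by (simp add: smult_HH1 iso_add add_HH1 distrib_right)
  show "c1 \<odot>\<^bsub>HH1 A\<^esub> (m1 \<oplus>\<^bsub>HH1 A\<^esub> m2) = c1 \<odot>\<^bsub>HH1 A\<^esub> m1 \<oplus>\<^bsub>HH1 A\<^esub> c1 \<odot>\<^bsub>HH1 A\<^esub> m2"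
    using c m by (simp add: smult_HH1 add_HH1 distrib_left)
  show "(c1 \<otimes>\<^bsub>center_ring A\<^esub> c2) \<odot>\<^bsub>HH1 A\<^esub> m1 = c1 \<odot>\<^bsub>HH1 A\<^esub> (c2 \<odot>\<^bsub>HH1 A\<^esub> m1)"
    using c m c' by (simp add: smult_HH1 iso_mult mult.assoc)
next
  fix m assume "m \<in> carrier (HH1 A)"
  then show "\<one>\<^bsub>center_ring A\<^esub> \<odot>\<^bsub>HH1 A\<^esub> m = m"
    by (auto simp: carrier_HH1 smult_HH1 iso_one center_ring_def)
qed

text \<open>The basis is the class of \<open>E\<close>. If \<open>k\<close> and \<open>l\<close> are
  two coefficients of one class, then k - l is central and (k - l) E is inner, so
  \<open>indep\<close> gives k = l.\<close>

lemma free_module_HH1: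
  assumes E: "derivation (E :: 'h \<Rightarrow> 'h)"
    and span: "\<And>d :: 'h \<Rightarrow> 'h. derivation d \<Longrightarrow> \<exists>c a. (\<forall>b. comm c b = 0) \<and> (\<forall>b. d b = c * E b + comm a b)"
    and indep: "\<And>c a. (\<And>b. comm c b = 0) \<Longrightarrow> (\<And>b. c * E b = comm a b) \<Longrightarrow> c = 0"
  shows "free_module_of_rank (center_ring A) (HH1 A) 1"
proof -
  interpret H: module "center_ring A" "HH1 A" by (rule module_HH1)
  have carrier [simp]: "carrier (center_ring A) = \<Phi> ` {c. \<forall>a. comm c a = 0}"
    by (simp add: center_ring_def center_iso)
  let ?u = "\<lambda>_::nat. hclass E"
  have u: "?u \<in> {..<1} \<rightarrow> carrier (HH1 A)"
    using E by (simp add: carrier_HH1)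
  have sum: "(\<Oplus>\<^bsub>HH1 A\<^esub>i\<in>{..<1::nat}. c i \<odot>\<^bsub>HH1 A\<^esub> ?u i) = c 0 \<odot>\<^bsub>HH1 A\<^esub> hclass E"
    if "c 0 \<in> carrier (center_ring A)" for c
  proof -
    have "hclass E \<in> carrier (HH1 A)" using E by (simp add: carrier_HH1)
    then have "c 0 \<odot>\<^bsub>HH1 A\<^esub> hclass E \<in> carrier (HH1 A)" by (rule H.smult_closed[OF that])
    then show ?thesis by (simp add: lessThan_Suc)
  qed
  have "\<exists>!c. c \<in> {..<1::nat} \<rightarrow>\<^sub>E carrier (center_ring A) \<and> m = (\<Oplus>\<^bsub>HH1 A\<^esub>i\<in>{..<1}. c i \<odot>\<^bsub>HH1 A\<^esub> ?u i)"
    if "m \<in> carrier (HH1 A)" for m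
  proof -
    obtain d where d: "derivation d" "m = hclass d" using \<open>m \<in> carrier (HH1 A)\<close> by (auto simp: carrier_HH1)
    obtain k a where k: "\<And>b. comm k b = 0" and a: "\<And>b. d b = k * E b + comm a b"
      using span[OF d(1)] by blast
    have m: "m = hclass (\<lambda>b. k * E b)"
      unfolding d(2) by (rule hclass_eqI[of _ a]) (simp add: a add.commute)
    show ?thesis
    proof (rule ex1I[of _ "\<lambda>i\<in>{..<1}. \<Phi> k"])
      show "(\<lambda>i\<in>{..<1::nat}. \<Phi> k) \<in> {..<1} \<rightarrow>\<^sub>E carrier (center_ring A) \<and>
          m = (\<Oplus>\<^bsub>HH1 A\<^esub>i\<in>{..<1}. (\<lambda>i\<in>{..<1}. \<Phi> k) i \<odot>\<^bsub>HH1 A\<^esub> ?u i)"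
        using k by (subst sum) (auto simp: m smult_HH1)
    next
      fix c :: "nat \<Rightarrow> 'r"
      assume c: "c \<in> {..<1} \<rightarrow>\<^sub>E carrier (center_ring A) \<and> m = (\<Oplus>\<^bsub>HH1 A\<^esub>i\<in>{..<1}. c i \<odot>\<^bsub>HH1 A\<^esub> ?u i)"
      then have c0: "c 0 \<in> carrier (center_ring A)" by (auto simp: PiE_iff)
      then obtain l where l: "c 0 = \<Phi> l" "\<And>b. comm l b = 0" by auto
      have "hclass (\<lambda>b. k * E b) = hclass (\<lambda>b. l * E b)"
        using c sum[of c, OF c0] l by (simp add: m smult_HH1)
      from hclass_eqD[OF this] obtain a where "\<And>b. k * E b = comm a b + l * E b" by blast
      then have "(k - l) * E b = comm a b" for b
        by (simp add: left_diff_distrib)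
      moreover have "comm (k - l) b = 0" for b
        by (simp add: comm_diff_left k l)
      ultimately have "k - l = 0" using indep by blast
      then have "c 0 = \<Phi> k" using l by simp
      then show "c = (\<lambda>i\<in>{..<1}. \<Phi> k)"
        using c by (intro extensionalityI[of _ "{..<1}"]) (auto simp: PiE_iff)
    qed
  qed
  then show ?thesis
    unfolding free_module_of_rank_def by (intro conjI module_HH1 bexI[of _ ?u] ballI u)
qed

end

definition coset_of :: "'a::ncideal ncquot \<Rightarrow> sl2V ncpoly set" where
  "coset_of a = nc_ideal TYPE('a) +>\<^bsub>free_alg UNIV\<^esub> rep_ncquot a"

lemma coset_of_abs: "coset_of (abs_ncquot p :: 'a::ncideal ncquot) = nc_ideal TYPE('a) +>\<^bsub>free_alg UNIV\<^esub> p"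
proof -
  interpret ideal "nc_ideal TYPE('a)" "free_alg (UNIV :: sl2V set)" by (rule ideal_nc_ideal)
  have "abs_ncquot (rep_ncquot (abs_ncquot p :: 'a ncquot)) = (abs_ncquot p :: 'a ncquot)"
    by (metis Quotient_abs_rep Quotient_ncquot)
  then have "rep_ncquot (abs_ncquot p :: 'a ncquot) - p \<in> nc_ideal TYPE('a)"
    unfolding abs_ncquot_eq_iff .
  then show ?thesis
    unfolding coset_of_def using quotient_eq_iff_same_a_r_cos[OF ideal_axioms] by (simp add: a_minus_def free_alg_minus)
qed

lemma algebra_iso_ncquot:
  "algebra_iso (quot_module (free_alg UNIV) (nc_ideal TYPE('a::ncideal))) (coset_of :: 'a ncquot \<Rightarrow> _)"
proof -
  interpret ideal "nc_ideal TYPE('a)" "free_alg (UNIV :: sl2V set)" by (rule ideal_nc_ideal)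
  let ?A = "quot_module (free_alg UNIV) (nc_ideal TYPE('a))"
  have coset_eq: "nc_ideal TYPE('a) +>\<^bsub>free_alg UNIV\<^esub> p = nc_ideal TYPE('a) +>\<^bsub>free_alg UNIV\<^esub> q
      \<longleftrightarrow> p - q \<in> nc_ideal TYPE('a)" for p q
    using quotient_eq_iff_same_a_r_cos[OF ideal_axioms, of p q] by (simp add: a_minus_def free_alg_minus)
  show ?thesis
  proof
    have "inj (coset_of :: 'a ncquot \<Rightarrow> _)"
    proof (rule injI)
      fix a b :: "'a ncquot"
      assume "coset_of a = coset_of b"
      then show "a = b"
        by (induction a rule: ncquot.abs_induct, induction b rule: ncquot.abs_induct)
           (simp add: coset_of_abs coset_eq abs_ncquot_eq_iff)
    qed
    moreover have "range (coset_of :: 'a ncquot \<Rightarrow> _) = carrier ?A"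
    proof -
      have "range (coset_of :: 'a ncquot \<Rightarrow> _) = range (\<lambda>p. nc_ideal TYPE('a) +>\<^bsub>free_alg UNIV\<^esub> p)"
      proof (intro equalityI subsetI)
        fix c assume "c \<in> range (\<lambda>p. nc_ideal TYPE('a) +>\<^bsub>free_alg UNIV\<^esub> p)"
        then obtain p where "c = nc_ideal TYPE('a) +>\<^bsub>free_alg UNIV\<^esub> p" by blast
        then have "c = coset_of (abs_ncquot p :: 'a ncquot)" by (simp add: coset_of_abs)
        then show "c \<in> range (coset_of :: 'a ncquot \<Rightarrow> _)" by blast
      qed (auto simp: coset_of_def)
      then show ?thesis
        by (auto simp: quot_module_simps A_RCOSETS_def')
    qed
    ultimately show "bij_betw (coset_of :: 'a ncquot \<Rightarrow> _) UNIV (carrier ?A)"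
      by (simp add: bij_betw_def)
    fix a b :: "'a ncquot" and c :: complex
    obtain p q where ab: "a = abs_ncquot p" "b = abs_ncquot q"
      by (induction a rule: ncquot.abs_induct, induction b rule: ncquot.abs_induct) blast
    show "coset_of a \<oplus>\<^bsub>?A\<^esub> coset_of b = coset_of (a + b)"
      by (simp add: ab abs_ncquot_simps coset_of_abs quot_module_simps a_rcos_sum)
    show "coset_of a \<otimes>\<^bsub>?A\<^esub> coset_of b = coset_of (a * b)"
      by (simp add: ab abs_ncquot_simps coset_of_abs quot_module_simps rcoset_mult_add)
    show "\<one>\<^bsub>?A\<^esub> = coset_of (1 :: 'a ncquot)"
      by (simp add: coset_of_abs quot_module_simps flip: abs_ncquot_1)
    show "\<zero>\<^bsub>?A\<^esub> = coset_of (0 :: 'a ncquot)"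
      by (simp add: coset_of_abs quot_module_simps a_r_coset_def r_coset_def flip: abs_ncquot_0)
    have "nc_ideal TYPE('a) +>\<^bsub>free_alg UNIV\<^esub> (c *\<^sub>C (i + p)) = nc_ideal TYPE('a) +>\<^bsub>free_alg UNIV\<^esub> (c *\<^sub>C p)"
      if "i \<in> nc_ideal TYPE('a)" for i
      unfolding coset_eq using that by (simp add: scaleC_add_right) (simp add: scaleC_ncpoly nc_ideal_closed)
    then show "c \<odot>\<^bsub>?A\<^esub> coset_of a = coset_of (c *\<^sub>C a)"
      using nc_ideal_closed(1)[where 'a='a]
      by (auto simp: ab abs_ncquot_simps coset_of_abs quot_module_simps a_r_coset_def r_coset_def)
  qed
qed

section \<open>The center of the enveloping algebra of sl2\<close>

lemma carrier_free_alg_iff: "p \<in> carrier (free_alg S) \<longleftrightarrow> (\<forall>w\<in>Poly_Mapping.keys p. set (letters w) \<subseteq> S)"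
  by (simp add: free_alg_def)

lemma carrier_free_alg_add: "p \<in> carrier (free_alg S) \<Longrightarrow> q \<in> carrier (free_alg S) \<Longrightarrow> p + q \<in> carrier (free_alg S)"
  using ring.ring_simprules(1)[OF ring_free_alg, of p S q] by simp

lemma carrier_free_alg_mult: "p \<in> carrier (free_alg S) \<Longrightarrow> q \<in> carrier (free_alg S) \<Longrightarrow> p * q \<in> carrier (free_alg S)"
  using ring.ring_simprules(5)[OF ring_free_alg, of p S q] by simp

lemma carrier_free_alg_minus: "p \<in> carrier (free_alg S) \<Longrightarrow> - p \<in> carrier (free_alg S)"
  by (auto simp: carrier_free_alg_iff in_keys_iff)

lemma carrier_free_alg_diff: "p \<in> carrier (free_alg S) \<Longrightarrow> q \<in> carrier (free_alg S) \<Longrightarrow> p - q \<in> carrier (free_alg S)"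
  using carrier_free_alg_add[of p S "- q"] carrier_free_alg_minus[of q S] by simp

lemma carrier_free_alg_comm: "p \<in> carrier (free_alg S) \<Longrightarrow> q \<in> carrier (free_alg S) \<Longrightarrow> comm p q \<in> carrier (free_alg S)"
  unfolding comm_def by (intro carrier_free_alg_diff carrier_free_alg_mult)

lemma carrier_free_alg_scale: "p \<in> carrier (free_alg S) \<Longrightarrow> c *\<^sub>C p \<in> carrier (free_alg S)"
  unfolding scaleC_ncpoly
  by (intro carrier_free_alg_mult) (auto simp: carrier_free_alg_iff zero_word_def split: if_splits)

lemmas carrier_free_alg_closed = carrier_free_alg_add carrier_free_alg_mult carrier_free_alg_minus
  carrier_free_alg_diff carrier_free_alg_comm carrier_free_alg_scale

lemma gen_in_carrier: "g \<in> S \<Longrightarrow> gen g \<in> carrier (free_alg S)"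
  and one_in_carrier: "1 \<in> carrier (free_alg S)"
  and zero_in_carrier: "0 \<in> carrier (free_alg S)"
  by (simp_all add: carrier_free_alg_iff gen_def zero_word_def)

abbreviation "sl2_gens \<equiv> {Ge, Gf, Gh}"

lemma sl2_relations_carrier: "sl2_relations \<subseteq> carrier (free_alg sl2_gens)"
  unfolding sl2_relations_def ncpoly_numeral
  by (auto intro!: carrier_free_alg_closed gen_in_carrier)

lemma peval_carrier: "p \<in> carrier (free_alg S) \<Longrightarrow> peval p r \<in> carrier (free_alg S)"
  by (induction r) (auto intro!: carrier_free_alg_closed simp: zero_in_carrier one_in_carrier)

lemma nccas_carrier: "nccas \<in> carrier (free_alg sl2_gens)"
  unfolding nccas_def by (intro carrier_free_alg_closed gen_in_carrier one_in_carrier) auto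

lemma ideal_restrict:
  assumes "ideal J (free_alg UNIV)"
  shows "ideal (J \<inter> carrier (free_alg S)) (free_alg S)"
proof -
  interpret ring "free_alg S" by (rule ring_free_alg)
  have J: "0 \<in> J" "\<And>p q. p \<in> J \<Longrightarrow> q \<in> J \<Longrightarrow> p + q \<in> J" "\<And>p q. p \<in> J \<Longrightarrow> q * p \<in> J" "\<And>p q. p \<in> J \<Longrightarrow> p * q \<in> J"
    using assms unfolding ideal_free_alg_iff by blast+
  have "- p \<in> J" if "p \<in> J" for p
    using J(3)[OF that, of "-1"] by simp
  moreover have "inv\<^bsub>add_monoid (free_alg S)\<^esub> p = - p" if "p \<in> carrier (free_alg S)" for p
    unfolding a_inv_def[symmetric] using that by (simp add: free_alg_minus)
  ultimately have "subgroup (J \<inter> carrier (free_alg S)) (add_monoid (free_alg S))"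
    using J by (intro group.subgroupI a_group) (auto intro: carrier_free_alg_closed zero_in_carrier)
  then show ?thesis
    using J by (intro idealI ring_free_alg) (auto intro: carrier_free_alg_closed)
qed

lemma Idl_free_alg_minimal: "ideal J (free_alg S) \<Longrightarrow> R \<subseteq> J \<Longrightarrow> Idl\<^bsub>free_alg S\<^esub> R \<subseteq> J"
  by (rule ring.genideal_minimal[OF ring_free_alg])

lemma ideal_Idl: "R \<subseteq> carrier (free_alg S) \<Longrightarrow> ideal (Idl\<^bsub>free_alg S\<^esub> R) (free_alg S)"
  by (rule ring.genideal_ideal[OF ring_free_alg])

lemma Idl_superset: "R \<subseteq> carrier (free_alg S) \<Longrightarrow> R \<subseteq> Idl\<^bsub>free_alg S\<^esub> R"
  by (rule ring.genideal_self[OF ring_free_alg])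

abbreviation sl2_ideal :: "sl2V ncpoly set" where
  "sl2_ideal \<equiv> Idl\<^bsub>free_alg sl2_gens\<^esub> sl2_relations"

lemma ideal_sl2_ideal: "ideal sl2_ideal (free_alg sl2_gens)"
  by (rule ideal_Idl[OF sl2_relations_carrier])

text \<open>\<open>sl2_ideal\<close> is generated inside the free algebra on \<open>e\<close>,
  \<open>f\<close>, \<open>h\<close>, while \<open>J\<close> lives in the free algebra on all five
  letters; intersecting \<open>J\<close> with the smaller algebra gives an ideal there.\<close>

lemma sl2_ideal_subset:
  assumes "ideal J (free_alg UNIV)" "sl2_relations \<subseteq> J"
  shows "sl2_ideal \<subseteq> J"
  using Idl_free_alg_minimal[OF ideal_restrict[OF assms(1)], of sl2_relations sl2_gens] assms(2) sl2_relations_carrier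
  by blast

text \<open>The algebra retraction onto the free algebra on \<open>S\<close> that sends all other
  letters to 0. It brings membership in an ideal of the large free algebra back to the small
  one.\<close>

lift_definition restrict_words :: "'g set \<Rightarrow> 'g ncpoly \<Rightarrow> 'g ncpoly" is
  "\<lambda>S p w. if set (letters w) \<subseteq> S then p w else 0"
  by (rule finite_subset[rotated]) auto

lemma restrict_words_add: "restrict_words S (p + q) = restrict_words S p + restrict_words S q"
  by (transfer, auto)

lemma restrict_words_0 [simp]: "restrict_words S 0 = 0"
  by (transfer, auto)

lemma restrict_words_single:
  "restrict_words S (Poly_Mapping.single w c) = (if set (letters w) \<subseteq> S then Poly_Mapping.single w c else 0)"
  by (transfer, auto simp: when_def fun_eq_iff)

lemma restrict_words_mult: "restrict_words S (p * q) = restrict_words S p * restrict_words S q"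
proof (induction p rule: poly_mapping_single_induct)
  case (single u a)
  show ?case
    by (induction q rule: poly_mapping_single_induct)
       (simp_all add: restrict_words_single mult_single plus_word_def restrict_words_add distrib_left)
qed (simp_all add: restrict_words_add distrib_right)

lemma restrict_words_carrier: "restrict_words S p \<in> carrier (free_alg S)"
  unfolding carrier_free_alg_iff by (auto simp: in_keys_iff restrict_words.rep_eq split: if_splits)

lemma restrict_words_id: "p \<in> carrier (free_alg S) \<Longrightarrow> restrict_words S p = p"
  unfolding carrier_free_alg_iff by (intro poly_mapping_eqI) (auto simp: in_keys_iff restrict_words.rep_eq)

lemma ideal_restrict_words_vimage:
  assumes "ideal I (free_alg S)"
  shows "ideal (restrict_words S -` I) (free_alg UNIV)"
proof -
  interpret ideal I "free_alg S" by (rule assms)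
  show ?thesis
    unfolding ideal_free_alg_iff
    using additive_subgroup.zero_closed[OF additive_subgroup_axioms]
      additive_subgroup.a_closed[OF additive_subgroup_axioms] I_l_closed I_r_closed
    by (auto simp: restrict_words_add restrict_words_mult restrict_words_carrier)
qed

text \<open>The enveloping algebra of sl2 is the infinitesimal Hecke algebra with \<open>z = 0\<close> modulo \<open>x\<close> and \<open>y\<close>, so the
  description of invariants applies to it.\<close>

datatype sl2_param = Sl2_param

instantiation sl2_param :: ncideal
begin

definition nc_ideal_sl2_param :: "sl2_param itself \<Rightarrow> sl2V ncpoly set" where
  "nc_ideal_sl2_param _ = Idl\<^bsub>free_alg UNIV\<^esub> (sl2_relations \<union> {gen Gx, gen Gy})"

instance
proof
  show "ideal (nc_ideal TYPE(sl2_param)) (free_alg UNIV)"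
    unfolding nc_ideal_sl2_param_def by (rule ideal_Idl) simp
  \<comment> \<open>The trivial representation, in which every generator acts by zero, shows that
    the quotient is nonzero.\<close>
  let ?T = "\<lambda>(_::sl2V) (_::gt) (_::int) (_::int). 0::complex"
  have lin: "gt_linear (?T g)" for g by (simp add: gt_linear_def)
  have "act ?T p \<psi> n k = 0" if "p \<in> sl2_relations \<union> {gen Gx, gen Gy}" for p \<psi> n k
    using that unfolding sl2_relations_def comm_def ncpoly_numeral
    by (auto simp: act_diff act_add act_mult[of ?T, OF lin] act_scale act_gen)
  then have "nc_ideal TYPE(sl2_param) \<subseteq> act_kernel ?T"
    unfolding nc_ideal_sl2_param_def
    by (intro Idl_free_alg_minimal ideal_act_kernel lin) (auto simp: act_kernel_def)
  then show "1 \<notin> nc_ideal TYPE(sl2_param)"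
    using one_notin_act_kernel by blast
qed

end

text \<open>Modulo \<open>x\<close> and \<open>y\<close> the element \<open>om\<close> vanishes, and
  with parameter 0 so does \<open>t\<close>; an invariant is therefore a polynomial in the Casimir
  element alone. The congruence found in the large free algebra is then pulled back by
  \<open>restrict_words\<close>.\<close>

lemma commuting_sl2:
  assumes "w \<in> carrier (free_alg sl2_gens)" "\<And>g. g \<in> sl2_gens \<Longrightarrow> comm (gen g) w \<in> sl2_ideal"
  shows "\<exists>r. w - peval nccas r \<in> sl2_ideal"
proof -
  let ?J = "nc_ideal TYPE(sl2_param)"
  have J: "ideal ?J (free_alg UNIV)" "sl2_relations \<subseteq> ?J" "gen Gx \<in> ?J" "gen Gy \<in> ?J"
    using ideal_nc_ideal[where 'a = sl2_param] Idl_superset[of "sl2_relations \<union> {gen Gx, gen Gy}" UNIV]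
    by (auto simp: nc_ideal_sl2_param_def)
  have "hecke_relations 0 \<subseteq> ?J"
    using J unfolding hecke_relations_def action_relations_def comm_def
    by (auto intro: nc_ideal_closed)
  then interpret H: hecke_gen "qgen Ge :: sl2_param ncquot" "qgen Gf" "qgen Gh" "qgen Gx" "qgen Gy" 0 0
    by (rule hecke_gen_ncquot) simp
  have cas: "H.cas = abs_ncquot nccas"
    using \<open>hecke_relations 0 \<subseteq> ?J\<close> by (rule hecke_gen_ncquot(2)[of _ 0]) simp
  have "(qgen Gx :: sl2_param ncquot) = 0" "(qgen Gy :: sl2_param ncquot) = 0"
    using J by (simp_all add: abs_ncquot_eq_iff flip: abs_ncquot_0)
  then have "H.t = 0"
    unfolding H.t_def H.om_def H.w_def H.wy_def by simp
  have "sl2_ideal \<subseteq> ?J"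
    using J by (intro sl2_ideal_subset)
  then have "comm (qgen g :: sl2_param ncquot) (abs_ncquot w) = 0" if "g \<in> sl2_gens" for g
    using assms(2)[OF that] by (auto simp: abs_ncquot_comm abs_ncquot_eq_iff simp flip: abs_ncquot_0)
  then obtain P where P: "abs_ncquot w = H.Z2 P"
    using H.invariant_Z2[of "abs_ncquot w"] by auto
  obtain r where "H.Z2 P = peval H.cas r"
    by (cases P) (auto simp: \<open>H.t = 0\<close>)
  then have "abs_ncquot w = (abs_ncquot (peval nccas r) :: sl2_param ncquot)"
    unfolding P cas abs_ncquot_peval .
  then have "w - peval nccas r \<in> ?J"
    by (simp add: abs_ncquot_eq_iff)
  moreover have "?J \<subseteq> restrict_words sl2_gens -` sl2_ideal"
    unfolding nc_ideal_sl2_param_def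
  proof (rule Idl_free_alg_minimal[OF ideal_restrict_words_vimage[OF ideal_sl2_ideal]])
    have "restrict_words sl2_gens p \<in> sl2_ideal" if "p \<in> sl2_relations" for p
    proof -
      have "p \<in> carrier (free_alg sl2_gens)" "p \<in> sl2_ideal"
        using that sl2_relations_carrier Idl_superset[OF sl2_relations_carrier] by blast+
      then show ?thesis by (simp only: restrict_words_id)
    qed
    moreover have "0 \<in> sl2_ideal"
      using additive_subgroup.zero_closed[OF ideal.axioms(1)[OF ideal_sl2_ideal]] by simp
    ultimately show "sl2_relations \<union> {gen Gx, gen Gy} \<subseteq> restrict_words sl2_gens -` sl2_ideal"
      by (auto simp: gen_def restrict_words_single)
  qed
  ultimately have "restrict_words sl2_gens (w - peval nccas r) \<in> sl2_ideal" by blast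
  moreover have "w - peval nccas r \<in> carrier (free_alg sl2_gens)"
    using assms(1) by (intro carrier_free_alg_closed peval_carrier nccas_carrier)
  ultimately show ?thesis
    by (metis restrict_words_id)
qed

text \<open>Uniqueness of \<open>r\<close> is not claimed. The last property is enough: for a
  nonzero central element any such \<open>r\<close> is nonzero.\<close>

lemma center_U_sl2:
  assumes "z \<in> center U_sl2"
  obtains r where "z \<noteq> {}" "\<And>w. w \<in> z \<Longrightarrow> w - peval nccas r \<in> sl2_ideal" "r = 0 \<Longrightarrow> z = \<zero>\<^bsub>U_sl2\<^esub>"
proof -
  interpret ideal sl2_ideal "free_alg sl2_gens" by (rule ideal_sl2_ideal)
  have U: "U_sl2 = quot_module (free_alg sl2_gens) sl2_ideal"
    by (simp add: U_sl2_def presented_alg_def)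
  obtain w0 where w0: "w0 \<in> carrier (free_alg sl2_gens)" "z = sl2_ideal +>\<^bsub>free_alg sl2_gens\<^esub> w0"
    using assms unfolding center_def U quot_module_simps A_RCOSETS_def' by blast
  have coset_eq: "sl2_ideal +>\<^bsub>free_alg sl2_gens\<^esub> p = sl2_ideal +>\<^bsub>free_alg sl2_gens\<^esub> q \<longleftrightarrow> p - q \<in> sl2_ideal"
    if "p \<in> carrier (free_alg sl2_gens)" "q \<in> carrier (free_alg sl2_gens)" for p q
    using quotient_eq_iff_same_a_r_cos[OF ideal_axioms that] that by (simp add: a_minus_def free_alg_minus)
  have "comm (gen g) w0 \<in> sl2_ideal" if g: "g \<in> sl2_gens" for g
  proof -
    have gc: "gen g \<in> carrier (free_alg sl2_gens)" using g by (rule gen_in_carrier)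
    then have "sl2_ideal +>\<^bsub>free_alg sl2_gens\<^esub> gen g \<in> carrier U_sl2"
      unfolding U quot_module_simps by (rule a_rcosetsI[OF a_subset])
    then have "(sl2_ideal +>\<^bsub>free_alg sl2_gens\<^esub> gen g) \<otimes>\<^bsub>U_sl2\<^esub> z = z \<otimes>\<^bsub>U_sl2\<^esub> (sl2_ideal +>\<^bsub>free_alg sl2_gens\<^esub> gen g)"
      using assms by (simp add: center_def)
    then have "sl2_ideal +>\<^bsub>free_alg sl2_gens\<^esub> (gen g * w0) = sl2_ideal +>\<^bsub>free_alg sl2_gens\<^esub> (w0 * gen g)"
      unfolding w0(2) U quot_module_simps by (simp add: rcoset_mult_add gc w0(1))
    then show ?thesis
      unfolding comm_def using coset_eq carrier_free_alg_mult gc w0(1) by blast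
  qed
  then obtain r where r: "w0 - peval nccas r \<in> sl2_ideal"
    using commuting_sl2[OF w0(1)] by blast
  have z: "z = (\<lambda>i. i + w0) ` sl2_ideal"
    unfolding w0(2) by (auto simp: a_r_coset_def r_coset_def)
  show thesis
  proof
    show "z \<noteq> {}"
      using z additive_subgroup.zero_closed[OF additive_subgroup_axioms] by blast
    show "w - peval nccas r \<in> sl2_ideal" if "w \<in> z" for w
    proof -
      obtain i where "i \<in> sl2_ideal" "w = i + w0" using \<open>w \<in> z\<close> z by blast
      then show ?thesis
        using additive_subgroup.a_closed[OF additive_subgroup_axioms _ r] by (simp add: add_diff_eq)
    qed
    assume "r = 0"
    then have "sl2_ideal +>\<^bsub>free_alg sl2_gens\<^esub> w0 = sl2_ideal +>\<^bsub>free_alg sl2_gens\<^esub> 0"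
      using r coset_eq[OF w0(1) zero_in_carrier] by simp
    then show "z = \<zero>\<^bsub>U_sl2\<^esub>"
      unfolding w0(2) U quot_module_simps by (simp add: a_r_coset_def r_coset_def)
  qed
qed

lemma zero_in_center_U_sl2: "\<zero>\<^bsub>U_sl2\<^esub> \<in> center U_sl2"
proof -
  interpret ideal sl2_ideal "free_alg sl2_gens" by (rule ideal_sl2_ideal)
  interpret Q: ring "free_alg sl2_gens Quot sl2_ideal" by (rule quotient_is_ring)
  have U: "U_sl2 = quot_module (free_alg sl2_gens) sl2_ideal"
    by (simp add: U_sl2_def presented_alg_def)
  show ?thesis
    unfolding center_def U using Q.zero_closed Q.l_null Q.r_null by (simp add: quot_module_def)
qed

section \<open>The main theorem\<close>

definition hecke_ideal :: "sl2V ncpoly set \<Rightarrow> sl2V ncpoly set" where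
  "hecke_ideal z = Idl\<^bsub>free_alg UNIV\<^esub>
     (sl2_relations \<union> action_relations \<union> {comm (gen Gx) (gen Gy) - w | w. w \<in> z})"

lemma inf_hecke_eq: "inf_hecke z = quot_module (free_alg UNIV) (hecke_ideal z)"
  by (simp add: inf_hecke_def presented_alg_def hecke_ideal_def)

lemma ideal_hecke_ideal: "ideal (hecke_ideal z) (free_alg UNIV)"
  unfolding hecke_ideal_def by (rule ideal_Idl) simp

lemma hecke_ideal_superset:
  "sl2_relations \<union> action_relations \<union> {comm (gen Gx) (gen Gy) - w | w. w \<in> z} \<subseteq> hecke_ideal z"
  unfolding hecke_ideal_def by (rule Idl_superset) simp

lemma hecke_relations_subset:
  assumes z: "z \<noteq> {}" "\<And>w. w \<in> z \<Longrightarrow> w - peval nccas r \<in> sl2_ideal"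
  shows "hecke_relations r \<subseteq> hecke_ideal z"
proof -
  obtain w where w: "w \<in> z" using z(1) by blast
  have "sl2_ideal \<subseteq> hecke_ideal z"
    using hecke_ideal_superset by (intro sl2_ideal_subset ideal_hecke_ideal) blast
  then have "w - peval nccas r \<in> hecke_ideal z"
    using z(2)[OF w] by blast
  moreover have "comm (gen Gx) (gen Gy) - w \<in> hecke_ideal z"
    using hecke_ideal_superset w by blast
  ultimately have "(comm (gen Gx) (gen Gy) - w) + (w - peval nccas r) \<in> hecke_ideal z"
    using ideal_hecke_ideal[of z] unfolding ideal_free_alg_iff by blast
  then show ?thesis
    unfolding hecke_relations_def using hecke_ideal_superset[of z] by auto
qed

lemma hecke_ideal_act_kernel:
  assumes z: "\<And>w. w \<in> z \<Longrightarrow> w - peval nccas r \<in> sl2_ideal"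
    and zt: "pcompose zt [:1, 2, 1:] - pcompose zt [:0, 0, 1:]
      = - ([:3, 2:] * pcompose r [:1, 2, 1:] + [:-1, 2:] * pcompose r [:0, 0, 1:])"
  shows "hecke_ideal z \<subseteq> act_kernel (gt_op (gpoly r zt \<tau>))"
proof -
  let ?K = "act_kernel (gt_op (gpoly r zt \<tau>))"
  have K: "ideal ?K (free_alg UNIV)"
    by (rule ideal_act_kernel) (rule gt_linear_gt_op)
  have "sl2_ideal \<subseteq> ?K"
    using relations_act_kernel by (intro sl2_ideal_subset K) blast
  then have "act (gt_op (gpoly r zt \<tau>)) w = act (gt_op (gpoly r zt \<tau>)) (peval nccas r)" if "w \<in> z" for w
    using z[OF that] act_kernel_iff by blast
  then have "comm (gen Gx) (gen Gy) - w \<in> ?K" if "w \<in> z" for w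
    unfolding act_kernel_iff using act_comm_xy[OF gpoly_difference[OF zt]] that by simp
  then show ?thesis
    unfolding hecke_ideal_def using relations_act_kernel
    by (intro Idl_free_alg_minimal K) blast
qed

section \<open>The Euler derivation\<close>

definition xy_degree :: "sl2V word \<Rightarrow> nat" where
  "xy_degree w = length (filter (\<lambda>g. g \<in> {Gx, Gy}) (letters w))"

lift_definition euler :: "sl2V ncpoly \<Rightarrow> sl2V ncpoly" is "\<lambda>p w. of_nat (xy_degree w) * p w"
  by (rule finite_subset[rotated]) auto

lemma euler_single: "euler (Poly_Mapping.single w c) = Poly_Mapping.single w (of_nat (xy_degree w) * c)"
  by (transfer, auto simp: when_def fun_eq_iff)

lemma euler_add: "euler (p + q) = euler p + euler q"
  by (transfer, auto simp: distrib_left)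

lemma euler_0 [simp]: "euler 0 = 0"
  by (transfer, auto)

lemma euler_mult: "euler (p * q) = euler p * q + p * euler q"
proof (induction p rule: poly_mapping_single_induct)
  case (single u a)
  show ?case
  proof (induction q rule: poly_mapping_single_induct)
    case (single v b)
    show ?case
      by (simp add: euler_single mult_single xy_degree_def plus_word_def distrib_right distrib_left mult_ac flip: single_add)
  qed (simp_all add: euler_add algebra_simps)
qed (simp_all add: euler_add algebra_simps)

lemma derivation_euler_ncpoly: "derivation euler"
proof -
  have "euler (const c) = 0" for c
    by (simp add: euler_single xy_degree_def zero_word_def)
  then show ?thesis
    by (simp add: derivation_def euler_add euler_mult scaleC_ncpoly)
qed

lemma euler_gen: "euler (gen g) = (if g \<in> {Gx, Gy} then gen g else 0)"
  by (simp add: gen_def euler_single xy_degree_def)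

lemma euler_sl2: "p \<in> carrier (free_alg sl2_gens) \<Longrightarrow> euler p = 0"
proof -
  assume p: "p \<in> carrier (free_alg sl2_gens)"
  have "xy_degree w = 0" if "w \<in> Poly_Mapping.keys p" for w
    using p that unfolding carrier_free_alg_iff xy_degree_def by (auto simp: filter_empty_conv)
  then show ?thesis
    by (intro poly_mapping_eqI) (auto simp: euler.rep_eq in_keys_iff)
qed

text \<open>For zero parameter the ideal is homogeneous for the degree in \<open>x\<close> and
  \<open>y\<close>. By the Leibniz rule the \<open>p\<close> with both \<open>p\<close> and
  \<open>euler p\<close> in the ideal form an ideal, so generators suffice: \<open>euler\<close>
  multiplies the sl2 and action relations by 0 and 1, and sends [x, y] - w to 2 [x, y], which lies
  in the ideal because w = 0 is allowed.\<close>

lemma euler_hecke_ideal: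
  assumes "p \<in> hecke_ideal sl2_ideal"
  shows "euler p \<in> hecke_ideal sl2_ideal"
proof -
  let ?I = "hecke_ideal sl2_ideal"
  note D = derivationD[OF derivation_euler_ncpoly]
  have I: "0 \<in> ?I" "\<And>p q. p \<in> ?I \<Longrightarrow> q \<in> ?I \<Longrightarrow> p + q \<in> ?I" "\<And>p q. p \<in> ?I \<Longrightarrow> q * p \<in> ?I" "\<And>p q. p \<in> ?I \<Longrightarrow> p * q \<in> ?I"
    using ideal_hecke_ideal[of sl2_ideal] unfolding ideal_free_alg_iff by blast+
  have ideal: "ideal {p \<in> ?I. euler p \<in> ?I} (free_alg UNIV)"
    unfolding ideal_free_alg_iff using I by (auto simp: euler_add euler_mult)
  have rel: "p \<in> ?I \<and> euler p \<in> ?I" if "p \<in> sl2_relations \<union> action_relations" for p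
  proof
    show p: "p \<in> ?I" using that hecke_ideal_superset[of sl2_ideal] by blast
    have "euler p = 0 \<or> euler p = p"
      using that
    proof
      assume "p \<in> sl2_relations"
      then show ?thesis using euler_sl2 sl2_relations_carrier by blast
    qed (auto simp: action_relations_def D euler_gen)
    then show "euler p \<in> ?I" using p I(1) by auto
  qed
  have zero: "0 \<in> sl2_ideal"
    using additive_subgroup.zero_closed[OF ideal.axioms(1)[OF ideal_sl2_ideal]] by simp
  have xy: "comm (gen Gx) (gen Gy) \<in> ?I"
    using hecke_ideal_superset[of sl2_ideal] zero by force
  have "euler (comm (gen Gx) (gen Gy) - w) = comm (gen Gx) (gen Gy) + comm (gen Gx) (gen Gy)"
    if "w \<in> sl2_ideal" for w
  proof -
    have "w \<in> carrier (free_alg sl2_gens)"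
      using that additive_subgroup.a_subset[OF ideal.axioms(1)[OF ideal_sl2_ideal]] by blast
    then show ?thesis by (simp add: D euler_gen euler_sl2)
  qed
  then have "comm (gen Gx) (gen Gy) - w \<in> {p \<in> ?I. euler p \<in> ?I}" if "w \<in> sl2_ideal" for w
    using that I(2)[OF xy xy] hecke_ideal_superset[of sl2_ideal] by auto
  then have "sl2_relations \<union> action_relations \<union> {comm (gen Gx) (gen Gy) - w | w. w \<in> sl2_ideal} \<subseteq> {p \<in> ?I. euler p \<in> ?I}"
    using rel by blast
  from Idl_free_alg_minimal[OF ideal this] have "?I \<subseteq> {p \<in> ?I. euler p \<in> ?I}"
    by (simp only: hecke_ideal_def)
  then show ?thesis using assms by blast
qed

text \<open>The second assertion concerns the zero parameter only, but it is phrased for each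
  \<open>z\<close> so that one choice of parameter serves both assertions.\<close>

definition theorem_at :: "sl2V ncpoly set \<Rightarrow> bool" where
  "theorem_at z \<longleftrightarrow>
     (z \<noteq> \<zero>\<^bsub>U_sl2\<^esub> \<longrightarrow> derivations (inf_hecke z) \<subseteq> inner_derivations (inf_hecke z)) \<and>
     (z = \<zero>\<^bsub>U_sl2\<^esub> \<longrightarrow> free_module_of_rank (center_ring (inf_hecke z)) (HH1 (inf_hecke z)) 1)"

text \<open>A type cannot depend on the parameter \<open>z\<close>. It is enough to prove the theorem for one
  parameter, chosen to be a counterexample if there is any; its Hecke algebra is then
  available as a type.\<close>

definition test_param :: "sl2V ncpoly set" where
  "test_param = (if \<exists>z\<in>center U_sl2. \<not> theorem_at z then SOME z. z \<in> center U_sl2 \<and> \<not> theorem_at z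
     else \<zero>\<^bsub>U_sl2\<^esub>)"

lemma test_param_center: "test_param \<in> center U_sl2"
  unfolding test_param_def using zero_in_center_U_sl2 someI_ex[of "\<lambda>z. z \<in> center U_sl2 \<and> \<not> theorem_at z"] by auto

lemma theorem_if_test_param: "theorem_at test_param \<Longrightarrow> z \<in> center U_sl2 \<Longrightarrow> theorem_at z"
  unfolding test_param_def using someI_ex[of "\<lambda>z. z \<in> center U_sl2 \<and> \<not> theorem_at z"] by (auto split: if_splits)

datatype hecke_param = Hecke_param

instantiation hecke_param :: ncideal
begin

definition nc_ideal_hecke_param :: "hecke_param itself \<Rightarrow> sl2V ncpoly set" where
  "nc_ideal_hecke_param _ = hecke_ideal test_param"

instance
proof
  show "ideal (nc_ideal TYPE(hecke_param)) (free_alg UNIV)"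
    unfolding nc_ideal_hecke_param_def by (rule ideal_hecke_ideal)
  obtain r where r: "\<And>w. w \<in> test_param \<Longrightarrow> w - peval nccas r \<in> sl2_ideal"
    using center_U_sl2[OF test_param_center] by metis
  obtain zt where zt: "pcompose zt [:1, 2, 1:] - pcompose zt [:0, 0, 1:]
      = - ([:3, 2:] * pcompose r [:1, 2, 1:] + [:-1, 2:] * pcompose r [:0, 0, 1:])"
    using zt_exists by blast
  \<comment> \<open>The ideal acts by zero on a Gelfand-Tsetlin module, where 1 acts as the
    identity.\<close>
  show "1 \<notin> nc_ideal TYPE(hecke_param)"
    unfolding nc_ideal_hecke_param_def
    using hecke_ideal_act_kernel[OF r zt] one_notin_act_kernel by blast
qed

end

lemma algebra_iso_hecke: "algebra_iso (inf_hecke test_param) (coset_of :: hecke_param ncquot \<Rightarrow> _)"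
  unfolding inf_hecke_eq using algebra_iso_ncquot[where 'a = hecke_param]
  by (simp add: nc_ideal_hecke_param_def)

lemma hecke_rep_test_param:
  assumes "test_param \<noteq> {}" "\<And>w. w \<in> test_param \<Longrightarrow> w - peval nccas r \<in> sl2_ideal"
    and zt: "pcompose zt [:1, 2, 1:] - pcompose zt [:0, 0, 1:]
      = - ([:3, 2:] * pcompose r [:1, 2, 1:] + [:-1, 2:] * pcompose r [:0, 0, 1:])"
  shows "hecke_rep (qgen Ge :: hecke_param ncquot) (qgen Gf) (qgen Gh) (qgen Gx) (qgen Gy) r zt
    (\<lambda>\<tau> a. act (gt_op (gpoly r zt \<tau>)) (rep_ncquot a))"
  by (rule hecke_rep_ncquot)
     (unfold nc_ideal_hecke_param_def, rule hecke_relations_subset[OF assms(1,2)], assumption,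
      rule zt, rule hecke_ideal_act_kernel[OF assms(2) zt])

lemma zero_U_sl2: "\<zero>\<^bsub>U_sl2\<^esub> = sl2_ideal"
  by (simp add: U_sl2_def presented_alg_def quot_module_simps)

lemma theorem_at_test_param: "theorem_at test_param"
proof (cases "test_param = \<zero>\<^bsub>U_sl2\<^esub>")
  case False
  obtain r where r: "test_param \<noteq> {}" "\<And>w. w \<in> test_param \<Longrightarrow> w - peval nccas r \<in> sl2_ideal" "r \<noteq> 0"
    using center_U_sl2[OF test_param_center] False by metis
  obtain zt where zt: "pcompose zt [:1, 2, 1:] - pcompose zt [:0, 0, 1:]
      = - ([:3, 2:] * pcompose r [:1, 2, 1:] + [:-1, 2:] * pcompose r [:0, 0, 1:])"
    using zt_exists by blast
  interpret hecke_rep "qgen Ge :: hecke_param ncquot" "qgen Gf" "qgen Gh" "qgen Gx" "qgen Gy" r zt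
      "\<lambda>\<tau> a. act (gt_op (gpoly r zt \<tau>)) (rep_ncquot a)"
    using r(1,2) zt by (rule hecke_rep_test_param)
  show ?thesis
    using algebra_iso.derivations_inner[OF algebra_iso_hecke derivation_inner[OF r(3)]] False
    by (simp add: theorem_at_def)
next
  case True
  then have z: "test_param = sl2_ideal" by (simp add: zero_U_sl2)
  have zero: "0 \<in> sl2_ideal"
    using additive_subgroup.zero_closed[OF ideal.axioms(1)[OF ideal_sl2_ideal]] by simp
  \<comment> \<open>The zero of \<open>U_sl2\<close> is the coset \<open>sl2_ideal\<close> itself,
    so it is represented by r = 0, and zt = 0 solves the corresponding difference equation.\<close>
  interpret hecke_rep "qgen Ge :: hecke_param ncquot" "qgen Gf" "qgen Gh" "qgen Gx" "qgen Gy" 0 0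
      "\<lambda>\<tau> a. act (gt_op (gpoly 0 0 \<tau>)) (rep_ncquot a)"
    by (rule hecke_rep_test_param) (use z zero in auto)
  define E :: "hecke_param ncquot \<Rightarrow> hecke_param ncquot" where "E a = abs_ncquot (euler (rep_ncquot a))" for a
  have E: "E (abs_ncquot p) = abs_ncquot (euler p)" for p
  proof -
    have "abs_ncquot (rep_ncquot (abs_ncquot p :: hecke_param ncquot)) = (abs_ncquot p :: hecke_param ncquot)"
      by (metis Quotient_abs_rep Quotient_ncquot)
    then have "euler (rep_ncquot (abs_ncquot p :: hecke_param ncquot) - p) \<in> nc_ideal TYPE(hecke_param)"
      unfolding abs_ncquot_eq_iff nc_ideal_hecke_param_def z by (rule euler_hecke_ideal)
    then show ?thesis
      unfolding E_def abs_ncquot_eq_iff by (simp add: derivationD[OF derivation_euler_ncpoly])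
  qed
  have dE: "derivation E"
    unfolding derivation_def
  proof (intro conjI allI)
    fix a b :: "hecke_param ncquot" and c
    obtain p q where ab: "a = abs_ncquot p" "b = abs_ncquot q"
      by (induction a rule: ncquot.abs_induct, induction b rule: ncquot.abs_induct) blast
    note D = derivationD(1-3)[OF derivation_euler_ncpoly]
    show "E (a + b) = E a + E b" "E (c *\<^sub>C a) = c *\<^sub>C E a" "E (a * b) = E a * b + a * E b"
      by (simp_all add: ab abs_ncquot_simps E D)
  qed
  have Eg: "E (qgen Ge) = 0" "E (qgen Gf) = 0" "E (qgen Gh) = 0" "E (qgen Gx) = qgen Gx" "E (qgen Gy) = qgen Gy"
    by (simp_all add: E euler_gen abs_ncquot_0)
  interpret A: algebra_iso "inf_hecke test_param" "coset_of :: hecke_param ncquot \<Rightarrow> _"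
    by (rule algebra_iso_hecke)
  have "free_module_of_rank (center_ring (inf_hecke test_param)) (HH1 (inf_hecke test_param)) 1"
    using derivation_euler[OF refl refl _ dE Eg] euler_not_inner[OF refl refl dE Eg]
    by (intro A.free_module_HH1[OF dE]) blast+
  then show ?thesis
    using True by (simp add: theorem_at_def)
qed

theorem theorem0p2:
  shows "(\<forall>z\<in>center U_sl2. z \<noteq> \<zero>\<^bsub>U_sl2\<^esub> \<longrightarrow>
            derivations (inf_hecke z) \<subseteq> inner_derivations (inf_hecke z)) \<and>
         free_module_of_rank (center_ring (inf_hecke \<zero>\<^bsub>U_sl2\<^esub>)) (HH1 (inf_hecke \<zero>\<^bsub>U_sl2\<^esub>)) 1"
  using theorem_if_test_param[OF theorem_at_test_param] zero_in_center_U_sl2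
  unfolding theorem_at_def by blast

end
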